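(* Let $\mathcal X$ be the Siegel space associated to $\mathrm{Sp}(4,\mathbb R)$. The space $\mathcal H$ of ordered right-angled hexagons in $\mathcal X$ is parametrized up to isometry by $$\mathcal A:=\big(\overline{\mathfrak a}^{3}\times[0,2\pi)^2\big)/\sim ,$$ where angles are read modulo $2\pi$ and $\sim$ is the equivalence relation generated by $(\underline b,\underline c,\underline d,\alpha_1,\alpha_2)\sim(\underline b,\underline c,\underline d,2\pi-\alpha_1,2\pi-\alpha_2)$ together with: (i) if $\underline b\in\mathfrak d$: $(\underline b,\underline c,\underline d,\alpha_1,\alpha_2)\sim(\underline b,\underline c,\underline d,\overline\alpha_1,\alpha_2)$ for all $\overline\alpha_1$; (ii) if $\underline c\in\mathfrak d$: $(\underline b,\underline c,\underline d,\alpha_1,\alpha_2)\sim(\underline b,\underline c,\underline d,\overline\alpha_1,\overline\alpha_2)$ for all $\overline\alpha_1,\overline\alpha_2$ with $\overline\alpha_1+\overline\alpha_2=\alpha_1+\alpha_2$ (modulo $2\pi$); (iii) if $\underline d\in\mathfrak d$: $(\underline b,\underline c,\underline d,\alpha_1,\alpha_2)\sim(\underline b,\underline c,\underline d,\alpha_1,\overline\alpha_2)$ for all $\overline\alpha_2$. That is, the arc-coordinate map $\Phi$ (defined in the context) induces a bijection $\mathcal A\to\mathcal H/\mathrm{PSp}(4,\mathbb R)$.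
   Context: $\mathrm{Sp}(4,\mathbb R)$ preserves the symplectic form with matrix $J=\begin{pmatrix}0&\mathrm{Id}\\-\mathrm{Id}&0\end{pmatrix}$, $\mathrm{PSp}(4,\mathbb R)=\mathrm{Sp}(4,\mathbb R)/\{\pm\mathrm{Id}\}$, $\mathcal X=\{X+iY: X\in\mathrm{Sym}(2,\mathbb R),\,Y\in\mathrm{Sym}^+(2,\mathbb R)\}$ with action $Z\mapsto(AZ+B)(CZ+D)^{-1}$. $\mathcal L(\mathbb R^4)$ is the set of Lagrangians; a real symmetric matrix $X$ denotes the Lagrangian spanned by the columns of $\binom{X}{\mathrm{Id}}$, and $\infty=\langle e_1,e_2\rangle$. A triple of pairwise transverse Lagrangians is maximal if it is in the $\mathrm{Sp}(4,\mathbb R)$-orbit of $(\infty,0,\mathrm{Id})$ (so $(\infty,X,Y)$ is maximal iff $Y-X$ is positive definite); an $m$-tuple $(l_1,\dots,l_m)$ is maximal if $(l_i,l_j,l_k)$ is maximal for all $i<j<k$. Cross-ratio: for $l_1$ transverse to $l_2$ and $l_3$ transverse to $l_4$, $R(l_1,l_2,l_3,l_4)=p_{l_1}^{\|l_2}\circ p_{l_4}^{\|l_3}|_{l_1}$, where $p_{l}^{\|l'}$ is the projection to $l$ parallel to $l'$; for symmetric matrices it equals $(X_1-X_2)^{-1}(X_4-X_2)(X_4-X_3)^{-1}(X_1-X_3)$. The $\mathbb R$-tube of an unordered pair $\{a,b\}$ of transverse real Lagrangians is $\mathcal Y_{a,b}=\{l\in\mathcal X: R(a,l,\overline l,b)=-\mathrm{Id}\}$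 (points $Z\in\mathcal X$ seen as complex Lagrangians via $\binom{Z}{\mathrm{Id}}$); $\mathcal Y_{0,\infty}=\{iY:Y\in\mathrm{Sym}^+(2,\mathbb R)\}$ and $g\mathcal Y_{a,b}=\mathcal Y_{ga,gb}$. Two tubes are orthogonal if they are orthogonal as submanifolds of $\mathcal X$; for $(a,c,b,d)$ maximal, $\mathcal Y_{a,b}\perp\mathcal Y_{c,d}$ iff $R(a,c,b,d)=2\,\mathrm{Id}$. A right-angled hexagon is a cyclic sequence $H=[\mathcal Y_1,\dots,\mathcal Y_6]$ of $\mathbb R$-tubes, consecutive ones orthogonal, with $\mathcal Y_1=\mathcal Y_{P_1,P_2}$, $\mathcal Y_2=\mathcal Y_{Q_1,Q_2}$, $\mathcal Y_3=\mathcal Y_{P_3,P_4}$, $\mathcal Y_4=\mathcal Y_{Q_3,Q_4}$, $\mathcal Y_5=\mathcal Y_{P_5,P_6}$, $\mathcal Y_6=\mathcal Y_{Q_5,Q_6}$ for a maximal 12-tuple $(P_1,Q_6,Q_1,P_2,P_3,Q_2,Q_3,P_4,P_5,Q_4,Q_5,P_6)$. An ordered right-angled hexagon is a pair $(H,\mathcal Y_1)$; $\mathcal H$ is the set of these. $(H,\mathcal Y_1)$ is uniquely determined by, and denoted by, the maximal 6-tuple $(P,A,B,C,D,Q):=(P_2,Q_2,P_4,P_5,Q_5,P_1)$; every maximal 6-tuple arises this way. $\mathfrak a=\{(x_1,x_2):x_1>x_2>0\}$, $\mathfrak d=\{(x_1,x_2): x_1=x_2>0\}$, $\overline{\mathfrak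 a}=\mathfrak a\cup\mathfrak d$. Arc-coordinate map: for $\underline b=(b_1,b_2)$, $\underline c=(c_1,c_2)$, $\underline d=(d_1,d_2)$ and $S_i=\begin{pmatrix}\cos\frac{\alpha_i}{2}&-\sin\frac{\alpha_i}{2}\\ \sin\frac{\alpha_i}{2}&\cos\frac{\alpha_i}{2}\end{pmatrix}$, $\Phi(\underline b,\underline c,\underline d,\alpha_1,\alpha_2)$ is the class of the ordered hexagon $(0,A,\mathrm{Id},C,D,\infty)$ with $A=S_1^T\begin{pmatrix}e^{-b_2}&0\\0&e^{-b_1}\end{pmatrix}S_1$, $C=\begin{pmatrix}e^{c_1}&0\\0&e^{c_2}\end{pmatrix}$, $D=M S_2\begin{pmatrix}e^{d_1}&0\\0&e^{d_2}\end{pmatrix}S_2^TM^T$, $M=\begin{pmatrix}0&\sqrt{e^{c_1}}\\-\sqrt{e^{c_2}}&0\end{pmatrix}$. *)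

theory Defs
  imports "HOL-Analysis.Analysis" "HOL-Library.Real_Mod"
begin

section \<open>The symplectic group\<close>

(* The index type 2 + 2 has four elements; Inl / Inr select the upper / lower block of a vector
   or matrix of size 4. *)

definition block_matrix ::
  "'a^2^2 \<Rightarrow> 'a^2^2 \<Rightarrow> 'a^2^2 \<Rightarrow> 'a^2^2 \<Rightarrow> 'a^(2 + 2)^(2 + 2)" where
  "block_matrix A B C D = (\<chi> i j.
     case i of
       Inl k \<Rightarrow> (case j of Inl l \<Rightarrow> A $ k $ l | Inr l \<Rightarrow> B $ k $ l)
     | Inr k \<Rightarrow> (case j of Inl l \<Rightarrow> C $ k $ l | Inr l \<Rightarrow> D $ k $ l))"

definition J4 :: "real^(2 + 2)^(2 + 2)" where
  "J4 = block_matrix 0 (mat 1) (- mat 1) 0"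

definition Sp4 :: "(real^(2 + 2)^(2 + 2)) set" where
  "Sp4 = {g. transpose g ** J4 ** g = J4}"

definition PSp4 :: "(real^(2 + 2)^(2 + 2)) set set" where
  "PSp4 = Sp4 // {(g, h). g \<in> Sp4 \<and> h \<in> Sp4 \<and> (h = g \<or> h = - g)}"


section \<open>Siegel space\<close>

definition sym_mat :: "real^2^2 \<Rightarrow> bool" where
  "sym_mat X \<longleftrightarrow> transpose X = X"

definition posdef_mat :: "real^2^2 \<Rightarrow> bool" where
  "posdef_mat Y \<longleftrightarrow> sym_mat Y \<and> (\<forall>v. v \<noteq> 0 \<longrightarrow> v \<bullet> (Y *v v) > 0)"

definition complex_mat :: "real^2^2 \<Rightarrow> real^2^2 \<Rightarrow> complex^2^2" where
  "complex_mat X Y = (\<chi> i j. Complex (X $ i $ j) (Y $ i $ j))"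

definition siegel :: "(complex^2^2) set" where
  "siegel = {complex_mat X Y | X Y. sym_mat X \<and> posdef_mat Y}"

definition moebius :: "real^(2 + 2)^(2 + 2) \<Rightarrow> complex^2^2 \<Rightarrow> complex^2^2" where
  "moebius g Z =
    (let A = (\<chi> i j. of_real (g $ Inl i $ Inl j)); B = (\<chi> i j. of_real (g $ Inl i $ Inr j));
         C = (\<chi> i j. of_real (g $ Inr i $ Inl j)); D = (\<chi> i j. of_real (g $ Inr i $ Inr j))
     in (A ** Z + B) ** matrix_inv (C ** Z + D))"

(* The Sp(4,R)-invariant Riemannian metric Re tr (Y^(-1) U Y^(-1) cnj V) at Z = X + iY, the
   polarisation of ds^2 = tr (Y^(-1) dZ Y^(-1) d(cnj Z)); it is unique up to a constant factor. *)
definition siegel_metric :: "complex^2^2 \<Rightarrow> complex^2^2 \<Rightarrow> complex^2^2 \<Rightarrow> real" where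
  "siegel_metric Z U V =
    (let W = map_matrix complex_of_real (matrix_inv (map_matrix Im Z))
     in Re (trace (W ** U ** W ** map_matrix cnj V)))"

definition tangent_to :: "(complex^2^2) set \<Rightarrow> complex^2^2 \<Rightarrow> complex^2^2 \<Rightarrow> bool" where
  "tangent_to S Z U \<longleftrightarrow>
    (\<exists>\<gamma> \<epsilon>. \<epsilon> > 0 \<and> (\<forall>t::real. \<bar>t\<bar> < \<epsilon> \<longrightarrow> \<gamma> t \<in> S) \<and> \<gamma> 0 = Z \<and>
           (\<gamma> has_vector_derivative U) (at 0))"

definition orthogonal_in_siegel :: "(complex^2^2) set \<Rightarrow> (complex^2^2) set \<Rightarrow> bool" where
  "orthogonal_in_siegel S T \<longleftrightarrow>
    S \<inter> T \<noteq> {} \<and>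
    (\<forall>Z\<in>S \<inter> T. \<forall>U V. tangent_to S Z U \<longrightarrow> tangent_to T Z V \<longrightarrow> siegel_metric Z U V = 0)"


section \<open>Lagrangians and maximality\<close>

type_synonym lag = "(real^(2 + 2)) set"

definition lagrangian :: "lag \<Rightarrow> bool" where
  "lagrangian l \<longleftrightarrow> subspace l \<and> dim l = 2 \<and> (\<forall>v\<in>l. \<forall>w\<in>l. v \<bullet> (J4 *v w) = 0)"

definition transverse :: "lag \<Rightarrow> lag \<Rightarrow> bool" where
  "transverse l l' \<longleftrightarrow> l \<inter> l' = {0}"

definition stacked :: "'a^2^2 \<Rightarrow> 'a^2^2 \<Rightarrow> 'a^2^(2 + 2)" where
  "stacked X Y = (\<chi> i. case i of Inl k \<Rightarrow> X $ k | Inr k \<Rightarrow> Y $ k)"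

(* Used both for real symmetric matrices and for complex points of Siegel space. *)
definition mat_lag :: "'a::field^2^2 \<Rightarrow> ('a^(2 + 2)) set" where
  "mat_lag X = vec.span (columns (stacked X (mat 1)))"

definition infty_lag :: lag where
  "infty_lag = span {axis (Inl 1) 1, axis (Inl 2) 1}"

definition maximal_triple :: "lag \<Rightarrow> lag \<Rightarrow> lag \<Rightarrow> bool" where
  "maximal_triple l1 l2 l3 \<longleftrightarrow>
    lagrangian l1 \<and> lagrangian l2 \<and> lagrangian l3 \<and>
    transverse l1 l2 \<and> transverse l1 l3 \<and> transverse l2 l3 \<and>
    (\<exists>g\<in>Sp4. l1 = (*v) g ` infty_lag \<and> l2 = (*v) g ` mat_lag 0 \<and> l3 = (*v) g ` mat_lag (mat 1))"

definition maximal_tuple :: "lag list \<Rightarrow> bool" where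
  "maximal_tuple ls \<longleftrightarrow>
    (\<forall>i j k. i < j \<and> j < k \<and> k < length ls \<longrightarrow> maximal_triple (ls ! i) (ls ! j) (ls ! k))"


section \<open>Cross-ratio and tubes\<close>

definition proj_parallel :: "('a::field^(2 + 2)) set \<Rightarrow> ('a^(2 + 2)) set \<Rightarrow> 'a^(2 + 2) \<Rightarrow> 'a^(2 + 2)" where
  "proj_parallel l l' v = (THE u. u \<in> l \<and> v - u \<in> l')"

definition cross_ratio ::
  "('a::field^(2 + 2)) set \<Rightarrow> ('a^(2 + 2)) set \<Rightarrow> ('a^(2 + 2)) set \<Rightarrow> ('a^(2 + 2)) set
    \<Rightarrow> 'a^(2 + 2) \<Rightarrow> 'a^(2 + 2)" where
  "cross_ratio l1 l2 l3 l4 = restrict (proj_parallel l1 l2 \<circ> proj_parallel l4 l3) l1"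

definition complexify :: "lag \<Rightarrow> (complex^(2 + 2)) set" where
  "complexify l = vec.span ((\<lambda>v. \<chi> i. of_real (v $ i)) ` l)"

definition conj_lag :: "(complex^(2 + 2)) set \<Rightarrow> (complex^(2 + 2)) set" where
  "conj_lag l = (\<lambda>v. \<chi> i. cnj (v $ i)) ` l"

definition tube :: "lag \<Rightarrow> lag \<Rightarrow> (complex^2^2) set" where
  "tube a b = {Z \<in> siegel.
     cross_ratio (complexify a) (mat_lag Z) (conj_lag (mat_lag Z)) (complexify b)
       = restrict uminus (complexify a)}"


section \<open>Ordered right-angled hexagons\<close>

(* Y lists the tubes of a right-angled hexagon, with endpoints P 1, ..., P 6 and Q 1, ..., Q 6. *)
definition hexagon_with_endpoints ::
  "(nat \<Rightarrow> lag) \<Rightarrow> (nat \<Rightarrow> lag) \<Rightarrow> (complex^2^2) set list \<Rightarrow> bool" where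
  "hexagon_with_endpoints P Q Y \<longleftrightarrow>
    maximal_tuple [P 1, Q 6, Q 1, P 2, P 3, Q 2, Q 3, P 4, P 5, Q 4, Q 5, P 6] \<and>
    Y = [tube (P 1) (P 2), tube (Q 1) (Q 2), tube (P 3) (P 4),
         tube (Q 3) (Q 4), tube (P 5) (P 6), tube (Q 5) (Q 6)] \<and>
    (\<forall>i<6. orthogonal_in_siegel (Y ! i) (Y ! ((i + 1) mod 6)))"

definition cyclic_seq :: "'a list \<Rightarrow> 'a list set" where
  "cyclic_seq ys = {rotate n ys | n. True}"

(* A pair (H, Y1) of a cyclic sequence of tubes and a distinguished tube. Distinguishing an
   arbitrary tube of H gives nothing more, because rotating Y only relabels the endpoints. *)
type_synonym ordered_hexagon = "(complex^2^2) set list set \<times> (complex^2^2) set"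

definition ordered_hexagons :: "ordered_hexagon set" where
  "ordered_hexagons = {(cyclic_seq Y, Y ! 0) | P Q Y. hexagon_with_endpoints P Q Y}"

definition hexagon_of_tuple :: "lag \<times> lag \<times> lag \<times> lag \<times> lag \<times> lag \<Rightarrow> ordered_hexagon" where
  "hexagon_of_tuple t = (THE h. \<exists>P Q Y. hexagon_with_endpoints P Q Y \<and> h = (cyclic_seq Y, Y ! 0) \<and>
     t = (P 2, Q 2, P 4, P 5, Q 5, P 1))"

definition act_hexagon :: "real^(2 + 2)^(2 + 2) \<Rightarrow> ordered_hexagon \<Rightarrow> ordered_hexagon" where
  "act_hexagon g = (\<lambda>(H, Y1). (map ((`) (moebius g)) ` H, moebius g ` Y1))"

(* An element of PSp4 is a coset {g, -g}, whose two members act in the same way. *)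
definition PSp4_orbit :: "ordered_hexagon \<Rightarrow> ordered_hexagon set" where
  "PSp4_orbit h = {act_hexagon g h | p g. p \<in> PSp4 \<and> g \<in> p}"

definition hexagon_moduli :: "ordered_hexagon set set" where
  "hexagon_moduli = PSp4_orbit ` ordered_hexagons"


section \<open>Arc coordinates\<close>

definition chamber :: "(real \<times> real) set" where
  "chamber = {(x1, x2). x1 > x2 \<and> x2 > 0}"

definition chamber_diag :: "(real \<times> real) set" where
  "chamber_diag = {(x1, x2). x1 = x2 \<and> x2 > 0}"

definition chamber_closed :: "(real \<times> real) set" where
  "chamber_closed = chamber \<union> chamber_diag"

type_synonym arc_params = "(real \<times> real) \<times> (real \<times> real) \<times> (real \<times> real) \<times> real \<times> real"

definition arc_domain :: "arc_params set" where
  "arc_domain = chamber_closed \<times> chamber_closed \<times> chamber_closed \<times> {0..<2 * pi} \<times> {0..<2 * pi}"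

(* Angles are compared modulo 2 pi, so that for instance 2 pi - 0 is read as 0. *)
inductive arc_step :: "arc_params \<Rightarrow> arc_params \<Rightarrow> bool" where
  reflect: "[\<beta>1 = 2 * pi - \<alpha>1] (rmod (2 * pi)) \<Longrightarrow> [\<beta>2 = 2 * pi - \<alpha>2] (rmod (2 * pi)) \<Longrightarrow>
    (b, c, d, \<alpha>1, \<alpha>2) \<in> arc_domain \<Longrightarrow> (b, c, d, \<beta>1, \<beta>2) \<in> arc_domain \<Longrightarrow>
    arc_step (b, c, d, \<alpha>1, \<alpha>2) (b, c, d, \<beta>1, \<beta>2)"
| b_diag: "b \<in> chamber_diag \<Longrightarrow>
    (b, c, d, \<alpha>1, \<alpha>2) \<in> arc_domain \<Longrightarrow> (b, c, d, \<beta>1, \<alpha>2) \<in> arc_domain \<Longrightarrow>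
    arc_step (b, c, d, \<alpha>1, \<alpha>2) (b, c, d, \<beta>1, \<alpha>2)"
| c_diag: "c \<in> chamber_diag \<Longrightarrow> [\<beta>1 + \<beta>2 = \<alpha>1 + \<alpha>2] (rmod (2 * pi)) \<Longrightarrow>
    (b, c, d, \<alpha>1, \<alpha>2) \<in> arc_domain \<Longrightarrow> (b, c, d, \<beta>1, \<beta>2) \<in> arc_domain \<Longrightarrow>
    arc_step (b, c, d, \<alpha>1, \<alpha>2) (b, c, d, \<beta>1, \<beta>2)"
| d_diag: "d \<in> chamber_diag \<Longrightarrow>
    (b, c, d, \<alpha>1, \<alpha>2) \<in> arc_domain \<Longrightarrow> (b, c, d, \<alpha>1, \<beta>2) \<in> arc_domain \<Longrightarrow>
    arc_step (b, c, d, \<alpha>1, \<alpha>2) (b, c, d, \<alpha>1, \<beta>2)"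

definition arc_rel :: "(arc_params \<times> arc_params) set" where
  "arc_rel = {(x, y). x \<in> arc_domain \<and> y \<in> arc_domain \<and> equivclp arc_step x y}"

lemma equiv_arc_rel: "equiv arc_domain arc_rel"
proof (rule equivI)
  show "arc_rel \<subseteq> arc_domain \<times> arc_domain"
    by (auto simp: arc_rel_def)
  show "refl_on arc_domain arc_rel"
    by (auto simp: refl_on_def arc_rel_def)
  show "sym arc_rel"
    by (auto simp: sym_def arc_rel_def intro: equivclp_sym)
  show "trans arc_rel"
    by (auto simp: trans_def arc_rel_def intro: equivclp_trans)
qed

definition arc_space :: "arc_params set set" where
  "arc_space = arc_domain // arc_rel"

definition diag2 :: "real \<Rightarrow> real \<Rightarrow> real^2^2" where
  "diag2 x y = vector [vector [x, 0], vector [0, y]]"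

definition rot_half :: "real \<Rightarrow> real^2^2" where
  "rot_half \<alpha> = vector [vector [cos (\<alpha> / 2), - sin (\<alpha> / 2)], vector [sin (\<alpha> / 2), cos (\<alpha> / 2)]]"

definition arc_A :: "real \<times> real \<Rightarrow> real \<Rightarrow> real^2^2" where
  "arc_A = (\<lambda>(b1, b2) \<alpha>1.
     transpose (rot_half \<alpha>1) ** diag2 (exp (- b2)) (exp (- b1)) ** rot_half \<alpha>1)"

definition arc_C :: "real \<times> real \<Rightarrow> real^2^2" where
  "arc_C = (\<lambda>(c1, c2). diag2 (exp c1) (exp c2))"

definition arc_M :: "real \<times> real \<Rightarrow> real^2^2" where
  "arc_M = (\<lambda>(c1, c2). vector [vector [0, sqrt (exp c1)], vector [- sqrt (exp c2), 0]])"

definition arc_D :: "real \<times> real \<Rightarrow> real \<times> real \<Rightarrow> real \<Rightarrow> real^2^2" where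
  "arc_D c = (\<lambda>(d1, d2) \<alpha>2.
     arc_M c ** rot_half \<alpha>2 ** diag2 (exp d1) (exp d2) ** transpose (rot_half \<alpha>2) ** transpose (arc_M c))"

definition arc_hexagon :: "arc_params \<Rightarrow> ordered_hexagon" where
  "arc_hexagon = (\<lambda>(b, c, d, \<alpha>1, \<alpha>2). hexagon_of_tuple
     (mat_lag 0, mat_lag (arc_A b \<alpha>1), mat_lag (mat 1), mat_lag (arc_C c), mat_lag (arc_D c d \<alpha>2),
      infty_lag))"

definition arc_map :: "arc_params \<Rightarrow> ordered_hexagon set" where
  "arc_map x = PSp4_orbit (arc_hexagon x)"

end

(* A tube determines its unordered pair of ends, and the tubes with ends (a, b) and (c, d) are
   orthogonal exactly when (a, c, b, d) lies in the Sp(4,R)-orbit of (infinity, -Id, 0, Id), i.e.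
   when the reflection that is the identity on a and minus the identity on b exchanges c and d.
   Such reflections reverse the cyclic order of maximal triples, and two tubes whose ends form a
   maximal 4-tuple have a unique common perpendicular, because a positive definite matrix has a
   unique positive definite square root. Hence a right-angled hexagon is recovered from its maximal
   6-tuple. Normalising that tuple to (0, A, Id, C, D, infinity) leaves only conjugation by O(2);
   diagonalising C, A and M^(-1) D M^(-T) yields the arc coordinates, and the relation on the
   angles is the remaining effect of the stabiliser of C in O(2). *)
theory Submission
  imports Defs
begin

text \<open>The reflection attached to a tube negates the symplectic form, so it lies outside
  \<open>Sp4\<close>. It enters only through \<open>harmonic\<close>, by uniqueness of the fourth
  point and by reversal of order. Orthogonality forces the harmonic position for a planar reason:
  with ends normalised to (infinity, -Id, 0, F), a rotation makes F diagonal, and diagonal tangent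
  vectors already reduce the question to two hyperbolic planes. A tube knows its ends only as an
  unordered pair, a cyclic sequence its list only up to rotation. The order of the twelve ends
  removes the first ambiguity, the distinguished tube the second. A rotation through t fixing C
  moves \<alpha>1 to \<alpha>1 - 2t and \<alpha>2 to \<alpha>2 + 2t: the angles enter halved, and
  the rotation stands transposed in A. If C is not scalar, such a rotation is plus or minus Id and
  shifts nothing modulo 2 pi, so only the reflection, which negates both angles, identifies
  anything. If C is scalar, every t is allowed and only the sum of the angles survives. When b or d
  lies on the diagonal, its angle drops out of the matrix.\<close>

declare transpose_matrix_vector [simp del]

section \<open>Block vectors and block matrices\<close>

text \<open>Every vector of size 4 is handled in this form, so that block matrices act by formulas
  in size 2. The entry type stays free because real and complex Lagrangians are both needed.\<close>

definition pv :: "'a^2 \<Rightarrow> 'a^2 \<Rightarrow> 'a^(2 + 2)" where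
  "pv x y = (\<chi> i. case i of Inl k \<Rightarrow> x $ k | Inr k \<Rightarrow> y $ k)"

lemma pv_nth [simp]: "pv x y $ Inl k = x $ k" "pv x y $ Inr k = y $ k"
  by (simp_all add: pv_def)

lemma vec_sum_eqI:
  fixes v w :: "'a^('b::finite + 'c::finite)"
  assumes "\<And>k. v $ Inl k = w $ Inl k" "\<And>k. v $ Inr k = w $ Inr k"
  shows "v = w"
proof -
  have "v $ i = w $ i" for i using assms by (cases i) auto
  thus ?thesis by (simp add: vec_eq_iff)
qed

lemma pv_inject [simp]: "pv x y = pv x' y' \<longleftrightarrow> x = x' \<and> y = y'"
  by (metis pv_nth vec_eq_iff)

lemma pv_cases: obtains x y where "v = pv x y"
proof
  show "v = pv (\<chi> k. v $ Inl k) (\<chi> k. v $ Inr k)"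
    by (rule vec_sum_eqI) auto
qed

lemma sum_UNIV_Plus:
  fixes f :: "('b::finite + 'c::finite) \<Rightarrow> 'a::comm_monoid_add"
  shows "sum f UNIV = (\<Sum>k\<in>UNIV. f (Inl k)) + (\<Sum>k\<in>UNIV. f (Inr k))"
proof -
  have "sum f UNIV = sum f (UNIV <+> UNIV)" by simp
  also have "\<dots> = (\<Sum>k\<in>UNIV. f (Inl k)) + (\<Sum>k\<in>UNIV. f (Inr k))"
    by (subst sum.Plus) (auto simp: o_def)
  finally show ?thesis .
qed

lemma pv_add: "pv x y + pv x' y' = pv (x + x') (y + y')"
  and pv_diff: "pv x y - pv x' y' = pv (x - x') (y - y')"
  for x y :: "'a::ab_group_add^2"
  by (rule vec_sum_eqI; simp)+

lemma pv_zero [simp]: "pv 0 0 = (0 :: 'a::zero^(2 + 2))"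
  by (rule vec_sum_eqI) simp_all

lemma pv_eq_0_iff [simp]: "pv x y = (0 :: 'a::zero^(2 + 2)) \<longleftrightarrow> x = 0 \<and> y = 0"
  using pv_inject[of x y 0 0] by simp

lemma block_matrix_nth [simp]:
  "block_matrix A B C D $ Inl k $ Inl l = A $ k $ l"
  "block_matrix A B C D $ Inl k $ Inr l = B $ k $ l"
  "block_matrix A B C D $ Inr k $ Inl l = C $ k $ l"
  "block_matrix A B C D $ Inr k $ Inr l = D $ k $ l"
  by (simp_all add: block_matrix_def)

lemma block_matrix_inject [simp]:
  "block_matrix A B C D = block_matrix A' B' C' D' \<longleftrightarrow> A = A' \<and> B = B' \<and> C = C' \<and> D = D'"
  by (metis block_matrix_nth vec_eq_iff)

lemma block_matrix_cases: obtains A B C D where "g = block_matrix A B C D"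
proof
  show "g = block_matrix (\<chi> i j. g $ Inl i $ Inl j) (\<chi> i j. g $ Inl i $ Inr j)
     (\<chi> i j. g $ Inr i $ Inl j) (\<chi> i j. g $ Inr i $ Inr j)"
    by (intro vec_sum_eqI) auto
qed

lemma block_matrix_mult_vec [simp]:
  "block_matrix A B C D *v pv x y = pv (A *v x + B *v y) (C *v x + D *v y)"
  for A :: "'a::comm_semiring_1^2^2"
  by (rule vec_sum_eqI) (simp_all add: matrix_vector_mult_def sum_UNIV_Plus)

lemma block_matrix_mult:
  "block_matrix A B C D ** block_matrix A' B' C' D' =
   block_matrix (A ** A' + B ** C') (A ** B' + B ** D') (C ** A' + D ** C') (C ** B' + D ** D')"
  for A :: "'a::comm_semiring_1^2^2"
  by (intro vec_sum_eqI) (simp_all add: matrix_matrix_mult_def sum_UNIV_Plus)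

lemma transpose_block_matrix:
  "transpose (block_matrix A B C D)
     = block_matrix (transpose A) (transpose C) (transpose B) (transpose D)"
  by (intro vec_sum_eqI) (simp_all add: transpose_def)

text \<open>Bilinear over every ring, in particular over the complex numbers, where
  \<open>inner\<close> would be a real-valued form and transposes would not be adjoints.\<close>

definition dotp :: "'a::comm_ring_1^2 \<Rightarrow> 'a^2 \<Rightarrow> 'a" where
  "dotp x y = (\<Sum>k\<in>UNIV. x $ k * y $ k)"

lemma dotp_2: "dotp x y = x $ 1 * y $ 1 + x $ 2 * y $ 2"
  by (simp add: dotp_def sum_2)

lemma dotp_inner: "dotp x y = x \<bullet> y" for x y :: "real^2"
  by (simp add: dotp_def inner_vec_def)

lemma dotp_simps:
  "dotp (x + y) z = dotp x z + dotp y z" "dotp z (x + y) = dotp z x + dotp z y"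
  "dotp (x - y) z = dotp x z - dotp y z" "dotp z (x - y) = dotp z x - dotp z y"
  "dotp (- x) z = - dotp x z" "dotp z (- x) = - dotp z x"
  "dotp (c *s x) z = c * dotp x z" "dotp z (c *s x) = c * dotp z x"
  "dotp 0 z = 0" "dotp z 0 = 0"
  by (simp_all add: dotp_2 algebra_simps)

lemma dotp_commute: "dotp x y = dotp y x"
  by (simp add: dotp_2 algebra_simps)

lemma matrix_vector_mult_2:
  "(A *v x) $ i = A $ i $ 1 * x $ 1 + A $ i $ 2 * x $ 2" for A :: "'a::comm_ring_1^2^2"
  by (simp add: matrix_vector_mult_def sum_2)

lemma matrix_matrix_mult_2:
  "(A ** B) $ i $ j = A $ i $ 1 * B $ 1 $ j + A $ i $ 2 * B $ 2 $ j" for A B ::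
      "'a::comm_ring_1^2^2"
  by (simp add: matrix_matrix_mult_def sum_2)

lemma mat_2 [simp]:
  "(mat a :: 'a::zero^2^2) $ 1 $ 1 = a" "(mat a :: 'a^2^2) $ 1 $ 2 = 0"
  "(mat a :: 'a^2^2) $ 2 $ 1 = 0" "(mat a :: 'a^2^2) $ 2 $ 2 = a"
  by (simp_all add: mat_def)

lemma transpose_nth [simp]: "transpose A $ i $ j = A $ j $ i"
  by (simp add: transpose_def)

lemmas mat2_eq = vec_eq_iff forall_2 matrix_matrix_mult_2 matrix_vector_mult_2

lemma dotp_matrix: "dotp (A *v x) y = dotp x (transpose A *v y)" for A :: "'a::comm_ring_1^2^2"
  by (simp add: dotp_2 matrix_vector_mult_2 algebra_simps)

lemma dotp_eq_0: "(\<And>y. dotp x y = 0) \<Longrightarrow> x = 0"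
proof -
  assume *: "\<And>y. dotp x y = 0"
  have "x $ k = 0" for k
    using *[of "axis k 1"] by (simp add: dotp_def axis_def if_distrib cong: if_cong)
  thus ?thesis by (simp add: vec_eq_iff)
qed

lemma transpose_add: "transpose (A + B) = transpose A + transpose B"
  and transpose_diff: "transpose (A - B) = transpose A - transpose B"
  and transpose_uminus: "transpose (- A) = - transpose A"
  and transpose_0 [simp]: "transpose (0 :: 'a^'n^'m) = 0"
  for A B :: "'a::ab_group_add^'n^'m"
  by (simp_all add: transpose_def vec_eq_iff)

lemma matrix_neg_mult: "(- A) ** B = - (A ** B)" "A ** (- B) = - (A ** B)" for A B ::
    "'a::comm_ring_1^2^2"
  by (simp_all add: mat2_eq)

lemma matrix_vector_neg: "(- A) *v x = - (A *v x)" "A *v (- x) = - (A *v x)" for A ::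
    "'a::comm_ring_1^2^2"
  by (simp_all add: mat2_eq)

lemma matrix_zero_mult [simp]: "0 ** A = 0" "A ** 0 = 0" "0 *v x = 0"
  for A :: "'a::comm_ring_1^2^2"
  by (simp_all add: mat2_eq)

lemma matrix_mult_diff: "(A - B) ** C = A ** C - B ** C" "C ** (A - B) = C ** A - C ** B"
  and matrix_mult_add: "(A + B) ** C = A ** C + B ** C" "C ** (A + B) = C ** A + C ** B"
  for A B :: "'a::comm_ring_1^2^2"
  by (simp_all add: mat2_eq algebra_simps)

lemma matrix_vector_diff: "(A - B) *v x = A *v x - B *v x"
  and matrix_vector_add: "(A + B) *v x = A *v x + B *v x"
  for A B :: "'a::comm_ring_1^2^2"
  by (simp_all add: mat2_eq algebra_simps)

lemma matrix_eqI: "(\<And>x. A *v x = B *v x) \<Longrightarrow> A = B" for A B :: "'a::comm_ring_1^2^2"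
  by (simp add: matrix_eq)

section \<open>Inverses of square matrices\<close>

lemma invertible_matrix_inv:
  assumes "invertible A"
  shows "A ** matrix_inv A = mat 1" "matrix_inv A ** A = mat 1"
  using assms someI_ex[of "\<lambda>A'. A ** A' = mat 1 \<and> A' ** A = mat 1"]
  by (auto simp: invertible_def matrix_inv_def)

lemma invertible_matrix_inv_vec:
  fixes A :: "'a::comm_ring_1^'n^'n"
  assumes "invertible A"
  shows "A *v (matrix_inv A *v x) = x" "matrix_inv A *v (A *v x) = x"
  using invertible_matrix_inv[OF assms] by (simp_all add: matrix_vector_mul_assoc)

lemma invertibleI_inj:
  fixes A :: "'a::field^2^2"
  assumes "\<And>x. A *v x = 0 \<Longrightarrow> x = 0"
  shows "invertible A"
  using assms by (metis invertible_left_inverse matrix_left_invertible_ker)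

lemma matrix_inv_eq:
  fixes A :: "'a::field^'n^'n"
  assumes "A ** B = mat 1"
  shows "matrix_inv A = B"
  by (metis assms invertible_matrix_inv(2) invertible_right_inverse matrix_mul_assoc matrix_mul_lid
      matrix_mul_rid)

section \<open>The symplectic form and the symplectic group\<close>

text \<open>The form given by \<open>J4\<close>, written out in coordinates so that it also makes
  sense bilinearly on complex vectors.\<close>

definition symp :: "'a::comm_ring_1^(2 + 2) \<Rightarrow> 'a^(2 + 2) \<Rightarrow> 'a" where
  "symp v w = (\<Sum>k\<in>UNIV. v $ Inl k * w $ Inr k) - (\<Sum>k\<in>UNIV. v $ Inr k * w $ Inl k)"

lemma symp_pv [simp]: "symp (pv x y) (pv x' y') = dotp x y' - dotp y x'"
  by (simp add: symp_def dotp_def)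

lemma symp_J4: "symp v w = v \<bullet> (J4 *v w)"
proof -
  obtain x y where v: "v = pv x y" by (rule pv_cases)
  obtain x' y' where w: "w = pv x' y'" by (rule pv_cases)
  show ?thesis
    unfolding v w J4_def
    by (simp add: inner_vec_def sum_UNIV_Plus dotp_def matrix_vector_neg sum_negf)
qed

lemma inner_matrix_eqI:
  fixes A B :: "real^'n^'n"
  assumes "\<And>v w. v \<bullet> (A *v w) = v \<bullet> (B *v w)"
  shows "A = B"
proof -
  have "A *v w = B *v w" for w
    by (metis assms vector_eq_ldot)
  thus ?thesis by (simp add: matrix_eq)
qed

lemma Sp4_iff: "g \<in> Sp4 \<longleftrightarrow> (\<forall>v w. symp (g *v v) (g *v w) = symp v w)"
proof -
  have *: "symp (g *v v) (g *v w) = v \<bullet> ((transpose g ** J4 ** g) *v w)" for v w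
  proof -
    have "(g *v v) \<bullet> u = v \<bullet> (transpose g *v u)" for u
      unfolding transpose_matrix_vector inner_commute[of v] dot_lmul_matrix by (rule inner_commute)
    thus ?thesis by (simp add: symp_J4 matrix_vector_mul_assoc matrix_mul_assoc)
  qed
  show ?thesis
  proof
    assume "g \<in> Sp4"
    thus "\<forall>v w. symp (g *v v) (g *v w) = symp v w"
      unfolding * by (simp add: Sp4_def symp_J4)
  next
    assume "\<forall>v w. symp (g *v v) (g *v w) = symp v w"
    hence "transpose g ** J4 ** g = J4"
      unfolding * by (intro inner_matrix_eqI) (simp add: symp_J4)
    thus "g \<in> Sp4" by (simp add: Sp4_def)
  qed
qed

lemma symp_nondeg: "(\<And>w. symp v w = 0) \<Longrightarrow> v = 0"
proof -
  assume *: "\<And>w. symp v w = 0"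
  obtain x y where v: "v = pv x y" by (rule pv_cases)
  have "x = 0" using *[of "pv 0 y" for y] by (intro dotp_eq_0) (simp add: v dotp_simps)
  moreover have "y = 0" using *[of "pv y 0" for y] by (intro dotp_eq_0) (simp add: v dotp_simps)
  ultimately show "v = 0" by (simp add: v)
qed

lemma Sp4_invertible:
  assumes "g \<in> Sp4" shows "invertible g"
proof -
  have "v = 0" if "g *v v = 0" for v
  proof (rule symp_nondeg)
    fix w
    have "symp v w = symp (g *v v) (g *v w)" using assms by (simp add: Sp4_iff)
    thus "symp v w = 0" by (simp add: that symp_def)
  qed
  thus ?thesis by (metis invertible_left_inverse matrix_left_invertible_ker)
qed

lemma Sp4_inv:
  assumes "g \<in> Sp4" shows "matrix_inv g \<in> Sp4"
  unfolding Sp4_iff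
  by (metis Sp4_iff Sp4_invertible assms invertible_matrix_inv_vec(1))

lemma Sp4_mult: "g \<in> Sp4 \<Longrightarrow> h \<in> Sp4 \<Longrightarrow> g ** h \<in> Sp4"
  by (simp add: Sp4_iff flip: matrix_vector_mul_assoc)

lemma Sp4_one [simp]: "mat 1 \<in> Sp4"
  by (simp add: Sp4_iff)

lemma block_in_Sp4_iff:
  "block_matrix A B C D \<in> Sp4 \<longleftrightarrow>
    transpose A ** C = transpose C ** A \<and> transpose B ** D = transpose D ** B \<and>
    transpose A ** D - transpose C ** B = mat 1"
proof -
  \<comment> \<open>The lower left block of the product is minus the transpose of the upper right
    one, so three block equations remain.\<close>
  have t: "transpose D ** A - transpose B ** C = transpose (transpose A ** D - transpose C ** B)"
    by (simp add: transpose_diff matrix_transpose_mul)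
  have "block_matrix A B C D \<in> Sp4 \<longleftrightarrow>
    transpose A ** C - transpose C ** A = 0 \<and> transpose A ** D - transpose C ** B = mat 1 \<and>
    - (transpose D ** A - transpose B ** C) = - mat 1 \<and> transpose B ** D - transpose D ** B = 0"
    unfolding Sp4_def J4_def
    by (simp add: transpose_block_matrix block_matrix_mult matrix_neg_mult)
  thus ?thesis unfolding t
    by (auto simp: transpose_mat)
qed

section \<open>Symmetric and positive definite matrices of size two\<close>

lemma diag2_nth [simp]:
  "diag2 x y $ 1 $ 1 = x" "diag2 x y $ 1 $ 2 = 0" "diag2 x y $ 2 $ 1 = 0" "diag2 x y $ 2 $ 2 = y"
  by (simp_all add: diag2_def)

lemma diag2_mult: "diag2 a b ** diag2 c d = diag2 (a * c) (b * d)"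
  and diag2_add: "diag2 a b + diag2 c d = diag2 (a + c) (b + d)"
  and diag2_diff: "diag2 a b - diag2 c d = diag2 (a - c) (b - d)"
  and diag2_uminus: "- diag2 a b = diag2 (- a) (- b)"
  and diag2_transpose: "transpose (diag2 a b) = diag2 a b"
  and diag2_one: "mat 1 = diag2 1 1"
  and diag2_zero: "(0 :: real^2^2) = diag2 0 0"
  by (simp_all add: mat2_eq)

lemma diag2_inject [simp]: "diag2 a b = diag2 c d \<longleftrightarrow> a = c \<and> b = d"
  by (auto simp add: mat2_eq)

lemma diag2_sym [simp]: "sym_mat (diag2 a b)"
  by (simp add: sym_mat_def diag2_transpose)

lemma diag2_invertible:
  assumes "a \<noteq> 0" "b \<noteq> 0" shows "invertible (diag2 a b)"
  unfolding invertible_def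
  by (rule exI[of _ "diag2 (1 / a) (1 / b)"]) (simp add: diag2_mult assms diag2_one)

lemma sym_mat_2: "sym_mat X \<longleftrightarrow> X $ 1 $ 2 = X $ 2 $ 1"
  by (auto simp: sym_mat_def mat2_eq)

lemma posdef_dotp: "posdef_mat Y \<longleftrightarrow> sym_mat Y \<and> (\<forall>v. v \<noteq> 0 \<longrightarrow> dotp v (Y *v v) > 0)"
  by (simp add: posdef_mat_def dotp_inner)

lemma posdef_sym: "posdef_mat Y \<Longrightarrow> sym_mat Y"
  by (simp add: posdef_mat_def)

lemma posdef_diag2 [simp]: "posdef_mat (diag2 a b) \<longleftrightarrow> a > 0 \<and> b > 0"
proof
  assume "posdef_mat (diag2 a b)"
  hence *: "dotp v (diag2 a b *v v) > 0" if "v \<noteq> 0" for v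
    using that by (simp add: posdef_dotp)
  show "a > 0 \<and> b > 0"
    using *[of "axis 1 1"] *[of "axis 2 1"]
    by (simp add: dotp_2 matrix_vector_mult_2 axis_def vec_eq_iff)
next
  assume ab: "a > 0 \<and> b > 0"
  have "0 < a * (v $ 1)\<^sup>2 + b * (v $ 2)\<^sup>2" if "v \<noteq> 0" for v :: "real^2"
  proof -
    from that have "v $ 1 \<noteq> 0 \<or> v $ 2 \<noteq> 0" by (auto simp: vec_eq_iff forall_2)
    thus ?thesis
      using ab
      by (metis add_pos_nonneg add_nonneg_pos less_imp_le mult_nonneg_nonneg mult_pos_pos
          zero_le_power2 zero_less_power2)
  qed
  thus "posdef_mat (diag2 a b)"
    by (simp add: posdef_dotp dotp_2 matrix_vector_mult_2 power2_eq_square algebra_simps)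
qed

lemma posdef_one [simp]: "posdef_mat (mat 1)"
  by (simp add: diag2_one)

lemma posdef_add: "posdef_mat X \<Longrightarrow> posdef_mat Y \<Longrightarrow> posdef_mat (X + Y)"
  by (auto simp: posdef_dotp sym_mat_def transpose_add matrix_vector_add dotp_simps add_pos_pos)

lemma posdef_not_uminus: "posdef_mat X \<Longrightarrow> \<not> posdef_mat (- X)"
proof
  assume "posdef_mat X" "posdef_mat (- X)"
  hence "posdef_mat (X + - X)" by (rule posdef_add)
  thus False by (metis posdef_diag2 diag2_zero less_irrefl add.right_inverse)
qed

lemma posdef_invertible:
  assumes "posdef_mat Y" shows "invertible Y"
proof (rule invertibleI_inj)
  fix x assume "Y *v x = 0"
  thus "x = 0" using assms by (auto simp: posdef_dotp dotp_simps)
qed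

lemma posdef_congruent:
  assumes "posdef_mat Y" "invertible K"
  shows "posdef_mat (K ** Y ** transpose K)"
  unfolding posdef_dotp
proof safe
  show "sym_mat (K ** Y ** transpose K)"
    using posdef_sym[OF assms(1)]
    by (simp add: sym_mat_def matrix_transpose_mul matrix_mul_assoc)
  fix v :: "real^2" assume "v \<noteq> 0"
  have "invertible (transpose K)" using assms(2) by (metis invertible_det_nz det_transpose)
  hence "transpose K *v v \<noteq> 0" using \<open>v \<noteq> 0\<close>
    by (metis invertible_matrix_inv_vec(2) matrix_vector_mult_0_right)
  hence "dotp (transpose K *v v) (Y *v (transpose K *v v)) > 0"
    using assms(1) by (simp add: posdef_dotp)
  thus "dotp v (K ** Y ** transpose K *v v) > 0"
    by (simp add: dotp_matrix flip: matrix_vector_mul_assoc)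
qed

lemma transpose_invertible_inv:
  fixes K :: "real^2^2"
  assumes "invertible K" shows "transpose (matrix_inv K) ** transpose K = mat 1"
    "transpose K ** transpose (matrix_inv K) = mat 1"
  using invertible_matrix_inv[OF assms]
  by (simp_all flip: matrix_transpose_mul)

section \<open>Rotations, diagonalisation and square roots\<close>

definition rot :: "real \<Rightarrow> real^2^2" where
  "rot t = vector [vector [cos t, - sin t], vector [sin t, cos t]]"

lemma rot_nth [simp]:
  "rot t $ 1 $ 1 = cos t" "rot t $ 1 $ 2 = - sin t" "rot t $ 2 $ 1 = sin t" "rot t $ 2 $ 2 = cos t"
  by (simp_all add: rot_def)

lemma rot_half_rot: "rot_half a = rot (a / 2)"
  by (simp add: rot_half_def rot_def)

lemma rot_add: "rot s ** rot t = rot (s + t)"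
  by (simp add: mat2_eq cos_add sin_add)

lemma rot_transpose: "transpose (rot t) = rot (- t)"
  by (simp add: mat2_eq)

lemma rot_0 [simp]: "rot 0 = mat 1"
  by (simp add: mat2_eq)

lemma rot_orthogonal [simp]: "rot t ** transpose (rot t) = mat 1" "transpose (rot t) ** rot t =
    mat 1"
  by (simp_all add: rot_transpose rot_add)

text \<open>The symmetric matrix with eigenvalues p, q whose first eigenvector has argument a / 2;
  in this form the dependence on the angle is visibly \<open>2 pi\<close>-periodic.\<close>

definition sym_polar :: "real \<Rightarrow> real \<Rightarrow> real \<Rightarrow> real^2^2" where
  "sym_polar p q a = vector
     [vector [(p + q) / 2 + (p - q) / 2 * cos a, (p - q) / 2 * sin a],
      vector [(p - q) / 2 * sin a, (p + q) / 2 - (p - q) / 2 * cos a]]"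

lemma sym_polar_nth [simp]:
  "sym_polar p q a $ 1 $ 1 = (p + q) / 2 + (p - q) / 2 * cos a"
  "sym_polar p q a $ 1 $ 2 = (p - q) / 2 * sin a"
  "sym_polar p q a $ 2 $ 1 = (p - q) / 2 * sin a"
  "sym_polar p q a $ 2 $ 2 = (p + q) / 2 - (p - q) / 2 * cos a"
  by (simp_all add: sym_polar_def)

lemma sym_polar_rot: "sym_polar p q a = rot (a / 2) ** diag2 p q ** transpose (rot (a / 2))"
proof -
  have c: "cos a = (cos (a/2))\<^sup>2 - (sin (a/2))\<^sup>2" and s: "sin a = 2 * sin (a/2) * cos (a/2)"
    using cos_double[of "a/2"] sin_double[of "a/2"] by simp_all
  have e: "(cos (a/2))\<^sup>2 + (sin (a/2))\<^sup>2 = 1" by simp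
  have e1: "p * (cos (a/2))\<^sup>2 + q * (sin (a/2))\<^sup>2 = (p + q) / 2 + (p - q) / 2 * cos a"
    and e2: "p * (sin (a/2))\<^sup>2 + q * (cos (a/2))\<^sup>2 = (p + q) / 2 - (p - q) / 2 * cos a"
    unfolding c using e by algebra+
  show ?thesis using e1 e2
    by (simp add: mat2_eq s power2_eq_square field_simps)
qed

text \<open>Subtracting half the trace leaves a traceless symmetric matrix, that is a plane vector
  (u, v). Its polar coordinates are half the gap of the eigenvalues and the doubled angle of the
  first eigenvector.\<close>

lemma sym_polar_exists:
  assumes "sym_mat X"
  obtains p q a where "p \<ge> q" "0 \<le> a" "a < 2 * pi" "X = sym_polar p q a"
proof -
  define u v where "u = (X $ 1 $ 1 - X $ 2 $ 2) / 2" and "v = X $ 1 $ 2"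
  define r where "r = sqrt (u\<^sup>2 + v\<^sup>2)"
  have "r \<ge> 0" by (simp add: r_def)
  obtain a where a: "0 \<le> a" "a < 2 * pi" "u = r * cos a" "v = r * sin a"
  proof (cases "r = 0")
    case True
    hence "u = 0 \<and> v = 0" by (simp add: r_def sum_power2_eq_zero_iff)
    thus ?thesis using that[of 0] True by simp
  next
    case False
    hence "(u / r)\<^sup>2 + (v / r)\<^sup>2 = 1"
      using r_def by (simp add: power_divide flip: add_divide_distrib)
    then obtain a where "0 \<le> a" "a < 2 * pi" "u / r = cos a" "v / r = sin a"
      by (rule sincos_total_2pi)
    thus ?thesis using that[of a] False by (simp add: field_simps)
  qed
  define m where "m = (X $ 1 $ 1 + X $ 2 $ 2) / 2"
  have "X = sym_polar (m + r) (m - r) a"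
    using assms a(3,4) by (simp add: mat2_eq sym_mat_2 m_def u_def v_def field_simps)
  thus ?thesis using that[of "m - r" "m + r" a] a \<open>r \<ge> 0\<close> by simp
qed

lemma sym_diagonalize:
  assumes "sym_mat X"
  obtains p q t where "X = rot t ** diag2 p q ** transpose (rot t)"
  using sym_polar_exists[OF assms] sym_polar_rot by metis

lemma rot_invertible: "invertible (rot t)"
  unfolding invertible_def by (rule exI[of _ "transpose (rot t)"]) simp

lemma posdef_orth_conj:
  "posdef_mat (rot t ** X ** transpose (rot t)) \<longleftrightarrow> posdef_mat X"
proof
  assume "posdef_mat (rot t ** X ** transpose (rot t))"
  hence "posdef_mat (rot (-t) ** (rot t ** X ** transpose (rot t)) ** transpose (rot (-t)))"
    by (rule posdef_congruent) (rule rot_invertible)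
  thus "posdef_mat X"
    by (simp add: rot_transpose matrix_mul_assoc rot_add)
      (simp add: rot_add flip: matrix_mul_assoc)
qed (intro posdef_congruent rot_invertible)

lemma posdef_diagonalize:
  assumes "posdef_mat X"
  obtains p q t where "p > 0" "q > 0" "X = rot t ** diag2 p q ** transpose (rot t)"
  by (metis assms posdef_diag2 posdef_orth_conj posdef_sym sym_diagonalize)

text \<open>Congruence acts transitively on positive definite matrices. This supplies the symplectic
  maps that carry Id to a prescribed matrix in the normal forms of maximal triples and harmonic
  quadruples.\<close>

lemma posdef_factor:
  assumes "posdef_mat X"
  obtains L :: "real^2^2" where "invertible L" "X = L ** transpose L"
proof -
  obtain p q t where *: "p > 0" "q > 0" "X = rot t ** diag2 p q ** transpose (rot t)"
    using posdef_diagonalize[OF assms] .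
  define L where "L = rot t ** diag2 (sqrt p) (sqrt q)"
  have "X = L ** transpose L"
    unfolding * L_def matrix_transpose_mul diag2_transpose
    using * by (simp add: matrix_mul_assoc) (simp add: diag2_mult flip: matrix_mul_assoc)
  moreover have "invertible L" unfolding L_def
    using * by (intro invertible_mult rot_invertible diag2_invertible) auto
  ultimately show ?thesis using that by blast
qed

text \<open>The eigenvalues of \<open>Y\<close> exceed 1, so each square root lies strictly between
  1 and the eigenvalue.\<close>

lemma posdef_sqrt_exists:
  assumes "posdef_mat Y" "posdef_mat (Y - mat 1)"
  obtains G where "posdef_mat G" "posdef_mat (G - mat 1)" "posdef_mat (Y - G)" "G ** G = Y"
proof -
  obtain p q t where *: "p > 0" "q > 0" "Y = rot t ** diag2 p q ** transpose (rot t)"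
    using posdef_diagonalize[OF assms(1)] .
  have conj_diff: "rot t ** A ** transpose (rot t) - rot t ** B ** transpose (rot t)
      = rot t ** (A - B) ** transpose (rot t)" for A B
    by (simp add: matrix_mult_diff)
  have one: "mat 1 = rot t ** diag2 1 1 ** transpose (rot t)"
    by (simp add: diag2_one[symmetric])
  have "Y - mat 1 = rot t ** diag2 (p - 1) (q - 1) ** transpose (rot t)"
    unfolding * by (subst one) (simp add: conj_diff diag2_diff)
  hence "p > 1" "q > 1"
    using assms(2) by (simp_all add: posdef_orth_conj)
  define G where "G = rot t ** diag2 (sqrt p) (sqrt q) ** transpose (rot t)"
  have "posdef_mat G" unfolding G_def posdef_orth_conj using * by simp
  moreover have "posdef_mat (G - mat 1)"
    unfolding G_def by (subst one) (use \<open>p > 1\<close> \<open>q > 1\<close> in \<open>simp add: conj_diff diag2_diff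
        posdef_orth_conj\<close>)
  moreover have "posdef_mat (Y - G)"
  proof -
    have "x > sqrt x" if "x > 1" for x
      using that by (metis less_trans mult_strict_left_mono real_sqrt_gt_1_iff real_sqrt_mult_self
          abs_of_pos mult.right_neutral zero_less_one)
    thus ?thesis unfolding * G_def
      using \<open>p > 1\<close> \<open>q > 1\<close> by (simp add: conj_diff diag2_diff posdef_orth_conj)
  qed
  moreover have "G ** G = Y"
  proof -
    have "G ** G = rot t ** (diag2 (sqrt p) (sqrt q) ** (transpose (rot t) ** rot t) ** diag2
        (sqrt p) (sqrt q)) ** transpose (rot t)"
      unfolding G_def by (simp add: matrix_mul_assoc del: rot_orthogonal)
    also have "\<dots> = Y" unfolding * using *(1,2) by (simp add: diag2_mult)
    finally show ?thesis .
  qed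
  ultimately show ?thesis using that by blast
qed

lemma posdef_nth:
  assumes "posdef_mat G" shows "G $ 1 $ 1 > 0" "G $ 2 $ 2 > 0" "G $ 1 $ 2 = G $ 2 $ 1"
proof -
  have *: "dotp v (G *v v) > 0" if "v \<noteq> 0" for v
    using that assms by (simp add: posdef_dotp)
  show "G $ 1 $ 1 > 0" "G $ 2 $ 2 > 0"
    using *[of "axis 1 1"] *[of "axis 2 1"]
    by (simp_all add: dotp_2 matrix_vector_mult_2 axis_def vec_eq_iff)
  show "G $ 1 $ 2 = G $ 2 $ 1" using posdef_sym[OF assms] by (simp add: sym_mat_2)
qed

lemma det_posdef: assumes "posdef_mat G" shows "det G > 0"
proof -
  obtain L :: "real^2^2" where "invertible L" "G = L ** transpose L" using posdef_factor[OF assms] .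
  thus ?thesis by (metis det_mul det_transpose invertible_det_nz not_real_square_gt_zero)
qed

text \<open>By Cayley--Hamilton G is determined by \<open>G\<^sup>2\<close> together with the trace and determinant
  of G, and those are the positive solutions of equations that only involve \<open>G\<^sup>2\<close>.\<close>

lemma posdef_sqrt_unique:
  assumes "posdef_mat G" "posdef_mat H" "G ** G = H ** H"
  shows "G = H"
proof -
  define tr :: "real^2^2 \<Rightarrow> real" where "tr X = X $ 1 $ 1 + X $ 2 $ 2" for X
  have "(det G)\<^sup>2 = (det H)\<^sup>2"
    using arg_cong[OF assms(3), of det] by (simp add: det_mul power2_eq_square)
  hence d: "det G = det H"
    using det_posdef[OF assms(1)] det_posdef[OF assms(2)] by (metis less_imp_le
        power2_eq_iff_nonneg)
  have ct: "tr (X ** X) = (tr X)\<^sup>2 - 2 * det X" for X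
    by (simp add: tr_def matrix_matrix_mult_2 det_2 power2_eq_square algebra_simps)
  have "(tr G)\<^sup>2 = (tr H)\<^sup>2" using ct[of G] ct[of H] assms(3) d by simp
  moreover have "tr G > 0" "tr H > 0"
    using posdef_nth[OF assms(1)] posdef_nth[OF assms(2)] by (simp_all add: tr_def)
  ultimately have t: "tr G = tr H" by (metis less_imp_le power2_eq_iff_nonneg)
  have ch: "(X ** X) $ i $ j = tr X * X $ i $ j - (if i = j then det X else 0)" for X ::
      "real^2^2" and i j
    using exhaust_2[of i] exhaust_2[of j]
    by (auto simp: tr_def matrix_matrix_mult_2 det_2 algebra_simps)
  have "tr G * G $ i $ j = tr G * H $ i $ j" for i j
    using ch[of G i j] ch[of H i j] assms(3) d t by (cases "i = j") auto
  thus ?thesis using \<open>tr G > 0\<close> by (simp add: vec_eq_iff)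
qed

section \<open>Lagrangians and maximal triples\<close>

abbreviation act :: "'a::comm_ring_1^(2 + 2)^(2 + 2) \<Rightarrow> ('a^(2 + 2)) set \<Rightarrow> ('a^(2 + 2)) set" where
  "act g l \<equiv> (*v) g ` l"

lemma act_act: "act g (act h l) = act (g ** h) l"
  by (simp add: image_image matrix_vector_mul_assoc)

lemma act_one [simp]: "act (mat 1) l = l"
  by simp

lemma act_inv:
  assumes "g \<in> Sp4"
  shows "act (matrix_inv g) (act g l) = l" "act g (act (matrix_inv g) l) = l"
  using invertible_matrix_inv[OF Sp4_invertible[OF assms]] by (simp_all add: act_act)

lemma act_eq_iff: "g \<in> Sp4 \<Longrightarrow> act g l = act g l' \<longleftrightarrow> l = l'"
  by (metis act_inv(1))

text \<open>The span of the columns is the image of the stacked matrix, hence the graph of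
  \<open>X\<close>, with the argument in the second block. Later arguments use the graph and not the
  span.\<close>

lemma mat_lag_range: "mat_lag X = range (\<lambda>q. pv (X *v q) q)"
proof -
  have *: "stacked X (mat 1) *v q = pv (X *v q) q" for q
    by (rule vec_sum_eqI) (simp_all add: stacked_def matrix_vector_mult_def mat_def if_distrib[of
        "\<lambda>x. x * _"] cong: if_cong)
  have col: "column i M = M *v axis i 1" for i and M :: "'a^2^(2 + 2)"
    by (simp add: vec_eq_iff column_def matrix_vector_mult_def axis_def if_distrib[of "\<lambda>x. _ * x"]
        cong: if_cong)
  have "mat_lag X = range (\<lambda>q. stacked X (mat 1) *v q)"
  proof
    show "mat_lag X \<subseteq> range (\<lambda>q. stacked X (mat 1) *v q)"
      unfolding mat_lag_def
    proof (rule vec.span_minimal)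
      show "columns (stacked X (mat 1)) \<subseteq> range (\<lambda>q. stacked X (mat 1) *v q)"
        unfolding columns_def using col by blast
      show "vec.subspace (range (\<lambda>q. stacked X (mat 1) *v q))"
        by (metis matrix_vector_mul_linear_gen vec.subspace_UNIV vec.subspace_image)
    qed
    show "range (\<lambda>q. stacked X (mat 1) *v q) \<subseteq> mat_lag X"
      by (auto simp: mat_lag_def intro: matrix_vector_mult_in_columnspace_gen)
  qed
  thus ?thesis by (simp add: *)
qed

lemma pv_in_mat_lag [simp]: "pv x y \<in> mat_lag X \<longleftrightarrow> x = X *v y"
  by (auto simp: mat_lag_range)

lemma mat_lag_inject [simp]: "mat_lag X = mat_lag Y \<longleftrightarrow> X = Y"
proof
  assume *: "mat_lag X = mat_lag Y"
  have "X *v q = Y *v q" for q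
    using pv_in_mat_lag[of "X *v q" q Y] unfolding *[symmetric] by simp
  thus "X = Y" by (simp add: matrix_eq)
qed simp

lemma infty_lag_range: "infty_lag = range (\<lambda>q. pv q 0)"
proof -
  have a: "axis (Inl k) 1 = pv (axis k 1) (0 :: real^2)" for k
    by (rule vec_sum_eqI) (simp_all add: axis_def)
  show ?thesis
  proof
    have "subspace (range (\<lambda>q. pv q (0 :: real^2)))"
    proof (rule linear_subspace_image[OF _ subspace_UNIV])
      show "linear (\<lambda>q. pv q (0 :: real^2))"
        by (rule linearI; rule vec_sum_eqI) simp_all
    qed
    thus "infty_lag \<subseteq> range (\<lambda>q. pv q 0)"
      unfolding infty_lag_def a by (intro span_minimal) auto
    show "range (\<lambda>q. pv q 0) \<subseteq> infty_lag"
    proof safe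
      fix q :: "real^2"
      have "pv q 0 = q $ 1 *\<^sub>R pv (axis 1 1) 0 + q $ 2 *\<^sub>R pv (axis 2 1) 0"
      proof (rule vec_sum_eqI)
        show "pv q 0 $ Inl k = (q $ 1 *\<^sub>R pv (axis 1 1) 0 + q $ 2 *\<^sub>R pv (axis 2 1) 0) $ Inl k"
            for k
          using exhaust_2[of k] by (auto simp: axis_def)
      qed simp
      thus "pv q 0 \<in> infty_lag"
        unfolding infty_lag_def a by (simp add: span_add span_mul span_base)
    qed
  qed
qed

lemma pv_in_infty_lag [simp]: "pv x y \<in> infty_lag \<longleftrightarrow> y = 0"
  by (auto simp: infty_lag_range)

section \<open>Fractional linear action on graphs and on infinity\<close>

lemma range_comp_invertible:
  fixes N :: "'a::comm_ring_1^'n^'n"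
  assumes "invertible N" shows "range (\<lambda>q. f (N *v q)) = range f"
proof
  show "range f \<subseteq> range (\<lambda>q. f (N *v q))"
    by (rule image_subsetI, rule range_eqI[of _ _ "matrix_inv N *v _"])
      (simp add: invertible_matrix_inv_vec[OF assms])
qed auto

text \<open>The hypothesis is X' = (A X + B) (C X + D)^-1 with the inverse cleared, so that
  applications only multiply matrices. The lemmas after it treat the cases in which infinity is
  source or target.\<close>

lemma act_block_mat_lag:
  fixes A :: "'a::field^2^2"
  assumes "A ** X + B = X' ** (C ** X + D)" "invertible (C ** X + D)"
  shows "act (block_matrix A B C D) (mat_lag X) = mat_lag X'"
proof -
  let ?N = "C ** X + D"
  have "act (block_matrix A B C D) (mat_lag X) = range (\<lambda>q. pv ((A ** X + B) *v q) (?N *v q))"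
    by (simp add: mat_lag_range image_image matrix_vector_add flip: matrix_vector_mul_assoc)
  also have "\<dots> = range (\<lambda>q. pv (X' *v (?N *v q)) (?N *v q))"
    by (simp add: assms(1) flip: matrix_vector_mul_assoc)
  also have "\<dots> = mat_lag X'"
    unfolding mat_lag_range by (rule range_comp_invertible) (rule assms(2))
  finally show ?thesis .
qed

lemma act_block_infty:
  assumes "A = X' ** C" "invertible C"
  shows "act (block_matrix A B C D) infty_lag = mat_lag X'"
proof -
  have "act (block_matrix A B C D) infty_lag = range (\<lambda>q. pv (X' *v (C *v q)) (C *v q))"
    by (simp add: infty_lag_range image_image assms(1) flip: matrix_vector_mul_assoc)
  also have "\<dots> = mat_lag X'"
    unfolding mat_lag_range by (rule range_comp_invertible) (rule assms(2))
  finally show ?thesis .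
qed

lemma act_block_infty_infty:
  assumes "invertible A"
  shows "act (block_matrix A B 0 D) infty_lag = infty_lag"
  using range_comp_invertible[OF assms, of "\<lambda>q. pv q 0"]
  by (simp add: infty_lag_range image_image)

lemma act_block_mat_infty:
  fixes A :: "real^2^2"
  assumes "C ** X + D = 0" "invertible (A ** X + B)"
  shows "act (block_matrix A B C D) (mat_lag X) = infty_lag"
proof -
  have "act (block_matrix A B C D) (mat_lag X) = range (\<lambda>q. pv ((A ** X + B) *v q) ((C ** X + D)
      *v q))"
    by (simp add: mat_lag_range image_image matrix_vector_add flip: matrix_vector_mul_assoc)
  also have "\<dots> = infty_lag"
    using range_comp_invertible[OF assms(2), of "\<lambda>q. pv q 0"]
    by (simp add: infty_lag_range assms(1))
  finally show ?thesis .
qed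

text \<open>The elements of \<open>Sp4\<close> that fix infinity; on graphs they act by congruence
  with \<open>K\<close> followed by translation by \<open>S\<close>.\<close>

definition affine_sp :: "real^2^2 \<Rightarrow> real^2^2 \<Rightarrow> real^(2 + 2)^(2 + 2)" where
  "affine_sp K S = block_matrix K (S ** transpose (matrix_inv K)) 0 (transpose (matrix_inv K))"

lemma affine_sp_Sp4:
  assumes "invertible K" "sym_mat S" shows "affine_sp K S \<in> Sp4"
  using assms transpose_invertible_inv[OF assms(1)]
  by (simp add: affine_sp_def block_in_Sp4_iff matrix_transpose_mul sym_mat_def matrix_mul_assoc)

lemma affine_sp_infty: "invertible K \<Longrightarrow> act (affine_sp K S) infty_lag = infty_lag"
  by (simp add: affine_sp_def act_block_infty_infty)

lemma affine_sp_mat_lag: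
  assumes "invertible K"
  shows "act (affine_sp K S) (mat_lag X) = mat_lag (K ** X ** transpose K + S)"
  unfolding affine_sp_def
proof (rule act_block_mat_lag)
  have t: "transpose K ** transpose (matrix_inv K) = mat 1"
    using transpose_invertible_inv[OF assms] by simp
  show "invertible (0 ** X + transpose (matrix_inv K))"
    unfolding invertible_def using transpose_invertible_inv[OF assms] by auto
  have "(K ** X ** transpose K) ** transpose (matrix_inv K) = K ** X ** (transpose K ** transpose
      (matrix_inv K))"
    by (simp add: matrix_mul_assoc)
  also have "\<dots> = K ** X" by (simp add: t)
  finally show "K ** X + S ** transpose (matrix_inv K) =
    (K ** X ** transpose K + S) ** (0 ** X + transpose (matrix_inv K))"
    by (simp add: matrix_mult_add)
qed

text \<open>Fixing infinity kills the lower left block. The block equations then make D the inverse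
  transpose of A and make B A^T symmetric, which is the translation part.\<close>

lemma stab_infty:
  assumes "g \<in> Sp4" "act g infty_lag = infty_lag"
  obtains K S where "invertible K" "sym_mat S" "g = affine_sp K S"
proof -
  obtain A B C D where g: "g = block_matrix A B C D" by (rule block_matrix_cases)
  have "C *v q = 0" for q
  proof -
    have "g *v pv q 0 \<in> infty_lag" using assms(2) by (metis image_eqI pv_in_infty_lag)
    thus ?thesis by (simp add: g)
  qed
  hence C: "C = 0" by (simp add: matrix_eq)
  have *: "transpose A ** D = mat 1" "transpose B ** D = transpose D ** B"
    using assms(1) unfolding g C block_in_Sp4_iff by auto
  hence inv: "invertible A"
    by (metis invertible_left_inverse invertible_right_inverse matrix_transpose_mul transpose_mat
        transpose_transpose)
  hence D: "D = transpose (matrix_inv A)"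
    by (metis * matrix_mul_assoc matrix_mul_lid matrix_mul_rid transpose_invertible_inv(1))
  define S where "S = B ** transpose A"
  have tD: "transpose D = matrix_inv A" by (simp add: D)
  have "A ** transpose B = B ** transpose A"
  proof -
    have "transpose B = transpose D ** B ** transpose A"
      by (metis "*"(1,2) D inv matrix_mul_assoc matrix_mul_rid transpose_invertible_inv(1))
    hence "A ** transpose B = (A ** matrix_inv A) ** B ** transpose A" by (simp add: tD
        matrix_mul_assoc)
    thus ?thesis using invertible_matrix_inv[OF inv] by simp
  qed
  hence "sym_mat S" by (simp add: S_def sym_mat_def matrix_transpose_mul)
  moreover have "B = S ** transpose (matrix_inv A)"
    unfolding S_def using transpose_invertible_inv[OF inv] by (simp flip: matrix_mul_assoc)
  ultimately show ?thesis using that[OF inv] unfolding g affine_sp_def C D by blast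
qed

text \<open>Two elements of SL(2,R), the second one primed, that act separately on the two diagonal
  entries of a matrix. On diagonal matrices the geometry is that of a product of two hyperbolic
  planes.\<close>

definition diag_sp :: "real \<Rightarrow> real \<Rightarrow> real \<Rightarrow> real \<Rightarrow> real \<Rightarrow> real \<Rightarrow> real \<Rightarrow> real \<Rightarrow> real^(2 + 2)^(2 +
    2)" where
  "diag_sp a b c d a' b' c' d' =
     block_matrix (diag2 a a') (diag2 b b') (diag2 c c') (diag2 d d')"

lemma diag_sp_Sp4:
  assumes "a * d - b * c = 1" "a' * d' - b' * c' = 1"
  shows "diag_sp a b c d a' b' c' d' \<in> Sp4"
  using assms unfolding diag_sp_def block_in_Sp4_iff
  by (simp add: diag2_transpose diag2_mult diag2_diff diag2_one algebra_simps)

lemma diag_sp_mat_lag: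
  assumes "c * x + d \<noteq> 0" "c' * x' + d' \<noteq> 0"
  shows "act (diag_sp a b c d a' b' c' d') (mat_lag (diag2 x x'))
    = mat_lag (diag2 ((a * x + b) / (c * x + d)) ((a' * x' + b') / (c' * x' + d')))"
  unfolding diag_sp_def
  by (rule act_block_mat_lag) (use assms in \<open>simp_all add: diag2_mult diag2_add diag2_invertible\<close>)

lemma diag_sp_infty:
  assumes "c \<noteq> 0" "c' \<noteq> 0"
  shows "act (diag_sp a b c d a' b' c' d') infty_lag = mat_lag (diag2 (a / c) (a' / c'))"
  unfolding diag_sp_def
  by (rule act_block_infty) (use assms in \<open>simp_all add: diag2_mult diag2_invertible\<close>)

lemma diag_sp_mat_infty:
  assumes "c * x + d = 0" "c' * x' + d' = 0" "a * x + b \<noteq> 0" "a' * x' + b' \<noteq> 0"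
  shows "act (diag_sp a b c d a' b' c' d') (mat_lag (diag2 x x')) = infty_lag"
  unfolding diag_sp_def
  by (rule act_block_mat_infty) (use assms in \<open>simp_all add: diag2_mult diag2_add diag2_invertible
      diag2_zero\<close>)

section \<open>The orbit of infinity and maximal triples\<close>

lemma lagrangian_act:
  assumes "g \<in> Sp4" "lagrangian l" shows "lagrangian (act g l)"
  unfolding lagrangian_def
proof (intro conjI ballI)
  show "subspace (act g l)"
    using assms(2) by (simp add: lagrangian_def linear_subspace_image)
  have "inj ((*v) g)"
    by (metis Sp4_invertible assms(1) injI invertible_matrix_inv_vec(2))
  thus "dim (act g l) = 2"
    using assms(2) by (simp add: lagrangian_def dim_image_eq inj_on_subset)
  fix v w assume "v \<in> act g l" "w \<in> act g l"
  thus "v \<bullet> (J4 *v w) = 0"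
    using assms by (auto simp: lagrangian_def Sp4_iff simp flip: symp_J4)
qed

lemma lagrangian_infty: "lagrangian infty_lag"
  unfolding lagrangian_def
proof (intro conjI ballI)
  show "subspace infty_lag" by (simp add: infty_lag_def)
  have "independent {axis (Inl 1) 1, axis (Inl 2) (1::real) :: real^(2 + 2)}"
    by (rule independent_mono[OF independent_Basis]) (auto simp: Basis_vec_def)
  moreover have "axis (Inl 1) 1 \<noteq> (axis (Inl 2) 1 :: real^(2 + 2))"
    by (simp add: axis_eq_axis)
  ultimately show "dim infty_lag = 2"
    unfolding infty_lag_def by (simp add: dim_span_eq_card_independent dim_eq_card_independent)
  fix v w assume "v \<in> infty_lag" "w \<in> infty_lag"
  thus "v \<bullet> (J4 *v w) = 0"
    by (auto simp: infty_lag_range dotp_simps simp flip: symp_J4)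
qed

text \<open>All members of maximal triples lie in this orbit. It is used in place of
  \<open>lagrangian\<close> because it hands over a symplectic map that normalises the
  Lagrangian.\<close>

definition lags :: "lag set" where
  "lags = {act g infty_lag | g. g \<in> Sp4}"

lemma lags_act: "g \<in> Sp4 \<Longrightarrow> l \<in> lags \<Longrightarrow> act g l \<in> lags"
  by (auto simp: lags_def act_act) (metis Sp4_mult)

lemma infty_in_lags [simp]: "infty_lag \<in> lags"
  unfolding lags_def by (metis (mono_tags, lifting) Sp4_one act_one mem_Collect_eq)

lemma mat_lag_in_lags:
  assumes "sym_mat X" shows "mat_lag X \<in> lags"
proof -
  have "act (diag_sp 0 1 (-1) 0 0 1 (-1) 0) infty_lag = mat_lag 0"
    by (simp add: diag_sp_infty diag2_zero)
  moreover have "diag_sp 0 1 (-1) 0 0 1 (-1) 0 \<in> Sp4" by (rule diag_sp_Sp4) auto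
  ultimately have "mat_lag 0 \<in> lags" by (metis infty_in_lags lags_act)
  hence "act (affine_sp (mat 1) X) (mat_lag 0) \<in> lags"
    by (rule lags_act[rotated]) (simp add: affine_sp_Sp4 assms invertible_det_nz)
  thus ?thesis by (simp add: affine_sp_mat_lag invertible_det_nz)
qed

lemma lags_lagrangian: "l \<in> lags \<Longrightarrow> lagrangian l"
  by (auto simp: lags_def intro: lagrangian_act lagrangian_infty)

lemma act_Int: "g \<in> Sp4 \<Longrightarrow> act g (l \<inter> l') = act g l \<inter> act g l'"
  by (metis Sp4_invertible image_Int injI invertible_matrix_inv_vec(2))

lemma transverse_act: "g \<in> Sp4 \<Longrightarrow> transverse l l' \<Longrightarrow> transverse (act g l) (act g l')"
  by (simp add: transverse_def flip: act_Int)

lemma sym_0 [simp]: "sym_mat 0" by (simp add: sym_mat_def)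

lemma sym_1 [simp]: "sym_mat (mat 1)" by (simp add: sym_mat_def transpose_mat)

text \<open>Being Lagrangian and being transverse are invariant under \<open>Sp4\<close>, so they
  are checked on the standard triple.\<close>

lemma maximal_triple_iff:
  "maximal_triple l1 l2 l3 \<longleftrightarrow>
    (\<exists>g\<in>Sp4. l1 = act g infty_lag \<and> l2 = act g (mat_lag 0) \<and> l3 = act g (mat_lag (mat 1)))"
proof
  assume "\<exists>g\<in>Sp4. l1 = act g infty_lag \<and> l2 = act g (mat_lag 0) \<and> l3 = act g (mat_lag (mat 1))"
  then obtain g where g: "g \<in> Sp4"
    and l: "l1 = act g infty_lag" "l2 = act g (mat_lag 0)" "l3 = act g (mat_lag (mat 1))" by blast
  have "transverse infty_lag (mat_lag 0)" "transverse infty_lag (mat_lag (mat 1))"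
    "transverse (mat_lag 0) (mat_lag (mat 1 :: real^2^2))"
    by (auto simp: transverse_def infty_lag_range mat_lag_range)
  moreover have "lagrangian infty_lag" "lagrangian (mat_lag 0)" "lagrangian (mat_lag (mat 1))"
    by (simp_all add: lags_lagrangian mat_lag_in_lags)
  ultimately show "maximal_triple l1 l2 l3"
    unfolding maximal_triple_def using g l transverse_act lagrangian_act by blast
qed (simp add: maximal_triple_def)

lemma maximal_triple_act:
  "g \<in> Sp4 \<Longrightarrow> maximal_triple a b c \<Longrightarrow> maximal_triple (act g a) (act g b) (act g c)"
  unfolding maximal_triple_iff by (metis Sp4_mult act_act)

lemma maximal_triple_lags:
  "maximal_triple a b c \<Longrightarrow> a \<in> lags \<and> b \<in> lags \<and> c \<in> lags"
  unfolding maximal_triple_iff by (auto intro!: lags_act mat_lag_in_lags)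

text \<open>The transporting map fixes infinity, so it is affine and sends (0, Id) to (S, K K^T +
  S). Conversely, a factorisation Y - X = L L^T gives such a map.\<close>

lemma maximal_triple_infty_iff:
  "maximal_triple infty_lag l m \<longleftrightarrow>
    (\<exists>X Y. sym_mat X \<and> posdef_mat (Y - X) \<and> l = mat_lag X \<and> m = mat_lag Y)"
proof
  assume "maximal_triple infty_lag l m"
  then obtain g where g: "g \<in> Sp4" "act g infty_lag = infty_lag" "l = act g (mat_lag 0)" "m = act
      g (mat_lag (mat 1))"
    unfolding maximal_triple_iff by metis
  from g(1,2) obtain K S where K: "invertible K" "sym_mat S" "g = affine_sp K S" by (rule
      stab_infty)
  have "l = mat_lag S" "m = mat_lag (K ** mat 1 ** transpose K + S)"
    unfolding g K by (simp_all add: affine_sp_mat_lag K)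
  moreover have "posdef_mat (K ** mat 1 ** transpose K)" by (intro posdef_congruent K) simp
  ultimately show "\<exists>X Y. sym_mat X \<and> posdef_mat (Y - X) \<and> l = mat_lag X \<and> m = mat_lag Y"
    using K(2) by (intro exI[of _ S] exI[of _ "K ** mat 1 ** transpose K + S"]) simp
next
  assume "\<exists>X Y. sym_mat X \<and> posdef_mat (Y - X) \<and> l = mat_lag X \<and> m = mat_lag Y"
  then obtain X Y where *: "sym_mat X" "posdef_mat (Y - X)" "l = mat_lag X" "m = mat_lag Y" by blast
  obtain L :: "real^2^2" where L: "invertible L" "Y - X = L ** transpose L" using posdef_factor[OF
      *(2)] .
  have "L ** transpose L + X = Y" using L(2) by (metis diff_add_cancel)
  thus "maximal_triple infty_lag l m"
    unfolding maximal_triple_iff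
    by (intro bexI[of _ "affine_sp L X"])
      (simp_all add: affine_sp_Sp4 affine_sp_infty affine_sp_mat_lag L *)
qed

lemma maximal_triple_infty:
  "sym_mat X \<Longrightarrow> maximal_triple infty_lag (mat_lag X) (mat_lag Y) \<longleftrightarrow> posdef_mat (Y - X)"
  by (auto simp: maximal_triple_infty_iff)

lemma maximal_triple_cyc: "maximal_triple a b c \<Longrightarrow> maximal_triple b c a"
proof -
  assume "maximal_triple a b c"
  then obtain g where g: "g \<in> Sp4" "a = act g infty_lag" "b = act g (mat_lag 0)" "c = act g
      (mat_lag (mat 1))"
    unfolding maximal_triple_iff by blast
  \<comment> \<open>On each diagonal entry this is z -> 1 / (1 - z), the map of order three with
    infinity -> 0 -> 1 -> infinity.\<close>
  let ?k = "diag_sp 0 1 (-1) 1 0 1 (-1) 1"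
  have "?k \<in> Sp4" by (rule diag_sp_Sp4) auto
  moreover have "act ?k infty_lag = mat_lag 0" "act ?k (mat_lag 0) = mat_lag (mat 1)"
    "act ?k (mat_lag (mat 1)) = infty_lag"
    by (simp_all add: diag_sp_infty diag_sp_mat_lag diag_sp_mat_infty diag2_zero diag2_one)
  ultimately show ?thesis
    unfolding maximal_triple_iff g
    by (intro bexI[of _ "g ** ?k"]) (simp_all add: Sp4_mult g flip: act_act)
qed

lemma maximal_triple_normalize:
  assumes "maximal_triple a b c"
  obtains g where "g \<in> Sp4" "act g a = infty_lag" "act g b = mat_lag 0" "act g c = mat_lag (mat 1)"
proof -
  obtain h where h: "h \<in> Sp4" "a = act h infty_lag" "b = act h (mat_lag 0)" "c = act h (mat_lag
      (mat 1))"
    using assms unfolding maximal_triple_iff by blast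
  show ?thesis
    by (rule that[of "matrix_inv h"]) (simp_all only: h act_inv[OF h(1)] Sp4_inv)
qed

lemma maximal_triple_act_iff:
  "g \<in> Sp4 \<Longrightarrow> maximal_triple (act g a) (act g b) (act g c) \<longleftrightarrow> maximal_triple a b c"
  by (metis Sp4_inv act_inv(1) maximal_triple_act)

lemma maximal_triple_antisym: "maximal_triple a b c \<Longrightarrow> \<not> maximal_triple a c b"
proof
  assume "maximal_triple a b c" "maximal_triple a c b"
  from this(1) obtain g where g: "g \<in> Sp4" "act g a = infty_lag" "act g b = mat_lag 0" "act g c =
      mat_lag (mat 1)"
    by (rule maximal_triple_normalize)
  have "maximal_triple infty_lag (mat_lag (mat 1)) (mat_lag 0)"
    using maximal_triple_act[OF g(1) \<open>maximal_triple a c b\<close>] by (simp add: g)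
  thus False using posdef_not_uminus[of "mat 1"] by (simp add: maximal_triple_infty)
qed

lemma posdef_diff_trans: "posdef_mat (Y - X) \<Longrightarrow> posdef_mat (Z - Y) \<Longrightarrow> posdef_mat (Z - X)"
  using posdef_add[of "Y - X" "Z - Y"] by simp

text \<open>With \<open>a\<close> at infinity the first part is transitivity of the order of
  symmetric matrices. The substantial part is the second, which forgets the base point.\<close>

lemma maximal_triple_trans:
  assumes "maximal_triple a b c" "maximal_triple a c d"
  shows "maximal_triple a b d" "maximal_triple b c d"
proof -
  obtain g where g: "g \<in> Sp4" "act g a = infty_lag" "act g b = mat_lag 0" "act g c = mat_lag (mat
      1)"
    using assms(1) by (rule maximal_triple_normalize)
  have "maximal_triple infty_lag (mat_lag (mat 1)) (act g d)"
    using maximal_triple_act[OF g(1) assms(2)] by (simp add: g)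
  then obtain Z where Z: "posdef_mat (Z - mat 1)" "act g d = mat_lag Z"
    by (auto simp: maximal_triple_infty_iff)
  have Z0: "posdef_mat (Z - 0)" using posdef_diff_trans[of "mat 1" 0 Z] Z by simp
  hence "maximal_triple (act g a) (act g b) (act g d)" by (simp add: g Z maximal_triple_infty)
  thus "maximal_triple a b d" using maximal_triple_act_iff[OF g(1)] by simp
  obtain p q t where pq: "p > 0" "q > 0" "Z = rot t ** diag2 p q ** transpose (rot t)"
    using posdef_diagonalize Z0 by (metis diff_zero)
  have "Z - mat 1 = rot t ** diag2 (p - 1) (q - 1) ** transpose (rot t)"
    unfolding pq by (simp add: matrix_mult_diff diag2_one flip: diag2_diff) (simp flip: diag2_one)
  hence "p > 1" "q > 1" using Z(1) by (simp_all add: posdef_orth_conj)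
  \<comment> \<open>The map \<open>?r\<close> diagonalises Z and fixes 0 and Id. On each diagonal
    entry \<open>?j\<close> is z -> -1/z, which moves 0 to infinity and preserves the inequality
    between 1 and an eigenvalue.\<close>
  let ?j = "diag_sp 0 (-1) 1 0 0 (-1) 1 0" and ?r = "affine_sp (transpose (rot t)) 0"
  have inv: "invertible (transpose (rot t))" by (simp add: rot_transpose rot_invertible)
  have j: "?j \<in> Sp4" by (rule diag_sp_Sp4) auto
  have r: "?r \<in> Sp4" by (rule affine_sp_Sp4) (auto simp: inv)
  have "act ?r (mat_lag Z) = mat_lag (diag2 p q)"
  proof -
    have "transpose (rot t) ** Z ** rot t = (transpose (rot t) ** rot t) ** diag2 p q **
        (transpose (rot t) ** rot t)"
      unfolding pq by (simp add: matrix_mul_assoc del: rot_orthogonal)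
    thus ?thesis by (simp add: affine_sp_mat_lag inv)
  qed
  moreover have "act ?r (mat_lag 0) = mat_lag 0" "act ?r (mat_lag (mat 1)) = mat_lag (mat 1)"
    by (simp_all add: affine_sp_mat_lag inv)
  moreover have "maximal_triple infty_lag (act ?j (mat_lag (diag2 1 1))) (act ?j (mat_lag (diag2 p
      q)))"
    using \<open>p > 1\<close> \<open>q > 1\<close>
    by (simp add: diag_sp_mat_lag maximal_triple_infty diag2_diff)
  hence "maximal_triple (act ?j (mat_lag 0)) (act ?j (mat_lag (diag2 1 1))) (act ?j (mat_lag
      (diag2 p q)))"
    by (simp add: diag_sp_mat_infty diag2_zero)
  ultimately have "maximal_triple (act ?r (act g b)) (act ?r (act g c)) (act ?r (act g d))"
    using maximal_triple_act_iff[OF j] by (simp add: g Z diag2_one)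
  thus "maximal_triple b c d" using maximal_triple_act_iff[OF g(1)] maximal_triple_act_iff[OF r]
      by simp
qed

section \<open>Harmonic quadruples of Lagrangians\<close>

text \<open>The arguments follow the cyclic order, so the ends \<open>a\<close>, \<open>b\<close> of
  one tube alternate with the ends \<open>c\<close>, \<open>d\<close> of the other.\<close>

definition harmonic :: "lag \<Rightarrow> lag \<Rightarrow> lag \<Rightarrow> lag \<Rightarrow> bool" where
  "harmonic a c b d \<longleftrightarrow> (\<exists>g\<in>Sp4. a = act g infty_lag \<and> c = act g (mat_lag (- mat 1)) \<and>
     b = act g (mat_lag 0) \<and> d = act g (mat_lag (mat 1)))"

lemma harmonic_act:
  "g \<in> Sp4 \<Longrightarrow> harmonic a c b d \<Longrightarrow> harmonic (act g a) (act g c) (act g b) (act g d)"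
  unfolding harmonic_def by (metis Sp4_mult act_act)

lemma harmonic_act_iff:
  "g \<in> Sp4 \<Longrightarrow> harmonic (act g a) (act g c) (act g b) (act g d) \<longleftrightarrow> harmonic a c b d"
  by (metis Sp4_inv act_inv(1) harmonic_act)

lemma harmonic_cyc:
  assumes "harmonic a c b d" shows "harmonic c b d a"
proof -
  obtain g where g: "g \<in> Sp4" "a = act g infty_lag" "c = act g (mat_lag (- mat 1))"
    "b = act g (mat_lag 0)" "d = act g (mat_lag (mat 1))"
    using assms unfolding harmonic_def by blast
  \<comment> \<open>Scales z -> (z + 1) / (1 - z) to determinant 1. This is the quarter turn
    infinity -> -1 -> 0 -> 1 -> infinity.\<close>
  define s where "s = 1 / sqrt (2 :: real)"
  have s: "s * s = 1 / 2" "s > 0" by (simp_all add: s_def)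
  let ?k = "diag_sp s s (-s) s s s (-s) s"
  have "?k \<in> Sp4" using s by (intro diag_sp_Sp4) auto
  moreover have "act ?k infty_lag = mat_lag (- mat 1)" "act ?k (mat_lag (- mat 1)) = mat_lag 0"
    "act ?k (mat_lag 0) = mat_lag (mat 1)" "act ?k (mat_lag (mat 1)) = infty_lag"
    using s unfolding diag2_one diag2_uminus diag2_zero
    by (simp_all add: diag_sp_infty diag_sp_mat_lag diag_sp_mat_infty)
  ultimately show ?thesis
    unfolding harmonic_def
    by (intro bexI[of _ "g ** ?k"]) (simp_all add: Sp4_mult g flip: act_act)
qed

text \<open>A symplectic map that fixes infinity and 0 is congruence by an invertible K; it sends
  (-Id, Id) to (-K K^T, K K^T).\<close>

lemma harmonic_infty_0:
  "harmonic infty_lag c (mat_lag 0) d \<longleftrightarrow> (\<exists>A. posdef_mat A \<and> c = mat_lag (- A) \<and> d = mat_lag A)"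
proof
  assume "harmonic infty_lag c (mat_lag 0) d"
  then obtain g where g: "g \<in> Sp4" "act g infty_lag = infty_lag" "c = act g (mat_lag (- mat 1))"
    "mat_lag 0 = act g (mat_lag 0)" "d = act g (mat_lag (mat 1))"
    unfolding harmonic_def by metis
  from g(1,2) obtain K S where K: "invertible K" "sym_mat S" "g = affine_sp K S" by (rule
      stab_infty)
  have "S = 0" using g(4) by (simp add: K affine_sp_mat_lag)
  moreover have "posdef_mat (K ** mat 1 ** transpose K)" by (intro posdef_congruent K) simp
  ultimately show "\<exists>A. posdef_mat A \<and> c = mat_lag (- A) \<and> d = mat_lag A"
    unfolding g(3,5) K(3)
    by (intro exI[of _ "K ** mat 1 ** transpose K"]) (simp add: affine_sp_mat_lag K matrix_neg_mult)
next
  assume "\<exists>A. posdef_mat A \<and> c = mat_lag (- A) \<and> d = mat_lag A"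
  then obtain A where A: "posdef_mat A" "c = mat_lag (- A)" "d = mat_lag A" by blast
  obtain L :: "real^2^2" where L: "invertible L" "A = L ** transpose L" using posdef_factor[OF
      A(1)] .
  show "harmonic infty_lag c (mat_lag 0) d"
    unfolding harmonic_def A L(2)
    by (intro bexI[of _ "affine_sp L 0"])
      (simp_all add: affine_sp_Sp4 affine_sp_infty affine_sp_mat_lag L(1) matrix_neg_mult)
qed

lemma harmonic_normalize:
  assumes "harmonic a c b d"
  obtains g where "g \<in> Sp4" "act g a = infty_lag" "act g b = mat_lag 0"
proof -
  obtain h where h: "h \<in> Sp4" "a = act h infty_lag" "b = act h (mat_lag 0)"
    using assms unfolding harmonic_def by blast
  show ?thesis
    by (rule that[of "matrix_inv h"]) (simp_all only: h act_inv[OF h(1)] Sp4_inv)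
qed

lemma harmonic_unique:
  assumes "harmonic a c b d" "harmonic a c b d'" shows "d = d'"
proof -
  obtain g where g: "g \<in> Sp4" "act g a = infty_lag" "act g b = mat_lag 0"
    using assms(1) by (rule harmonic_normalize)
  have "harmonic infty_lag (act g c) (mat_lag 0) (act g d)" "harmonic infty_lag (act g c) (mat_lag
      0) (act g d')"
    using assms[THEN harmonic_act[OF g(1)]] by (simp_all only: g)
  hence "act g d = act g d'" by (auto simp: harmonic_infty_0)
  thus ?thesis using act_eq_iff[OF g(1)] by blast
qed

lemma harmonic_maximal:
  assumes "harmonic a c b d"
  shows "maximal_triple a c b" "maximal_triple a b d"
proof -
  obtain g where g: "g \<in> Sp4" "act g a = infty_lag" "act g b = mat_lag 0"
    using assms(1) by (rule harmonic_normalize)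
  have "harmonic infty_lag (act g c) (mat_lag 0) (act g d)"
    using assms[THEN harmonic_act[OF g(1)]] by (simp only: g)
  then obtain A where A: "posdef_mat A" "act g c = mat_lag (- A)" "act g d = mat_lag A"
    by (auto simp: harmonic_infty_0)
  have "sym_mat (- A)" using posdef_sym[OF A(1)] by (simp add: sym_mat_2)
  hence "maximal_triple (act g a) (act g c) (act g b)" "maximal_triple (act g a) (act g b) (act g
      d)"
    using A(1) by (simp_all only: g A(2,3)) (simp_all add: maximal_triple_infty)
  thus "maximal_triple a c b" "maximal_triple a b d"
    using maximal_triple_act_iff[OF g(1)] by blast+
qed

lemma harmonic_exists_4:
  assumes "maximal_triple a c b" obtains d where "harmonic a c b d"
proof -
  obtain h where h: "h \<in> Sp4" "a = act h infty_lag" "c = act h (mat_lag 0)" "b = act h (mat_lag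
      (mat 1))"
    using assms unfolding maximal_triple_iff by blast
  \<comment> \<open>Translation by Id carries (infinity, -Id, 0) to the standard triple (infinity,
    0, Id).\<close>
  let ?t = "affine_sp (mat 1) (mat 1)"
  have inv: "invertible (mat 1 :: real^2^2)" by (simp add: invertible_det_nz)
  have "act ?t infty_lag = infty_lag" "act ?t (mat_lag (- mat 1)) = mat_lag 0" "act ?t (mat_lag 0)
      = mat_lag (mat 1)"
    by (simp_all add: affine_sp_infty affine_sp_mat_lag inv)
  moreover have "?t \<in> Sp4" by (simp add: affine_sp_Sp4 inv)
  ultimately have "harmonic a c b (act (h ** ?t) (mat_lag (mat 1)))"
    unfolding harmonic_def
    by (intro bexI[of _ "h ** ?t"]) (simp_all add: Sp4_mult h flip: act_act)
  thus ?thesis by (rule that)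
qed

lemma harmonic_exists_2:
  assumes "maximal_triple a b d" obtains c where "harmonic a c b d"
  using assms by (meson harmonic_cyc harmonic_exists_4 maximal_triple_cyc)

lemma harmonic_unique_2:
  "harmonic a c b d \<Longrightarrow> harmonic a c' b d \<Longrightarrow> c = c'"
  by (meson harmonic_cyc harmonic_unique)

text \<open>With \<open>a\<close> at infinity and \<open>b\<close> at 0 the partner of a matrix is
  its negative, and negation reverses the order of symmetric matrices. This is how the reflection in
  a tube is used to locate points.\<close>

lemma harmonic_reverse:
  assumes "harmonic a c b d" "harmonic a c' b d'" "maximal_triple a d d'"
  shows "maximal_triple a c' c"
proof -
  obtain g where g: "g \<in> Sp4" "act g a = infty_lag" "act g b = mat_lag 0"
    using assms(1) by (rule harmonic_normalize)
  have "harmonic infty_lag (act g c) (mat_lag 0) (act g d)" "harmonic infty_lag (act g c')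
      (mat_lag 0) (act g d')"
    using assms(1,2)[THEN harmonic_act[OF g(1)]] by (simp_all only: g)
  then obtain A A' where A: "posdef_mat A" "act g c = mat_lag (- A)" "act g d = mat_lag A"
     "posdef_mat A'" "act g c' = mat_lag (- A')" "act g d' = mat_lag A'"
    by (auto simp: harmonic_infty_0)
  have "maximal_triple infty_lag (mat_lag A) (mat_lag A')"
    using maximal_triple_act[OF g(1) assms(3)] by (simp only: g A)
  hence "posdef_mat (A' - A)" using A by (simp add: maximal_triple_infty posdef_sym)
  moreover have "sym_mat (- A')" using posdef_sym[OF A(4)] by (simp add: sym_mat_2)
  ultimately have "maximal_triple (act g a) (act g c') (act g c)"
    by (simp only: g A) (simp add: maximal_triple_infty)
  thus ?thesis using maximal_triple_act_iff[OF g(1)] by blast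
qed

text \<open>After diagonalisation this is a planar fact: inversion in the circle of radius x around
  0 fixes x and -x and exchanges 1 with x^2.\<close>

lemma harmonic_square:
  assumes "posdef_mat G" "posdef_mat (G - mat 1)"
  shows "harmonic (mat_lag (- G)) (mat_lag (mat 1)) (mat_lag G) (mat_lag (G ** G))"
proof -
  obtain p q t where *: "p > 0" "q > 0" "G = rot t ** diag2 p q ** transpose (rot t)"
    using posdef_diagonalize[OF assms(1)] .
  have "G - mat 1 = rot t ** diag2 (p - 1) (q - 1) ** transpose (rot t)"
    unfolding * by (simp add: matrix_mult_diff diag2_one flip: diag2_diff) (simp flip: diag2_one)
  hence "p > 1" "q > 1" using assms(2) by (simp_all add: posdef_orth_conj)
  \<comment> \<open>The scaling that gives the matrix with entries a, b, c, d determinant 1; the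
    radicand is positive for x > 1.\<close>
  define s where "s x = 1 / sqrt (2 * x * (x\<^sup>2 - 1))" for x :: real
  have s: "s x > 0" "(s x)\<^sup>2 * (2 * x * (x\<^sup>2 - 1)) = 1" if "x > 1" for x
  proof -
    have "x\<^sup>2 > 1" using that by (simp add: one_less_power)
    hence "2 * x * (x\<^sup>2 - 1) > 0" using that by simp
    thus "s x > 0" "(s x)\<^sup>2 * (2 * x * (x\<^sup>2 - 1)) = 1"
      unfolding s_def power_divide by (simp, metis less_imp_le less_irrefl nonzero_divide_eq_eq
          power_one real_sqrt_pow2)
  qed
  \<comment> \<open>The entries solve the conditions (infinity, -1, 0, 1) -> (-x, 1, x, x^2) for a
    fractional linear map.\<close>
  define a b c d where abcd: "a x = x * (x - 1) * s x" "b x = x * (x + 1) * s x"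
    "c x = - (x - 1) * s x" "d x = (x + 1) * s x" for x
  have det: "a x * d x - b x * c x = 1" if "x > 1" for x
  proof -
    have "a x * d x - b x * c x = (s x)\<^sup>2 * (2 * x * (x\<^sup>2 - 1))"
      by (simp add: abcd power2_eq_square algebra_simps)
    thus ?thesis using s[OF that] by simp
  qed
  have v: "a x / c x = - x" "(b x - a x) / (d x - c x) = 1" "b x / d x = x" "(a x + b x) / (c x +
      d x) = x * x"
    "c x \<noteq> 0" "d x \<noteq> 0" "d x - c x \<noteq> 0" "c x + d x \<noteq> 0"
    if "x > 1" for x
  proof -
    have e: "d x - c x = 2 * x * s x" "b x - a x = 2 * x * s x" "a x + b x = 2 * (x * x) * s x"
      "c x + d x = 2 * s x" "a x = - x * c x" "b x = x * d x"
      by (simp_all add: abcd algebra_simps)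
    show nz: "c x \<noteq> 0" "d x \<noteq> 0" "d x - c x \<noteq> 0" "c x + d x \<noteq> 0"
      unfolding e using s(1)[OF that] that by (simp_all add: abcd)
    show "(b x - a x) / (d x - c x) = 1" "(a x + b x) / (c x + d x) = x * x"
      unfolding e(1-4) using s(1)[OF that] that by simp_all
    show "a x / c x = - x" "b x / d x = x"
      unfolding e(5,6) using nz by simp_all
  qed
  note vp = v[OF \<open>p > 1\<close>] and vq = v[OF \<open>q > 1\<close>]
  let ?g = "diag_sp (a p) (b p) (c p) (d p) (a q) (b q) (c q) (d q)"
  have g: "?g \<in> Sp4" by (intro diag_sp_Sp4 det \<open>p > 1\<close> \<open>q > 1\<close>)
  have "act ?g infty_lag = mat_lag (- diag2 p q)"
    using vp vq by (simp add: diag_sp_infty diag2_uminus)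
  moreover have "act ?g (mat_lag (- mat 1)) = mat_lag (mat 1)"
    using vp vq by (simp add: diag2_uminus diag2_one diag_sp_mat_lag)
  moreover have "act ?g (mat_lag 0) = mat_lag (diag2 p q)"
    using vp vq by (simp add: diag2_zero diag_sp_mat_lag)
  moreover have "act ?g (mat_lag (mat 1)) = mat_lag (diag2 (p * p) (q * q))"
    using vp vq by (simp add: diag2_one diag_sp_mat_lag)
  ultimately have "harmonic (mat_lag (- diag2 p q)) (mat_lag (mat 1)) (mat_lag (diag2 p q))
      (mat_lag (diag2 (p * p) (q * q)))"
    unfolding harmonic_def using g by metis
  hence "harmonic (act (affine_sp (rot t) 0) (mat_lag (- diag2 p q))) (act (affine_sp (rot t) 0)
      (mat_lag (mat 1)))
     (act (affine_sp (rot t) 0) (mat_lag (diag2 p q))) (act (affine_sp (rot t) 0) (mat_lag (diag2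
         (p * p) (q * q))))"
    by (rule harmonic_act[rotated]) (simp add: affine_sp_Sp4 rot_invertible)
  moreover have "rot t ** diag2 (p * p) (q * q) ** transpose (rot t) = G ** G"
  proof -
    have "G ** G = rot t ** (diag2 p q ** (transpose (rot t) ** rot t) ** diag2 p q) ** transpose
        (rot t)"
      unfolding * by (simp add: matrix_mul_assoc del: rot_orthogonal)
    thus ?thesis by (simp add: diag2_mult)
  qed
  ultimately show ?thesis
    by (simp add: affine_sp_mat_lag rot_invertible matrix_neg_mult flip: *(3))
qed

text \<open>Only the inequality has to be extracted: seen from -G, the points Id, G and infinity
  follow in this order, and turning cyclically puts infinity first. Uniqueness of the fourth point
  then gives Y.\<close>

lemma harmonic_one_iff:
  assumes "posdef_mat G"
  shows "harmonic (mat_lag (- G)) (mat_lag (mat 1)) (mat_lag G) (mat_lag Y) \<longleftrightarrow>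
    posdef_mat (G - mat 1) \<and> Y = G ** G"
proof
  assume h: "harmonic (mat_lag (- G)) (mat_lag (mat 1)) (mat_lag G) (mat_lag Y)"
  have "posdef_mat (G - - G)" using posdef_add[OF assms assms] by simp
  moreover have "sym_mat (- G)" using posdef_sym[OF assms] by (simp add: sym_mat_2)
  ultimately have "maximal_triple infty_lag (mat_lag (- G)) (mat_lag G)" by (simp add:
      maximal_triple_infty)
  hence "maximal_triple (mat_lag (- G)) (mat_lag G) infty_lag" by (rule maximal_triple_cyc)
  hence "maximal_triple (mat_lag (mat 1)) (mat_lag G) infty_lag"
    using harmonic_maximal(1)[OF h] maximal_triple_trans(2) by blast
  hence "maximal_triple infty_lag (mat_lag (mat 1)) (mat_lag G)" by (meson maximal_triple_cyc)
  hence "posdef_mat (G - mat 1)" by (simp add: maximal_triple_infty)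
  thus "posdef_mat (G - mat 1) \<and> Y = G ** G"
    using harmonic_unique[OF h harmonic_square] assms by simp
qed (simp add: assms harmonic_square)

text \<open>Move (a, b, x) to (infinity, 0, Id) and y to Y. Orthogonality to the first tube says
  that the new ends are -G and G with G positive definite; orthogonality to the second says that G^2
  = Y.\<close>

lemma common_perpendicular:
  assumes "maximal_triple a b x" "maximal_triple a x y"
  shows "\<exists>!(q, q'). harmonic a q b q' \<and> harmonic q x q' y"
proof -
  obtain g where g: "g \<in> Sp4" "act g a = infty_lag" "act g b = mat_lag 0" "act g x = mat_lag (mat
      1)"
    using assms(1) by (rule maximal_triple_normalize)
  have "maximal_triple infty_lag (mat_lag (mat 1)) (act g y)"
    using maximal_triple_act[OF g(1) assms(2)] by (simp only: g)
  then obtain Y where Y: "posdef_mat (Y - mat 1)" "act g y = mat_lag Y"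
    by (auto simp: maximal_triple_infty_iff)
  have "posdef_mat Y" using posdef_add[OF Y(1) posdef_one] by simp
  then obtain G where G: "posdef_mat G" "posdef_mat (G - mat 1)" "G ** G = Y"
    using posdef_sqrt_exists Y(1) by metis
  have iff: "harmonic a q b q' \<and> harmonic q x q' y \<longleftrightarrow> act g q = mat_lag (- G) \<and> act g q' = mat_lag
      G" for q q'
  proof -
    have 1: "harmonic a q b q' \<longleftrightarrow> harmonic infty_lag (act g q) (mat_lag 0) (act g q')"
      using harmonic_act_iff[OF g(1), of a q b q'] by (simp only: g)
    have 2: "harmonic q x q' y \<longleftrightarrow> harmonic (act g q) (mat_lag (mat 1)) (act g q') (mat_lag Y)"
      using harmonic_act_iff[OF g(1), of q x q' y] by (simp only: g Y)
    show ?thesis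
    proof
      assume "harmonic a q b q' \<and> harmonic q x q' y"
      then obtain A where A: "posdef_mat A" "act g q = mat_lag (- A)" "act g q' = mat_lag A"
        "harmonic (mat_lag (- A)) (mat_lag (mat 1)) (mat_lag A) (mat_lag Y)"
        unfolding 1 2 harmonic_infty_0 by metis
      have "A ** A = G ** G" using A(4) G(3) by (simp add: harmonic_one_iff[OF A(1)])
      hence "A = G" by (rule posdef_sqrt_unique[OF A(1) G(1)])
      thus "act g q = mat_lag (- G) \<and> act g q' = mat_lag G" using A by blast
    next
      assume *: "act g q = mat_lag (- G) \<and> act g q' = mat_lag G"
      have "harmonic (mat_lag (- G)) (mat_lag (mat 1)) (mat_lag G) (mat_lag Y)"
        by (simp add: harmonic_one_iff G)
      moreover have "harmonic infty_lag (mat_lag (- G)) (mat_lag 0) (mat_lag G)"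
        unfolding harmonic_infty_0 using G(1) by blast
      ultimately show "harmonic a q b q' \<and> harmonic q x q' y"
        unfolding 1 2 using * by simp
    qed
  qed
  show ?thesis
  proof (rule ex1I[of _ "(act (matrix_inv g) (mat_lag (- G)), act (matrix_inv g) (mat_lag G))"])
    show "case (act (matrix_inv g) (mat_lag (- G)), act (matrix_inv g) (mat_lag G)) of
      (q, q') \<Rightarrow> harmonic a q b q' \<and> harmonic q x q' y"
      unfolding prod.case iff by (simp only: act_inv[OF g(1)])
  next
    fix r :: "lag \<times> lag" assume "case r of (q, q') \<Rightarrow> harmonic a q b q' \<and> harmonic q x q' y"
    then obtain q q' where r: "r = (q, q')" "act g q = mat_lag (- G)" "act g q' = mat_lag G"
      using iff by (cases r) auto
    show "r = (act (matrix_inv g) (mat_lag (- G)), act (matrix_inv g) (mat_lag G))"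
      unfolding r(2,3)[symmetric] r(1) act_inv[OF g(1)] ..
  qed
qed

section \<open>Harmonic hexagons\<close>

text \<open>A change of base point: positions found relative to other ends are brought into the
  order seen from a fixed \<open>o'\<close>.\<close>

lemma maximal_triple_between:
  assumes "maximal_triple o' x z" "maximal_triple x y z"
  shows "maximal_triple o' x y" "maximal_triple o' y z"
  using assms maximal_triple_cyc maximal_triple_trans by meson+

lemma transp_maximal_triple: "transp (maximal_triple a)"
proof (rule transpI)
  fix x y z assume "maximal_triple a x y" "maximal_triple a y z"
  thus "maximal_triple a x z" by (rule maximal_triple_trans(1))
qed

text \<open>Turns a condition on all triples into a linear chain seen from the first member. Triples
  that avoid this member come from the second part of \<open>maximal_triple_trans\<close>.\<close>

lemma maximal_tuple_Cons: "maximal_tuple (x # xs) \<longleftrightarrow> sorted_wrt (maximal_triple x) xs"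
proof
  assume *: "maximal_tuple (x # xs)"
  show "sorted_wrt (maximal_triple x) xs"
    unfolding sorted_wrt_iff_nth_less
  proof (intro allI impI)
    fix i j assume "i < j" "j < length xs"
    thus "maximal_triple x (xs ! i) (xs ! j)"
      using *[unfolded maximal_tuple_def, rule_format, of 0 "Suc i" "Suc j"] by simp
  qed
next
  assume *: "sorted_wrt (maximal_triple x) xs"
  hence M: "maximal_triple x (xs ! i) (xs ! j)" if "i < j" "j < length xs" for i j
    using that by (simp add: sorted_wrt_iff_nth_less)
  show "maximal_tuple (x # xs)"
    unfolding maximal_tuple_def
  proof (intro allI impI, elim conjE)
    fix i j k assume ijk: "i < j" "j < k" "k < length (x # xs)"
    then obtain j' k' where jk: "j = Suc j'" "k = Suc k'" "j' < k'" "k' < length xs"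
      by (cases j; cases k) auto
    show "maximal_triple ((x # xs) ! i) ((x # xs) ! j) ((x # xs) ! k)"
    proof (cases i)
      case 0 thus ?thesis using M jk by simp
    next
      case (Suc i')
      thus ?thesis
        using jk ijk maximal_triple_trans(2)[of x "xs ! i'" "xs ! j'" "xs ! k'"] M by simp
    qed
  qed
qed

text \<open>The hexagon condition without tubes: only the relative positions of the twelve ends
  remain.\<close>

definition harmonic_hexagon :: "(nat \<Rightarrow> lag) \<Rightarrow> (nat \<Rightarrow> lag) \<Rightarrow> bool" where
  "harmonic_hexagon P Q \<longleftrightarrow>
    maximal_tuple [P 1, Q 6, Q 1, P 2, P 3, Q 2, Q 3, P 4, P 5, Q 4, Q 5, P 6] \<and>
    harmonic (P 1) (Q 1) (P 2) (Q 2) \<and> harmonic (Q 1) (P 3) (Q 2) (P 4) \<and>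
    harmonic (P 3) (Q 3) (P 4) (Q 4) \<and> harmonic (Q 3) (P 5) (Q 4) (P 6) \<and>
    harmonic (P 5) (Q 5) (P 6) (Q 6) \<and> harmonic (Q 5) (P 1) (Q 6) (P 2)"

text \<open>All orders below are read off from the base point \<open>p1\<close>; the positions of the new
  points relative to the old ones come from the order-reversing reflections in the sides.\<close>

lemma harmonic_hexagon_exists_aux:
  assumes "maximal_tuple [p1, p2, q2, p4, p5, q5]"
  obtains p3 p6 q1 q3 q4 q6 where
    "maximal_tuple [p1, q6, q1, p2, p3, q2, q3, p4, p5, q4, q5, p6]"
    "harmonic p1 q1 p2 q2" "harmonic q1 p3 q2 p4" "harmonic p3 q3 p4 q4"
    "harmonic q3 p5 q4 p6" "harmonic p5 q5 p6 q6" "harmonic q5 p1 q6 p2"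
proof -
  let ?L = "maximal_triple p1"
  note cyc = maximal_triple_cyc
  have tr: "?L x z" if "?L x y" "?L y z" for x y z using that by (rule maximal_triple_trans(1))
  have three: "maximal_triple x y z" if "?L x y" "?L y z" for x y z
    using that by (rule maximal_triple_trans(2))
  have L: "?L p2 q2" "?L q2 p4" "?L p4 p5" "?L p5 q5"
    using assms by (auto simp: maximal_tuple_Cons)
  \<comment> \<open>One reflection, in the tube with ends p1 and p2, produces q1 from q2 and q6 from
    q5. Since q2 precedes q5, its reversal of order puts q6 before q1.\<close>
  obtain q1 where q1: "harmonic p1 q1 p2 q2" using L(1) by (rule harmonic_exists_2)
  have "?L p2 q5" using L tr by blast
  then obtain q6 where q6: "harmonic p1 q6 p2 q5" by (rule harmonic_exists_2)
  have L2: "?L q1 p2" "?L q6 p2" using harmonic_maximal q1 q6 by blast+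
  have "?L q2 q5" using L tr by blast
  with q1 q6 have L3: "?L q6 q1" by (rule harmonic_reverse)
  have q6': "harmonic q5 p1 q6 p2" using harmonic_cyc[OF harmonic_cyc[OF harmonic_cyc[OF q6]]] .
  have "?L q1 q2" using L(1) L2(1) tr by blast
  hence "maximal_triple q1 q2 p4" using L(2) by (rule three)
  then obtain p3 where p3: "harmonic q1 p3 q2 p4" by (rule harmonic_exists_2)
  have L4: "?L q1 p3" "?L p3 q2"
    using maximal_triple_between[OF \<open>?L q1 q2\<close> harmonic_maximal(1)[OF p3]] .
  have "?L q1 p4" using \<open>?L q1 q2\<close> L tr by blast
  hence "maximal_triple q1 p4 p1" by (rule cyc)
  with p3 harmonic_cyc[OF q1] have "maximal_triple q1 p2 p3" by (rule harmonic_reverse)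
  with L4(1) have L5: "?L p2 p3" using maximal_triple_between(2) by blast
  have "?L q6 p5" using L L2 tr by blast
  hence "maximal_triple q6 p5 q5" using L(4) by (rule three)
  hence "maximal_triple q5 q6 p5" by (rule cyc[OF cyc])
  then obtain p6 where p6: "harmonic q5 p6 q6 p5" by (rule harmonic_exists_2)
  have p6': "harmonic p5 q5 p6 q6" using harmonic_cyc[OF harmonic_cyc[OF harmonic_cyc[OF p6]]] .
  have "?L p2 p5" using L tr by blast
  hence "maximal_triple q5 p2 p5" using three[OF _ L(4)] cyc by blast
  with q6' p6 have "maximal_triple q5 p6 p1" by (rule harmonic_reverse)
  hence L6: "?L q5 p6" using cyc by blast
  have "?L p3 p4" using L4 L tr by blast
  have "?L p5 p6" using L L6 tr by blast
  have "maximal_triple p3 p4 p5" using three[OF \<open>?L p3 p4\<close> L(3)] .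
  moreover have "maximal_triple p3 p5 p6" using three[OF tr[OF \<open>?L p3 p4\<close> L(3)] \<open>?L p5 p6\<close>] .
  \<comment> \<open>The fourth side has no prescribed end: it is the common perpendicular of the
    third and the fifth.\<close>
  ultimately obtain q3 q4 where q34: "harmonic p3 q3 p4 q4" "harmonic q3 p5 q4 p6"
    using common_perpendicular by blast
  have L7: "?L p3 q3" "?L q3 p4"
    using maximal_triple_between[OF \<open>?L p3 p4\<close> harmonic_maximal(1)[OF q34(1)]] .
  have q4: "harmonic p5 q4 p6 q3" using harmonic_cyc[OF q34(2)] .
  have L8: "?L p5 q4" "?L q4 p6"
    using maximal_triple_between[OF \<open>?L p5 p6\<close> harmonic_maximal(1)[OF q4]] .
  have "?L p3 q4" using \<open>?L p3 p4\<close> L(3) L8(1) tr by blast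
  hence "maximal_triple p3 q4 q1" using three[OF L4(1)] cyc by blast
  with q34(1) harmonic_cyc[OF p3] have "maximal_triple p3 q2 q3" by (rule harmonic_reverse)
  with L7(1) have L9: "?L q2 q3" using maximal_triple_between(2) by blast
  have "?L q6 q3" using L3 L4 L7 tr by blast
  moreover have "?L q3 p5" using L7 L tr by blast
  ultimately have "maximal_triple p5 q6 q3" using cyc[OF cyc[OF three]] by blast
  with p6' q4 have "maximal_triple p5 q4 q5" by (rule harmonic_reverse)
  with L(4) have L10: "?L q4 q5" using maximal_triple_between(2) by blast
  have "maximal_tuple [p1, q6, q1, p2, p3, q2, q3, p4, p5, q4, q5, p6]"
    unfolding maximal_tuple_Cons
    by (simp only: sorted_wrt2[OF transp_maximal_triple] sorted_wrt1 L L2 L3 L4 L5 L6 L7 L8 L9 L10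
        simp_thms)
  thus ?thesis using that q1 p3 q34 p6' q6' by blast
qed

lemma harmonic_hexagon_exists:
  assumes "maximal_tuple [p1, p2, q2, p4, p5, q5]"
  obtains P Q where "harmonic_hexagon P Q"
    "(P 2, Q 2, P 4, P 5, Q 5, P 1) = (p2, q2, p4, p5, q5, p1)"
proof -
  obtain p3 p6 q1 q3 q4 q6 where *:
    "maximal_tuple [p1, q6, q1, p2, p3, q2, q3, p4, p5, q4, q5, p6]"
    "harmonic p1 q1 p2 q2" "harmonic q1 p3 q2 p4" "harmonic p3 q3 p4 q4"
    "harmonic q3 p5 q4 p6" "harmonic p5 q5 p6 q6" "harmonic q5 p1 q6 p2"
    using harmonic_hexagon_exists_aux[OF assms] .
  \<comment> \<open>Ends are numbered from 1; the entry at position 0 is filler.\<close>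
  define P Q where "P i = [p1, p1, p2, p3, p4, p5, p6] ! i" and "Q i = [q1, q1, q2, q3, q4, q5,
      q6] ! i" for i
  have "P 1 = p1" "P 2 = p2" "P 3 = p3" "P 4 = p4" "P 5 = p5" "P 6 = p6"
    "Q 1 = q1" "Q 2 = q2" "Q 3 = q3" "Q 4 = q4" "Q 5 = q5" "Q 6 = q6"
    by (simp_all add: P_def Q_def)
  thus ?thesis using that[of P Q] * by (simp add: harmonic_hexagon_def del: One_nat_def)
qed

lemma ball_1_6: "(\<forall>i\<in>{1..6::nat}. R i) \<longleftrightarrow> R 1 \<and> R 2 \<and> R 3 \<and> R 4 \<and> R 5 \<and> R 6"
proof -
  have "{1..6::nat} = {1, 2, 3, 4, 5, 6}" by auto
  thus ?thesis by simp
qed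

text \<open>Labellings are total functions on the naturals, so equality of functions would be too
  strong.\<close>

definition same_ends :: "(nat \<Rightarrow> lag) \<Rightarrow> (nat \<Rightarrow> lag) \<Rightarrow> (nat \<Rightarrow> lag) \<Rightarrow> (nat \<Rightarrow> lag) \<Rightarrow> bool" where
  "same_ends P Q P' Q' \<longleftrightarrow> (\<forall>i\<in>{1..6}. P i = P' i \<and> Q i = Q' i)"

text \<open>The missing ends are forced one after another: Q 1 and Q 6 by reflection in the first
  side, P 3 and P 6 by reflection in its neighbours, Q 3 and Q 4 as ends of a common
  perpendicular.\<close>

lemma harmonic_hexagon_unique:
  assumes "harmonic_hexagon P Q" "harmonic_hexagon P' Q'"
    "(P 2, Q 2, P 4, P 5, Q 5, P 1) = (P' 2, Q' 2, P' 4, P' 5, Q' 5, P' 1)"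
  shows "same_ends P Q P' Q'"
proof -
  note h = assms(1)[unfolded harmonic_hexagon_def] and h' = assms(2)[unfolded harmonic_hexagon_def]
  have e: "P' 2 = P 2" "Q' 2 = Q 2" "P' 4 = P 4" "P' 5 = P 5" "Q' 5 = Q 5" "P' 1 = P 1"
    using assms(3) by simp_all
  note h' = h'[unfolded e]
  have q1: "Q' 1 = Q 1" using h h' harmonic_unique_2 by blast
  note h' = h'[unfolded q1]
  have p3: "P' 3 = P 3" using h h' harmonic_unique_2 by blast
  note h' = h'[unfolded p3]
  have q6: "Q' 6 = Q 6" using h h' harmonic_cyc harmonic_unique_2 by meson
  note h' = h'[unfolded q6]
  have p6: "P' 6 = P 6" using h h' harmonic_cyc harmonic_unique_2 by meson
  note h' = h'[unfolded p6]
  have m: "maximal_triple (P 3) (P 4) (P 5)" "maximal_triple (P 3) (P 5) (P 6)"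
    using h unfolding maximal_tuple_Cons by (auto intro: maximal_triple_trans(2))
  have "Q' 3 = Q 3 \<and> Q' 4 = Q 4"
    using common_perpendicular[OF m] h h' by blast
  thus ?thesis using e q1 p3 q6 p6 by (simp add: same_ends_def ball_1_6 del: One_nat_def)
qed

text \<open>Exchanging P 1 and P 2 would force the exchange of Q 1 with Q 2 and of Q 6 with Q 5.
  Seen from P 2, the end Q 5 would then come before Q 2, contrary to the given order.\<close>

lemma maximal_tuple_doubleton_unique:
  assumes "maximal_tuple [P 1, Q 6, Q 1, P 2, P 3, Q 2, Q 3, P 4, P 5, Q 4, Q 5, P 6]"
    and "maximal_tuple [P' 1, Q' 6, Q' 1, P' 2, P' 3, Q' 2, Q' 3, P' 4, P' 5, Q' 4, Q' 5, P' 6]"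
    and "{P 1, P 2} = {P' 1, P' 2}" "{Q 1, Q 2} = {Q' 1, Q' 2}" "{P 3, P 4} = {P' 3, P' 4}"
      "{Q 3, Q 4} = {Q' 3, Q' 4}" "{P 5, P 6} = {P' 5, P' 6}" "{Q 5, Q 6} = {Q' 5, Q' 6}"
  shows "same_ends P Q P' Q'"
proof -
  let ?M = maximal_triple
  note as = maximal_triple_antisym and cyc = maximal_triple_cyc
  note m = assms(1)[unfolded maximal_tuple_Cons, simplified]
    and m' = assms(2)[unfolded maximal_tuple_Cons, simplified]
  have P1: "P' 1 = P 1"
  proof (rule ccontr)
    assume "P' 1 \<noteq> P 1"
    hence e: "P' 1 = P 2" "P' 2 = P 1" using assms(3) by (auto simp: doubleton_eq_iff)
    have "Q' 1 \<noteq> Q 1"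
    proof
      assume "Q' 1 = Q 1"
      hence "?M (P 2) (Q 1) (P 1)" using m' e by simp
      moreover have "?M (P 1) (Q 1) (P 2)" using m by simp
      ultimately show False using as cyc by blast
    qed
    hence q: "Q' 1 = Q 2" using assms(4) by (auto simp: doubleton_eq_iff)
    have "Q' 6 \<noteq> Q 6"
    proof
      assume "Q' 6 = Q 6"
      hence "?M (P 2) (Q 6) (P 1)" using m' e by simp
      moreover have "?M (P 1) (Q 6) (P 2)" using m by simp
      ultimately show False using as cyc by blast
    qed
    hence "Q' 6 = Q 5" using assms(8) by (auto simp: doubleton_eq_iff)
    hence "?M (P 2) (Q 5) (Q 2)" using m' e q by simp
    moreover have "?M (P 2) (Q 2) (Q 5)"
      by (rule maximal_triple_trans(2)[of "P 1"]) (use m in simp_all)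
    ultimately show False using as by blast
  qed
  have P2: "P' 2 = P 2" using assms(3) P1 by (auto simp: doubleton_eq_iff)
  \<comment> \<open>Seen from P 1, the point z separates the two ends of a pair, so it tells which
    is which. Each use takes for z an end that is already identified.\<close>
  have pick: "x' = x \<and> y' = y"
    if "?M (P 1) x z" "?M (P 1) z y" "?M (P 1) x' z" "{x, y} = {x', y'}" for x y z x' y'
    using that as by (auto simp: doubleton_eq_iff)
  have Q12: "Q' 1 = Q 1 \<and> Q' 2 = Q 2"
    by (rule pick[of _ "P 2"]) (use m m' assms(4) P1 P2 in simp_all)
  have Q56: "Q' 6 = Q 6 \<and> Q' 5 = Q 5"
    by (rule pick[of _ "P 2"]) (use m m' assms(8)[unfolded insert_commute[of "Q 5"]
        insert_commute[of "Q' 5"]] P1 P2 in simp_all)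
  have P34: "P' 3 = P 3 \<and> P' 4 = P 4"
    by (rule pick[of _ "Q 2"]) (use m m' assms(5) P1 Q12 in simp_all)
  have P56: "P' 5 = P 5 \<and> P' 6 = P 6"
    by (rule pick[of _ "Q 5"]) (use m m' assms(7) P1 Q56 in simp_all)
  have Q34: "Q' 3 = Q 3 \<and> Q' 4 = Q 4"
    by (rule pick[of _ "P 4"]) (use m m' assms(6) P1 P34 in simp_all)
  show ?thesis
    using P1 P2 Q12 Q56 P34 P56 Q34 by (simp add: same_ends_def ball_1_6 del: One_nat_def)
qed

section \<open>Complexification and the action on Siegel space\<close>

abbreviation cmat :: "real^'n^'m \<Rightarrow> complex^'n^'m" where
  "cmat \<equiv> map_matrix complex_of_real"

definition cvec :: "real^'n \<Rightarrow> complex^'n" where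
  "cvec v = (\<chi> i. complex_of_real (v $ i))"

definition cnjv :: "complex^'n \<Rightarrow> complex^'n" where
  "cnjv v = (\<chi> i. cnj (v $ i))"

abbreviation cnjm :: "complex^'n^'m \<Rightarrow> complex^'n^'m" where
  "cnjm \<equiv> map_matrix cnj"

lemma cvec_nth [simp]: "cvec v $ i = complex_of_real (v $ i)" by (simp add: cvec_def)

lemma cnjv_nth [simp]: "cnjv v $ i = cnj (v $ i)" by (simp add: cnjv_def)

lemma cvec_add: "cvec (v + w) = cvec v + cvec w"
  and cvec_0 [simp]: "cvec 0 = 0"
  by (simp_all add: vec_eq_iff)

lemma cnjv_diff: "cnjv (v - w) = cnjv v - cnjv w"
  and cnjv_cnjv [simp]: "cnjv (cnjv v) = v"
  by (simp_all add: vec_eq_iff)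

lemma cvec_cases: obtains a b where "v = cvec a + \<i> *s cvec b"
proof
  show "v = cvec (\<chi> i. Re (v $ i)) + \<i> *s cvec (\<chi> i. Im (v $ i))"
    by (simp add: vec_eq_iff complex_eq)
qed

lemma cmat_mult_cvec: "cmat g *v cvec v = cvec (g *v v)"
  by (simp add: vec_eq_iff matrix_vector_mult_def)

lemma cmat_mult_cnjv: "cmat g *v cnjv v = cnjv (cmat g *v v)"
  by (simp add: vec_eq_iff matrix_vector_mult_def)

lemma cnjm_mult_cnjv: "cnjm Z *v cnjv v = cnjv (Z *v v)"
  by (simp add: vec_eq_iff matrix_vector_mult_def)

lemma matrix_vector_mult_scale: "M *v (c *s v) = c *s (M *v v)" for M :: "'a::comm_ring_1^'n^'m"
  by (simp add: vec_eq_iff matrix_vector_mult_def sum_distrib_left algebra_simps)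

lemma cmat_mult: "cmat (g ** h) = cmat g ** cmat h"
  by (simp add: vec_eq_iff matrix_matrix_mult_def)

lemma cmat_1 [simp]: "cmat (mat 1) = mat 1"
  by (simp add: vec_eq_iff mat_def)

lemma cmat_block: "cmat (block_matrix A B C D) = block_matrix (cmat A) (cmat B) (cmat C) (cmat D)"
  by (intro vec_sum_eqI) simp_all

lemma cmat_cmul: "cmat (matrix_inv g) *v (cmat g *v v) = v" "cmat g *v (cmat (matrix_inv g) *v v)
    = v"
  if "invertible g" for g :: "real^'n^'n"
  using invertible_matrix_inv[OF that]
  by (simp_all add: matrix_vector_mul_assoc flip: cmat_mult)

lemma symp_bilinear:
  "symp (v + w) u = symp v u + symp w u" "symp u (v + w) = symp u v + symp u w"
  "symp (c *s v) u = c * symp v u" "symp u (c *s v) = c * symp u v"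
  by (simp_all add: symp_def sum.distrib sum_distrib_left algebra_simps)

lemma symp_cvec: "symp (cvec v) (cvec w) = complex_of_real (symp v w)"
  by (simp add: symp_def)

lemma symp_cmat:
  assumes "g \<in> Sp4" shows "symp (cmat g *v v) (cmat g *v w) = symp v w"
proof -
  obtain a b where v: "v = cvec a + \<i> *s cvec b" by (rule cvec_cases)
  obtain c d where w: "w = cvec c + \<i> *s cvec d" by (rule cvec_cases)
  show ?thesis
    using assms unfolding v w
    by (simp add: matrix_vector_right_distrib matrix_vector_mult_scale cmat_mult_cvec
        symp_bilinear symp_cvec Sp4_iff)
qed

text \<open>This is the Hermitian form \<open>(\<i> / 2) symp (cnj v) v\<close>.\<close>

definition hform :: "complex^(2 + 2) \<Rightarrow> real" where
  "hform v = Im (\<Sum>k\<in>UNIV. v $ Inl k * cnj (v $ Inr k))"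

lemma hform_pv: "hform (pv x y) = Im (x $ 1 * cnj (y $ 1) + x $ 2 * cnj (y $ 2))"
  by (simp add: hform_def sum_2)

lemma hform_cvec: "hform (cvec a + \<i> *s cvec b) = symp b a"
  by (simp add: hform_def symp_def algebra_simps flip: sum_subtractf)

lemma hform_cmat:
  assumes "g \<in> Sp4" shows "hform (cmat g *v v) = hform v"
proof -
  obtain a b where v: "v = cvec a + \<i> *s cvec b" by (rule cvec_cases)
  show ?thesis
    using assms unfolding v
    by (simp add: matrix_vector_right_distrib matrix_vector_mult_scale cmat_mult_cvec hform_cvec
        Sp4_iff)
qed

section \<open>Siegel space through invariant forms\<close>

lemma transpose_eq_nth: "transpose Z = Z \<Longrightarrow> Z $ i $ j = Z $ j $ i"
  by (metis transpose_nth)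

lemma siegel_sym_posdef:
  "Z \<in> siegel \<longleftrightarrow> transpose Z = Z \<and> posdef_mat (map_matrix Im Z)"
proof
  assume "Z \<in> siegel"
  then obtain X Y where *: "Z = complex_mat X Y" "sym_mat X" "posdef_mat Y" by (auto simp:
      siegel_def)
  have "map_matrix Im Z = Y" by (simp add: * complex_mat_def vec_eq_iff)
  moreover have "transpose Z = Z"
    using *(2) posdef_sym[OF *(3)] by (simp add: *(1) complex_mat_def mat2_eq sym_mat_2)
  ultimately show "transpose Z = Z \<and> posdef_mat (map_matrix Im Z)" using * by simp
next
  assume *: "transpose Z = Z \<and> posdef_mat (map_matrix Im Z)"
  have "Z $ 1 $ 2 = Z $ 2 $ 1" using * transpose_eq_nth by blast
  hence "sym_mat (map_matrix Re Z)" by (simp add: sym_mat_2)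
  moreover have "Z = complex_mat (map_matrix Re Z) (map_matrix Im Z)"
    by (simp add: complex_mat_def vec_eq_iff)
  ultimately show "Z \<in> siegel" using * unfolding siegel_def by blast
qed

text \<open>The mixed terms in a and b cancel because Z is symmetric, so positivity of the Hermitian
  form on the graph is positivity of Im Z.\<close>

lemma hform_graph:
  assumes "transpose Z = Z"
  shows "hform (pv (Z *v (cvec a + \<i> *s cvec b)) (cvec a + \<i> *s cvec b))
    = dotp a (map_matrix Im Z *v a) + dotp b (map_matrix Im Z *v b)"
proof -
  have "Z $ 2 $ 1 = Z $ 1 $ 2" using assms transpose_eq_nth by blast
  thus ?thesis
    by (simp add: hform_pv dotp_2 matrix_vector_mult_2 algebra_simps)
qed

text \<open>A description by invariant forms, isotropy of the graph for symmetry of Z and positivity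
  of \<open>hform\<close> for Im Z > 0. Stability of \<open>siegel\<close> under \<open>Sp4\<close>
  then needs no computation with quotients of matrices.\<close>

lemma siegel_iff:
  "Z \<in> siegel \<longleftrightarrow> (\<forall>v\<in>mat_lag Z. \<forall>w\<in>mat_lag Z. symp v w = 0) \<and>
     (\<forall>v\<in>mat_lag Z. v \<noteq> 0 \<longrightarrow> hform v > 0)"
proof -
  have 1: "(\<forall>v\<in>mat_lag Z. \<forall>w\<in>mat_lag Z. symp v w = 0) \<longleftrightarrow> transpose Z = Z"
  proof
    assume *: "\<forall>v\<in>mat_lag Z. \<forall>w\<in>mat_lag Z. symp v w = 0"
    have "dotp (Z *v p - transpose Z *v p) q = 0" for p q
    proof -
      have "symp (pv (Z *v p) p) (pv (Z *v q) q) = 0" by (rule *[rule_format]) simp_all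
      moreover have "dotp p (Z *v q) = dotp (transpose Z *v p) q"
        by (simp add: dotp_matrix)
      ultimately show ?thesis by (simp add: dotp_simps)
    qed
    hence "Z *v p - transpose Z *v p = 0" for p by (rule dotp_eq_0)
    hence "Z = transpose Z" by (intro matrix_eqI) simp
    thus "transpose Z = Z" by simp
  next
    assume "transpose Z = Z"
    hence "symp (pv (Z *v p) p) (pv (Z *v q) q) = 0" for p q
      by (simp add: dotp_matrix)
    thus "\<forall>v\<in>mat_lag Z. \<forall>w\<in>mat_lag Z. symp v w = 0" by (auto simp: mat_lag_range)
  qed
  have 2: "(\<forall>v\<in>mat_lag Z. v \<noteq> 0 \<longrightarrow> hform v > 0) \<longleftrightarrow> posdef_mat (map_matrix Im Z)" if t: "transpose Z
      = Z"
  proof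
    assume *: "\<forall>v\<in>mat_lag Z. v \<noteq> 0 \<longrightarrow> hform v > 0"
    have "dotp a (map_matrix Im Z *v a) > 0" if "a \<noteq> 0" for a
    proof -
      have "cvec a \<noteq> 0" using that by (auto simp: vec_eq_iff)
      hence "hform (pv (Z *v (cvec a + \<i> *s cvec 0)) (cvec a + \<i> *s cvec 0)) > 0"
        by (intro *[rule_format]) simp_all
      thus ?thesis unfolding hform_graph[OF t] by (simp add: dotp_simps)
    qed
    moreover have "sym_mat (map_matrix Im Z)" using transpose_eq_nth[OF t, of 1 2] by (simp add:
        sym_mat_2)
    ultimately show "posdef_mat (map_matrix Im Z)" by (simp add: posdef_dotp)
  next
    assume *: "posdef_mat (map_matrix Im Z)"
    show "\<forall>v\<in>mat_lag Z. v \<noteq> 0 \<longrightarrow> hform v > 0"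
    proof (intro ballI impI)
      fix v assume "v \<in> mat_lag Z" "v \<noteq> 0"
      from \<open>v \<in> mat_lag Z\<close> obtain q where q1: "v = pv (Z *v q) q" by (auto simp: mat_lag_range)
      with \<open>v \<noteq> 0\<close> have q: "v = pv (Z *v q) q" "q \<noteq> 0" by auto
      obtain a b where ab: "q = cvec a + \<i> *s cvec b" by (rule cvec_cases)
      have pos: "dotp u (map_matrix Im Z *v u) \<ge> 0" for u
        using * by (cases "u = 0") (auto simp: posdef_dotp dotp_simps intro: less_imp_le)
      have "a \<noteq> 0 \<or> b \<noteq> 0" using q(2) ab by auto
      thus "hform v > 0"
        unfolding q(1) ab hform_graph[OF t]
        using * pos[of a] pos[of b] by (auto simp: posdef_dotp add_pos_nonneg add_nonneg_pos)
    qed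
  qed
  show ?thesis using 1 2 siegel_sym_posdef by blast
qed

lemma siegel_transpose: "Z \<in> siegel \<Longrightarrow> transpose Z = Z"
  by (simp add: siegel_sym_posdef)

lemma moebius_block:
  "moebius (block_matrix A B C D) Z =
    (cmat A ** Z + cmat B) ** matrix_inv (cmat C ** Z + cmat D)"
  by (simp add: moebius_def map_matrix_def)

text \<open>A kernel vector of C Z + D would give a graph vector whose image has second block 0.
  There \<open>hform\<close> vanishes, although it is invariant and positive on nonzero vectors of
  the graph.\<close>

lemma siegel_denom_invertible:
  assumes "block_matrix A B C D \<in> Sp4" "Z \<in> siegel"
  shows "invertible (cmat C ** Z + cmat D)"
proof (rule invertibleI_inj)
  fix q assume q: "(cmat C ** Z + cmat D) *v q = 0"
  let ?v = "pv (Z *v q) q" and ?g = "block_matrix A B C D"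
  have "cmat ?g *v ?v = pv (cmat A *v (Z *v q) + cmat B *v q) 0"
    using q by (simp add: cmat_block matrix_vector_add matrix_vector_mul_assoc)
  hence "hform (cmat ?g *v ?v) = 0" by (simp add: hform_pv)
  hence "hform ?v = 0" by (simp add: hform_cmat assms)
  thus "q = 0" using assms(2) unfolding siegel_iff
    by (metis less_irrefl pv_eq_0_iff pv_in_mat_lag)
qed

text \<open>Transfers \<open>moebius\<close> to the linear action on graphs; composition and
  inverses follow from injectivity of \<open>mat_lag\<close>.\<close>

lemma mat_lag_moebius:
  assumes "g \<in> Sp4" "Z \<in> siegel"
  shows "mat_lag (moebius g Z) = act (cmat g) (mat_lag Z)"
proof -
  obtain A B C D where g: "g = block_matrix A B C D" by (rule block_matrix_cases)
  have inv: "invertible (cmat C ** Z + cmat D)"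
    using assms unfolding g by (rule siegel_denom_invertible)
  show ?thesis
    unfolding g cmat_block moebius_block
    by (rule act_block_mat_lag[symmetric])
      (simp_all add: inv invertible_matrix_inv flip: matrix_mul_assoc)
qed

lemma moebius_siegel:
  assumes "g \<in> Sp4" "Z \<in> siegel" shows "moebius g Z \<in> siegel"
  using assms(2) unfolding siegel_iff mat_lag_moebius[OF assms]
  by (auto simp: symp_cmat hform_cmat assms(1))

lemma moebius_mult:
  assumes "g \<in> Sp4" "h \<in> Sp4" "Z \<in> siegel"
  shows "moebius g (moebius h Z) = moebius (g ** h) Z"
proof -
  have "mat_lag (moebius g (moebius h Z)) = mat_lag (moebius (g ** h) Z)"
    by (simp add: mat_lag_moebius assms moebius_siegel Sp4_mult act_act cmat_mult)
  thus ?thesis by simp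
qed

lemma moebius_one: "Z \<in> siegel \<Longrightarrow> moebius (mat 1) Z = Z"
  using mat_lag_moebius[of "mat 1" Z] by simp

lemma moebius_inv:
  assumes "g \<in> Sp4" "Z \<in> siegel"
  shows "moebius (matrix_inv g) (moebius g Z) = Z" "moebius g (moebius (matrix_inv g) Z) = Z"
  using assms invertible_matrix_inv[OF Sp4_invertible[OF assms(1)]]
  by (simp_all add: moebius_mult Sp4_inv moebius_one)

section \<open>Tubes\<close>

lemma lags_subspace: "l \<in> lags \<Longrightarrow> subspace l"
  using lags_lagrangian by (auto simp: lagrangian_def)

lemma complexify_eq:
  assumes "subspace l"
  shows "complexify l = {cvec u + \<i> *s cvec w | u w. u \<in> l \<and> w \<in> l}"
proof -
  let ?S = "{cvec u + \<i> *s cvec w | u w. u \<in> l \<and> w \<in> l}"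
  have c: "cvec = (\<lambda>v. \<chi> i. complex_of_real (v $ i))" by (simp add: cvec_def fun_eq_iff)
  have "complexify l = vec.span (cvec ` l)" by (simp add: complexify_def c)
  also have "\<dots> = ?S"
  proof
    have "vec.subspace ?S"
    proof (rule vec.subspaceI)
      show "0 \<in> ?S" using subspace_0[OF assms] by (auto intro!: exI[of _ 0])
    next
      fix x y assume "x \<in> ?S" "y \<in> ?S"
      then obtain u w u' w' where *: "x = cvec u + \<i> *s cvec w" "y = cvec u' + \<i> *s cvec w'"
        "u \<in> l" "w \<in> l" "u' \<in> l" "w' \<in> l" by blast
      have "x + y = cvec (u + u') + \<i> *s cvec (w + w')"
        by (simp add: * cvec_add vec.scale_right_distrib algebra_simps)
      thus "x + y \<in> ?S" using * assms subspace_add by blast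
    next
      fix c :: complex and x assume "x \<in> ?S"
      then obtain u w where *: "x = cvec u + \<i> *s cvec w" "u \<in> l" "w \<in> l" by blast
      have "c *s x = cvec (Re c *\<^sub>R u - Im c *\<^sub>R w) + \<i> *s cvec (Re c *\<^sub>R w + Im c *\<^sub>R u)"
        by (simp add: * vec_eq_iff complex_eq_iff algebra_simps)
      moreover have "Re c *\<^sub>R u - Im c *\<^sub>R w \<in> l" "Re c *\<^sub>R w + Im c *\<^sub>R u \<in> l"
        using * assms by (simp_all add: subspace_add subspace_diff subspace_scale)
      ultimately show "c *s x \<in> ?S" by blast
    qed
    moreover have "cvec ` l \<subseteq> ?S"
    proof safe
      fix u assume "u \<in> l"
      moreover have "cvec u = cvec u + \<i> *s cvec 0" by (simp add: vec_eq_iff)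
      ultimately show "\<exists>u' w. cvec u = cvec u' + \<i> *s cvec w \<and> u' \<in> l \<and> w \<in> l"
        using subspace_0[OF assms] by blast
    qed
    ultimately show "vec.span (cvec ` l) \<subseteq> ?S" by (rule vec.span_minimal[rotated])
    show "?S \<subseteq> vec.span (cvec ` l)"
      by (auto intro!: vec.span_add vec.span_scale intro: vec.span_base)
  qed
  finally show ?thesis .
qed

lemma cvec_in_complexify: "v \<in> l \<Longrightarrow> cvec v \<in> complexify l"
  unfolding complexify_def cvec_def by (intro vec.span_base) auto

lemma cvec_in_complexify_iff:
  assumes "subspace l" shows "cvec v + \<i> *s cvec w \<in> complexify l \<longleftrightarrow> v \<in> l \<and> w \<in> l"
proof
  assume "cvec v + \<i> *s cvec w \<in> complexify l"
  then obtain u t where *: "cvec v + \<i> *s cvec w = cvec u + \<i> *s cvec t" "u \<in> l" "t \<in> l"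
    unfolding complexify_eq[OF assms] by blast
  from *(1) have "v = u" "w = t" by (simp_all add: vec_eq_iff complex_eq_iff)
  thus "v \<in> l \<and> w \<in> l" using * by simp
qed (use complexify_eq[OF assms] in blast)

lemma complexify_act:
  assumes "subspace l"
  shows "complexify (act g l) = act (cmat g) (complexify l)"
proof -
  have s: "subspace (act g l)" using assms by (simp add: linear_subspace_image)
  have e: "cvec (g *v u) + \<i> *s cvec (g *v w) = cmat g *v (cvec u + \<i> *s cvec w)" for u w
    by (simp add: matrix_vector_right_distrib matrix_vector_mult_scale cmat_mult_cvec)
  show ?thesis
    unfolding complexify_eq[OF assms] complexify_eq[OF s]
  proof -
    have "{cvec u + \<i> *s cvec w |u w. u \<in> act g l \<and> w \<in> act g l} =
      {cvec (g *v u) + \<i> *s cvec (g *v w) |u w. u \<in> l \<and> w \<in> l}" by blast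
    also have "\<dots> = act (cmat g) {cvec u + \<i> *s cvec w |u w. u \<in> l \<and> w \<in> l}"
      unfolding e by blast
    finally show "{cvec u + \<i> *s cvec w |u w. u \<in> act g l \<and> w \<in> act g l} =
      act (cmat g) {cvec u + \<i> *s cvec w |u w. u \<in> l \<and> w \<in> l}" .
  qed
qed

lemma complexify_cnjv:
  assumes "subspace l" "v \<in> complexify l" shows "cnjv v \<in> complexify l"
proof -
  obtain u w where *: "v = cvec u + \<i> *s cvec w" "u \<in> l" "w \<in> l"
    using assms complexify_eq by blast
  have "cnjv v = cvec u + \<i> *s cvec (- w)" by (simp add: * vec_eq_iff)
  thus ?thesis using * assms(1) by (simp add: cvec_in_complexify_iff subspace_neg)
qed

lemma complexify_uminus: "v \<in> complexify l \<Longrightarrow> - v \<in> complexify l"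
  unfolding complexify_def by (rule vec.subspace_neg) simp_all

lemma complexify_infty: "pv x y \<in> complexify infty_lag \<longleftrightarrow> y = 0"
proof -
  obtain a b where x: "x = cvec a + \<i> *s cvec b" by (rule cvec_cases)
  obtain c d where y: "y = cvec c + \<i> *s cvec d" by (rule cvec_cases)
  have e: "pv x y = cvec (pv a c) + \<i> *s cvec (pv b d)"
    unfolding x y by (rule vec_sum_eqI) simp_all
  have "y = 0 \<longleftrightarrow> c = 0 \<and> d = 0" unfolding y by (auto simp: vec_eq_iff complex_eq_iff)
  thus ?thesis unfolding e by (simp add: cvec_in_complexify_iff lags_subspace)
qed

lemma complexify_0: "pv x y \<in> complexify (mat_lag 0) \<longleftrightarrow> x = 0"
proof -
  obtain a b where x: "x = cvec a + \<i> *s cvec b" by (rule cvec_cases)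
  obtain c d where y: "y = cvec c + \<i> *s cvec d" by (rule cvec_cases)
  have e: "pv x y = cvec (pv a c) + \<i> *s cvec (pv b d)"
    unfolding x y by (rule vec_sum_eqI) simp_all
  have "x = 0 \<longleftrightarrow> a = 0 \<and> b = 0" unfolding x by (auto simp: vec_eq_iff complex_eq_iff)
  thus ?thesis unfolding e by (simp add: cvec_in_complexify_iff lags_subspace mat_lag_in_lags)
qed

lemma conj_lag_cnjv: "conj_lag l = cnjv ` l"
  by (simp add: conj_lag_def cnjv_def)

lemma in_conj_lag: "v \<in> conj_lag l \<longleftrightarrow> cnjv v \<in> l"
  unfolding conj_lag_cnjv by (metis (no_types, lifting) cnjv_cnjv image_iff)

section \<open>Tubes as conditions on graphs\<close>

lemma act_cmat_iff:
  assumes "g \<in> Sp4" shows "cmat g *v v \<in> act (cmat g) l \<longleftrightarrow> v \<in> l"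
proof -
  have "inj ((*v) (cmat g))"
    by (rule inj_on_inverseI) (rule cmat_cmul(1)[OF Sp4_invertible[OF assms]])
  thus ?thesis by (rule inj_image_mem_iff)
qed

text \<open>Complexified real Lagrangians are complementary to the points of Siegel space, which
  gives the definite descriptions in the cross-ratio their meaning. With b moved to infinity, the
  component is obtained by solving for the first block.\<close>

lemma decomposition_unique:
  assumes "b \<in> lags" "Z \<in> siegel"
  shows "\<exists>!u. u \<in> complexify b \<and> v - u \<in> mat_lag Z"
proof -
  obtain g where g: "g \<in> Sp4" "b = act g infty_lag" using assms(1) by (auto simp: lags_def)
  define Z' v' where "Z' = moebius (matrix_inv g) Z" and "v' = cmat (matrix_inv g) *v v"
  note inv = Sp4_invertible[OF g(1)]
  have Z: "mat_lag Z = act (cmat g) (mat_lag Z')"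
    using mat_lag_moebius[OF g(1), of Z'] moebius_inv(2)[OF g(1) assms(2)] moebius_siegel[OF
        Sp4_inv[OF g(1)] assms(2)]
    by (simp add: Z'_def)
  have b: "complexify b = act (cmat g) (complexify infty_lag)"
    unfolding g by (rule complexify_act) (simp add: lags_subspace)
  have v: "v = cmat g *v v'" by (simp add: v'_def cmat_cmul inv)
  obtain p q where pq: "v' = pv p q" by (rule pv_cases)
  have iff: "cmat g *v pv r s \<in> complexify b \<and> v - cmat g *v pv r s \<in> mat_lag Z \<longleftrightarrow> s = 0 \<and> p - r =
      Z' *v (q - s)" for r s
    unfolding b Z v by (simp add: act_cmat_iff g(1) complexify_infty pq pv_diff flip:
        matrix_vector_mult_diff_distrib)
  show ?thesis
  proof (rule ex1I[of _ "cmat g *v pv (p - Z' *v q) 0"])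
    show "cmat g *v pv (p - Z' *v q) 0 \<in> complexify b \<and> v - cmat g *v pv (p - Z' *v q) 0 \<in> mat_lag
        Z"
      unfolding iff by simp
  next
    fix u assume *: "u \<in> complexify b \<and> v - u \<in> mat_lag Z"
    obtain r s where rs: "cmat (matrix_inv g) *v u = pv r s" by (rule pv_cases)
    have u: "u = cmat g *v pv r s" by (simp add: cmat_cmul inv flip: rs)
    hence "s = 0 \<and> p - r = Z' *v (q - s)" using * iff by blast
    thus "u = cmat g *v pv (p - Z' *v q) 0" unfolding u by (auto simp: algebra_simps)
  qed
qed

lemma decomposition_unique_conj:
  assumes "b \<in> lags" "Z \<in> siegel"
  shows "\<exists>!u. u \<in> complexify b \<and> v - u \<in> conj_lag (mat_lag Z)"
proof -
  have "u \<in> complexify b \<longleftrightarrow> cnjv u \<in> complexify b" for u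
    using complexify_cnjv[OF lags_subspace[OF assms(1)]] by (metis cnjv_cnjv)
  hence "u \<in> complexify b \<and> v - u \<in> conj_lag (mat_lag Z) \<longleftrightarrow>
      cnjv u \<in> complexify b \<and> cnjv v - cnjv u \<in> mat_lag Z" for u
    by (simp add: in_conj_lag cnjv_diff)
  thus ?thesis using decomposition_unique[OF assms, of "cnjv v"] by (metis cnjv_cnjv)
qed

lemma proj_parallel_eq_iff:
  assumes "\<exists>!u. u \<in> l \<and> v - u \<in> l'"
  shows "proj_parallel l l' v = w \<longleftrightarrow> w \<in> l \<and> v - w \<in> l'"
  using theI'[OF assms] assms unfolding proj_parallel_def by blast

text \<open>Here w is the projection of v to b along the conjugate Lagrangian, and the cross-ratio
  condition says that w differs by an element of \<open>mat_lag Z\<close> from -v. In this form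
  linear maps can be pushed through without projections.\<close>

lemma tube_iff:
  assumes "a \<in> lags" "b \<in> lags"
  shows "Z \<in> tube a b \<longleftrightarrow> Z \<in> siegel \<and>
    (\<forall>v\<in>complexify a. \<exists>w\<in>complexify b. v + w \<in> mat_lag Z \<and> v - w \<in> conj_lag (mat_lag Z))"
proof (cases "Z \<in> siegel")
  case Z: True
  note p1 = proj_parallel_eq_iff[OF decomposition_unique[OF assms(1) Z]]
    and p2 = proj_parallel_eq_iff[OF decomposition_unique_conj[OF assms(2) Z]]
  let ?l = "mat_lag Z"
  have "cross_ratio (complexify a) ?l (conj_lag ?l) (complexify b) = restrict uminus (complexify
      a) \<longleftrightarrow>
     (\<forall>v\<in>complexify a. proj_parallel (complexify a) ?l (proj_parallel (complexify b) (conj_lag ?l)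
         v) = - v)"
    by (auto simp: cross_ratio_def restrict_def fun_eq_iff)
  also have "\<dots> \<longleftrightarrow> (\<forall>v\<in>complexify a. \<exists>w\<in>complexify b. v + w \<in> mat_lag Z \<and> v - w \<in> conj_lag (mat_lag
      Z))"
  proof (rule ball_cong[OF refl])
    fix v assume v: "v \<in> complexify a"
    hence v': "- v \<in> complexify a" by (rule complexify_uminus)
    show "proj_parallel (complexify a) ?l (proj_parallel (complexify b) (conj_lag ?l) v) = - v \<longleftrightarrow>
      (\<exists>w\<in>complexify b. v + w \<in> mat_lag Z \<and> v - w \<in> conj_lag (mat_lag Z))"
    proof -
      define w0 where "w0 = proj_parallel (complexify b) (conj_lag ?l) v"
      have w0: "w = w0 \<longleftrightarrow> w \<in> complexify b \<and> v - w \<in> conj_lag ?l" for w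
        using p2[of v w] unfolding w0_def by auto
      have "w0 - - v = v + w0" by (simp add: add.commute)
      thus ?thesis unfolding p1 w0_def[symmetric] Bex_def using w0 v' by metis
    qed
  qed
  finally show ?thesis using Z by (simp add: tube_def)
qed (simp add: tube_def)

lemma tube_subset_siegel: "tube a b \<subseteq> siegel"
  by (auto simp: tube_def)

lemma conj_lag_act: "conj_lag (act (cmat g) l) = act (cmat g) (conj_lag l)"
  by (simp add: conj_lag_cnjv image_image cmat_mult_cnjv)

lemma moebius_in_tube:
  assumes "g \<in> Sp4" "a \<in> lags" "b \<in> lags" "Z \<in> tube a b"
  shows "moebius g Z \<in> tube (act g a) (act g b)"
proof -
  have Z: "Z \<in> siegel" "\<forall>v\<in>complexify a. \<exists>w\<in>complexify b. v + w \<in> mat_lag Z \<and> v - w \<in> conj_lag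
      (mat_lag Z)"
    using assms(4) unfolding tube_iff[OF assms(2,3)] by blast+
  show ?thesis
    unfolding tube_iff[OF lags_act[OF assms(1,2)] lags_act[OF assms(1,3)]]
      complexify_act[OF lags_subspace[OF assms(2)]] complexify_act[OF lags_subspace[OF assms(3)]]
      mat_lag_moebius[OF assms(1) Z(1)] conj_lag_act
  proof (intro conjI ballI)
    show "moebius g Z \<in> siegel" using assms(1) Z(1) by (rule moebius_siegel)
    fix v assume "v \<in> act (cmat g) (complexify a)"
    then obtain u where u: "v = cmat g *v u" "u \<in> complexify a" by blast
    with Z(2) obtain w where w: "w \<in> complexify b" "u + w \<in> mat_lag Z" "u - w \<in> conj_lag (mat_lag
        Z)" by blast
    show "\<exists>w\<in>act (cmat g) (complexify b). v + w \<in> act (cmat g) (mat_lag Z) \<and> v - w \<in> act (cmat g)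
        (conj_lag (mat_lag Z))"
      unfolding u(1)
      by (rule bexI[of _ "cmat g *v w"])
        (use w in \<open>simp_all add: act_cmat_iff assms(1) flip: matrix_vector_right_distrib
            matrix_vector_mult_diff_distrib\<close>)
  qed
qed

lemma tube_act:
  assumes "g \<in> Sp4" "a \<in> lags" "b \<in> lags"
  shows "moebius g ` tube a b = tube (act g a) (act g b)"
proof
  show "moebius g ` tube a b \<subseteq> tube (act g a) (act g b)"
    using moebius_in_tube assms by blast
  show "tube (act g a) (act g b) \<subseteq> moebius g ` tube a b"
  proof
    fix Z assume Z: "Z \<in> tube (act g a) (act g b)"
    hence "moebius (matrix_inv g) Z \<in> tube (act (matrix_inv g) (act g a)) (act (matrix_inv g) (act
        g b))"
      using assms by (intro moebius_in_tube Sp4_inv lags_act)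
    hence "moebius (matrix_inv g) Z \<in> tube a b" by (simp only: act_inv assms)
    moreover have "moebius g (moebius (matrix_inv g) Z) = Z"
      using assms(1) Z tube_subset_siegel by (blast intro: moebius_inv(2))
    ultimately show "Z \<in> moebius g ` tube a b" by (metis imageI)
  qed
qed

section \<open>The tube of purely imaginary points and its ends\<close>

lemma mat_lag_0_in_lags [simp]: "mat_lag 0 \<in> lags" by (simp add: mat_lag_in_lags)

lemma complex_mat_nth [simp]: "complex_mat X Y $ i $ j = Complex (X $ i $ j) (Y $ i $ j)"
  by (simp add: complex_mat_def)

lemma siegel_invertible:
  assumes "Z \<in> siegel" shows "invertible Z"
proof (rule invertibleI_inj)
  fix q assume "Z *v q = 0"
  hence "hform (pv (Z *v q) q) = 0" by (simp add: hform_pv)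
  thus "q = 0" using assms unfolding siegel_iff by (metis less_irrefl pv_eq_0_iff pv_in_mat_lag)
qed

lemma cnjv_pv: "cnjv (pv x y) = pv (cnjv x) (cnjv y)"
  by (rule vec_sum_eqI) simp_all

lemma cnjv_uminus: "cnjv (- v) = - cnjv v"
  by (simp add: vec_eq_iff)

text \<open>With v = (p, 0) and w = (0, q) the tube condition asks, for every p, for a q with p = Z
  q whose conjugates satisfy the same relation with -Z. Since Z is invertible, this means that the
  conjugate of Z is -Z.\<close>

lemma tube_infty_0: "tube infty_lag (mat_lag 0) = {complex_mat 0 Y | Y. posdef_mat Y}"
proof -
  have "Z \<in> tube infty_lag (mat_lag 0) \<longleftrightarrow> (\<exists>Y. Z = complex_mat 0 Y \<and> posdef_mat Y)" for Z
  proof (cases "Z \<in> siegel")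
    case True
    note inv = siegel_invertible[OF True]
    have inC: "v \<in> complexify infty_lag \<longleftrightarrow> (\<exists>p. v = pv p 0)" "v \<in> complexify (mat_lag 0) \<longleftrightarrow> (\<exists>q. v =
        pv 0 q)" for v
      by (metis pv_cases complexify_infty complexify_0)+
    have "Z \<in> tube infty_lag (mat_lag 0) \<longleftrightarrow> (\<forall>p. \<exists>q. p = Z *v q \<and> cnjv p = - (Z *v cnjv q))"
    proof -
      have "pv p 0 + pv 0 q \<in> mat_lag Z \<longleftrightarrow> p = Z *v q"
        "pv p 0 - pv 0 q \<in> conj_lag (mat_lag Z) \<longleftrightarrow> cnjv p = - (Z *v cnjv q)" for p q
        by (simp_all add: pv_add pv_diff in_conj_lag cnjv_pv cnjv_uminus matrix_vector_neg)
      thus ?thesis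
        unfolding tube_iff[OF infty_in_lags mat_lag_0_in_lags] Ball_def Bex_def inC using True by
            metis
    qed
    also have "\<dots> \<longleftrightarrow> cnjm Z = - Z"
    proof
      assume *: "\<forall>p. \<exists>q. p = Z *v q \<and> cnjv p = - (Z *v cnjv q)"
      show "cnjm Z = - Z"
      proof (rule matrix_eqI)
        fix r
        obtain q where q: "Z *v cnjv r = Z *v q" "cnjv (Z *v cnjv r) = - (Z *v cnjv q)" using * by
            blast
        have "q = cnjv r" using q(1) invertible_matrix_inv_vec(2)[OF inv] by metis
        thus "cnjm Z *v r = - Z *v r" using q(2)
          by (simp add: matrix_vector_neg flip: cnjm_mult_cnjv)
      qed
    next
      assume *: "cnjm Z = - Z"
      show "\<forall>p. \<exists>q. p = Z *v q \<and> cnjv p = - (Z *v cnjv q)"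
      proof
        fix p
        have "p = Z *v (matrix_inv Z *v p)" by (simp add: invertible_matrix_inv_vec[OF inv])
        moreover have "cnjv (Z *v q) = - (Z *v cnjv q)" for q
          by (simp add: * matrix_vector_neg flip: cnjm_mult_cnjv)
        ultimately show "\<exists>q. p = Z *v q \<and> cnjv p = - (Z *v cnjv q)" by metis
      qed
    qed
    also have "\<dots> \<longleftrightarrow> Z = complex_mat 0 (map_matrix Im Z)"
    proof -
      have "cnj z = - z \<longleftrightarrow> z = Complex 0 (Im z)" for z by (auto simp: complex_eq_iff)
      thus ?thesis by (simp add: vec_eq_iff)
    qed
    also have "\<dots> \<longleftrightarrow> (\<exists>Y. Z = complex_mat 0 Y \<and> posdef_mat Y)"
    proof -
      have "map_matrix Im (complex_mat 0 Y) = Y" for Y by (simp add: vec_eq_iff)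
      thus ?thesis using True[unfolded siegel_sym_posdef] by metis
    qed
    finally show ?thesis .
  next
    case False
    moreover have "Z \<in> siegel" if "Z = complex_mat 0 Y" "posdef_mat Y" for Y
      unfolding siegel_def using that sym_0 by blast
    ultimately show ?thesis using tube_subset_siegel by blast
  qed
  thus ?thesis by blast
qed

lemma posdef_2112: "posdef_mat (vector [vector [2, 1], vector [1, 2]])"
  unfolding posdef_dotp
proof (intro conjI allI impI)
  fix v :: "real^2" assume "v \<noteq> 0"
  hence "v $ 1 \<noteq> 0 \<or> v $ 2 \<noteq> 0" by (simp add: vec_eq_iff forall_2)
  hence "0 < (v $ 1)\<^sup>2 + (v $ 2)\<^sup>2" by (simp add: sum_power2_gt_zero_iff)
  hence "0 < (v $ 1)\<^sup>2 + (v $ 2)\<^sup>2 + (v $ 1 + v $ 2)\<^sup>2" by (rule add_pos_nonneg) simp_all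
  thus "0 < dotp v (vector [vector [2, 1], vector [1, 2]] *v v)"
    by (simp add: dotp_2 matrix_vector_mult_2 power2_eq_square algebra_simps)
qed (simp add: sym_mat_2)

text \<open>Id, diag(1, 2) and the matrix with diagonal 2 and off-diagonal 1 span the symmetric
  matrices. The hypothesis thus kills the symmetric product of x and y, which is nonzero for nonzero
  factors.\<close>

lemma posdef_separates:
  assumes "\<And>Y. posdef_mat Y \<Longrightarrow> dotp (Y *v y) x = 0"
  shows "y = 0 \<or> x = 0"
proof -
  have 1: "y $ 1 * x $ 1 + y $ 2 * x $ 2 = 0"
    using assms[of "mat 1"] by (simp add: dotp_2)
  have 2: "y $ 1 * x $ 1 + 2 * y $ 2 * x $ 2 = 0"
    using assms[of "diag2 1 2"] by (simp add: dotp_2 matrix_vector_mult_2)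
  have 3: "(2 * y $ 1 + y $ 2) * x $ 1 + (y $ 1 + 2 * y $ 2) * x $ 2 = 0"
    using assms[OF posdef_2112] by (simp add: dotp_2 matrix_vector_mult_2)
  have 4: "y $ 1 * x $ 1 = 0" "y $ 2 * x $ 2 = 0" "y $ 2 * x $ 1 + y $ 1 * x $ 2 = 0"
    using 1 2 3 by algebra+
  hence "(y $ 1 = 0 \<and> y $ 2 = 0) \<or> (x $ 1 = 0 \<and> x $ 2 = 0)" by auto
  thus ?thesis by (auto simp: vec_eq_iff forall_2)
qed

lemma lags_subset_eq:
  assumes "l \<in> lags" "m \<in> lags" "l \<subseteq> m" shows "l = m"
  using assms lags_lagrangian[of l] lags_lagrangian[of m]
  by (intro subspace_dim_equal) (auto simp: lagrangian_def)

text \<open>Each point iY of the tube turns a real vector (x, y) of c into the real vector (Y y,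
  -Y^-1 x) of d. Varying Y yields enough vectors of d for its isotropy to confine c to one of the
  two blocks.\<close>

lemma imaginary_tube_determines_ends:
  assumes "c \<in> lags" "d \<in> lags" "tube c d = tube infty_lag (mat_lag 0)"
  shows "{c, d} = {infty_lag, mat_lag 0}"
proof -
  note sub = lags_subspace[OF assms(1)] lags_subspace[OF assms(2)]
  have key: "\<exists>s. Y *v s = - x \<and> pv (Y *v y) s \<in> d" if Y: "posdef_mat Y" and c: "pv x y \<in> c" for Y
      x y
  proof -
    define Z where "Z = complex_mat 0 Y"
    have Ze: "Z *v (cvec a + \<i> *s cvec b) = cvec (- (Y *v b)) + \<i> *s cvec (Y *v a)" for a b
      by (simp add: Z_def vec_eq_iff matrix_vector_mult_2 complex_eq_iff algebra_simps)
    have "Z \<in> tube c d" unfolding assms(3) tube_infty_0 Z_def using Y by blast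
    then obtain w where w: "w \<in> complexify d" "cvec (pv x y) + w \<in> mat_lag Z" "cvec (pv x y) - w \<in>
        conj_lag (mat_lag Z)"
      unfolding tube_iff[OF assms(1,2)] using cvec_in_complexify[OF c] by blast
    obtain u t where ut: "w = cvec u + \<i> *s cvec t" by (rule cvec_cases)
    obtain u1 u2 where u: "u = pv u1 u2" by (rule pv_cases)
    obtain t1 t2 where t: "t = pv t1 t2" by (rule pv_cases)
    have e1: "cvec (pv x y) + w = pv (cvec (x + u1) + \<i> *s cvec t1) (cvec (y + u2) + \<i> *s cvec t2)"
      "cnjv (cvec (pv x y) - w) = pv (cvec (x - u1) + \<i> *s cvec t1) (cvec (y - u2) + \<i> *s cvec t2)"
      unfolding ut u t by (rule vec_sum_eqI; simp)+
    have ceq: "cvec a + \<i> *s cvec b = cvec a' + \<i> *s cvec b' \<longleftrightarrow> a = a' \<and> b = b'" for a b a' b' ::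
        "real^2"
      by (auto simp: vec_eq_iff complex_eq_iff)
    have E: "x + u1 = - (Y *v t2)" "t1 = Y *v (y + u2)" "x - u1 = - (Y *v t2)" "t1 = Y *v (y - u2)"
      using w(2,3) unfolding in_conj_lag e1 pv_in_mat_lag Ze ceq by auto
    have "(Y *v t2) $ i = (- x) $ i" for i
      using arg_cong[OF E(1), of "\<lambda>v. v $ i"] arg_cong[OF E(3), of "\<lambda>v. v $ i"] by simp
    moreover have "t1 $ i = (Y *v y) $ i" for i
      using arg_cong[OF E(2), of "\<lambda>v. v $ i"] arg_cong[OF E(4), of "\<lambda>v. v $ i"]
      by (simp add: matrix_vector_right_distrib matrix_vector_mult_diff_distrib)
    ultimately have "Y *v t2 = - x" "t1 = Y *v y"
      unfolding vec_eq_iff by blast+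
    moreover have "pv t1 t2 \<in> d" using w(1) unfolding ut t by (simp add: cvec_in_complexify_iff sub)
    ultimately show ?thesis by auto
  qed
  have split: "pv y 0 \<in> d \<and> pv 0 x \<in> d" if c: "pv x y \<in> c" for x y
  proof -
    have 1: "pv y (- x) \<in> d" using key[OF posdef_one c] by auto
    have d: "diag2 2 2 *v u = 2 *\<^sub>R u" for u
      by (simp add: vec_eq_iff forall_2 matrix_vector_mult_2)
    obtain s where s: "diag2 2 2 *v s = - x" "pv (diag2 2 2 *v y) s \<in> d" using key[of "diag2 2 2"]
        c by auto
    have s2: "x = - 2 *\<^sub>R s" using s(1) by (simp add: vec_eq_iff forall_2 matrix_vector_mult_2)
    \<comment> \<open>The matrices Id and 2 Id give (y, 2s) and (2y, s) in d; half of the first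
      cancels s and leaves 3/2 of (y, 0).\<close>
    have "pv y 0 = (2/3) *\<^sub>R (pv (diag2 2 2 *v y) s - (1/2) *\<^sub>R pv y (- x))"
      unfolding s2 d by (rule vec_sum_eqI) simp_all
    hence y: "pv y 0 \<in> d" using 1 s(2) sub by (simp add: subspace_diff subspace_scale)
    have "pv 0 x = pv y 0 - pv y (- x)" by (simp add: pv_diff)
    hence "pv 0 x \<in> d" using 1 y sub by (simp add: subspace_diff)
    thus ?thesis using y by simp
  qed
  \<comment> \<open>Isotropy of d pairs (Y y, s) with (0, x') for every positive definite Y. Hence
    one vector of c with y nonzero already forces all first blocks in c to vanish.\<close>
  have "y = 0 \<or> x' = 0" if "pv x y \<in> c" "pv x' y' \<in> c" for x y x' y'
  proof (rule posdef_separates)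
    fix Y assume "posdef_mat Y"
    with that(1) obtain s where s: "pv (Y *v y) s \<in> d" using key by blast
    have "symp (pv (Y *v y) s) (pv 0 x') = 0"
      using lags_lagrangian[OF assms(2)] s split[OF that(2)] by (simp add: lagrangian_def symp_J4)
    thus "dotp (Y *v y) x' = 0" by (simp add: dotp_simps)
  qed
  hence "(\<forall>x y. pv x y \<in> c \<longrightarrow> y = 0) \<or> (\<forall>x y. pv x y \<in> c \<longrightarrow> x = 0)" by blast
  hence "c \<subseteq> infty_lag \<or> c \<subseteq> mat_lag 0"
    by (metis pv_cases pv_in_infty_lag pv_in_mat_lag matrix_zero_mult(3) subsetI)
  hence "c = infty_lag \<or> c = mat_lag 0" using lags_subset_eq[OF assms(1)] infty_in_lags
      mat_lag_0_in_lags by blast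
  thus ?thesis
  proof
    assume c: "c = infty_lag"
    have "mat_lag 0 \<subseteq> d" using split[of _ 0] unfolding c by (auto simp: mat_lag_range)
    hence "mat_lag 0 = d" by (rule lags_subset_eq[OF mat_lag_0_in_lags assms(2)])
    thus ?thesis using c by simp
  next
    assume c: "c = mat_lag 0"
    have "infty_lag \<subseteq> d" using split[of 0] unfolding c by (auto simp: infty_lag_range)
    hence "infty_lag = d" by (rule lags_subset_eq[OF infty_in_lags assms(2)])
    thus ?thesis using c by auto
  qed
qed

lemma tube_determines_ends:
  assumes "maximal_triple a b x" "c \<in> lags" "d \<in> lags" "tube a b = tube c d"
  shows "{a, b} = {c, d}"
proof -
  obtain g where g: "g \<in> Sp4" "act g a = infty_lag" "act g b = mat_lag 0"
    using assms(1) by (rule maximal_triple_normalize)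
  have ab: "a \<in> lags" "b \<in> lags" using maximal_triple_lags[OF assms(1)] by auto
  have "tube (act g c) (act g d) = tube infty_lag (mat_lag 0)"
    using arg_cong[OF assms(4), of "image (moebius g)"] tube_act[OF g(1)] ab assms g by metis
  hence "{act g c, act g d} = {act g a, act g b}"
    unfolding g(2,3) using assms g(1) by (intro imaginary_tube_determines_ends lags_act)
  thus ?thesis using act_eq_iff[OF g(1)] by (auto simp: doubleton_eq_iff)
qed

section \<open>Invariance of orthogonality\<close>

text \<open>The automorphy factor C Z + D. With L its inverse, the action has derivative U -> L^T U
  L at Z.\<close>

definition denom :: "real^(2 + 2)^(2 + 2) \<Rightarrow> complex^2^2 \<Rightarrow> complex^2^2" where
  "denom g Z = (\<chi> i j. of_real (g $ Inr i $ Inl j)) ** Z + (\<chi> i j. of_real (g $ Inr i $ Inr j))"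

lemma denom_block: "denom (block_matrix A B C D) Z = cmat C ** Z + cmat D"
  by (simp add: denom_def map_matrix_def)

lemma denom_invertible: "g \<in> Sp4 \<Longrightarrow> Z \<in> siegel \<Longrightarrow> invertible (denom g Z)"
  by (metis block_matrix_cases denom_block siegel_denom_invertible)

lemma moebius_denom:
  assumes "block_matrix A B C D \<in> Sp4" "Z \<in> siegel"
  shows "moebius (block_matrix A B C D) Z ** (cmat C ** Z + cmat D) = cmat A ** Z + cmat B"
  using invertible_matrix_inv[OF siegel_denom_invertible[OF assms]]
  by (simp add: moebius_block flip: matrix_mul_assoc)

lemma moebius_eqI:
  assumes "block_matrix A B C D \<in> Sp4" "Z \<in> siegel"
    "cmat A ** Z + cmat B = W ** (cmat C ** Z + cmat D)"
  shows "moebius (block_matrix A B C D) Z = W"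
  using invertible_matrix_inv[OF siegel_denom_invertible[OF assms(1,2)]]
  by (simp add: moebius_block assms(3) flip: matrix_mul_assoc)

lemma moebius_graph:
  assumes "g \<in> Sp4" "Z \<in> siegel"
  shows "cmat g *v pv (Z *v p) p = pv (moebius g Z *v (denom g Z *v p)) (denom g Z *v p)"
proof -
  obtain A B C D where g: "g = block_matrix A B C D" by (rule block_matrix_cases)
  have "moebius g Z *v (denom g Z *v p) = (cmat A ** Z + cmat B) *v p"
    using moebius_denom[of A B C D Z] assms unfolding g denom_block
    by (simp add: matrix_vector_mul_assoc)
  thus ?thesis unfolding g denom_block cmat_block
    by (simp add: matrix_vector_add matrix_vector_mul_assoc)
qed

text \<open>The classical identity (C Z + D)^T (gZ - gW) (C W + D) = Z - W, read off by pairing two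
  graph vectors with the invariant form. \<open>W'\<close> and \<open>M\<close> stay abstract
  because \<open>W\<close> is also taken to be the conjugate of Z, which lies outside
  \<open>siegel\<close>.\<close>

lemma moebius_difference:
  assumes g: "g \<in> Sp4" and Z: "Z \<in> siegel"
    and W: "\<And>q. cmat g *v pv (W *v q) q = pv (W' *v (M *v q)) (M *v q)"
  shows "transpose (denom g Z) ** (moebius g Z - W') ** M = Z - W"
proof (rule matrix_eqI)
  fix q
  let ?N = "denom g Z" and ?Z = "moebius g Z"
  note t = siegel_transpose[OF Z] siegel_transpose[OF moebius_siegel[OF g Z]]
  have "dotp ((Z - W) *v q - transpose ?N ** (?Z - W') ** M *v q) p = 0" for p
  proof -
    have "symp (cmat g *v pv (Z *v p) p) (cmat g *v pv (W *v q) q) = dotp p ((Z - W) *v q)"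
      using t(1) by (simp add: symp_cmat[OF g] dotp_matrix matrix_vector_diff dotp_simps)
    moreover have "symp (cmat g *v pv (Z *v p) p) (cmat g *v pv (W *v q) q)
        = dotp (?N *v p) ((?Z - W') *v (M *v q))"
      unfolding moebius_graph[OF g Z] W using t(2)
      by (simp add: matrix_vector_diff dotp_simps dotp_matrix[of ?Z])
    moreover have "\<dots> = dotp p (transpose ?N ** (?Z - W') ** M *v q)"
      by (simp add: dotp_matrix[of ?N] flip: matrix_vector_mul_assoc)
    ultimately show ?thesis by (simp add: dotp_simps dotp_commute)
  qed
  hence "(Z - W) *v q - transpose ?N ** (?Z - W') ** M *v q = 0" by (rule dotp_eq_0)
  thus "transpose ?N ** (?Z - W') ** M *v q = (Z - W) *v q" by simp
qed

lemma cnjm_mult: "cnjm (A ** B) = cnjm A ** cnjm B"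
  by (simp add: vec_eq_iff matrix_matrix_mult_def)

lemma cnjm_cnjm [simp]: "cnjm (cnjm A) = A" by (simp add: vec_eq_iff)

lemma cnjm_cmat [simp]: "cnjm (cmat A) = cmat A" by (simp add: vec_eq_iff)

lemma cnjm_transpose: "cnjm (transpose A) = transpose (cnjm A)" by (simp add: vec_eq_iff)

lemma cnjm_1 [simp]: "cnjm (mat 1) = mat 1" by (simp add: vec_eq_iff mat_def)

text \<open>The difference formula for Z and its conjugate, divided by 2i; it applies because g is
  real and so commutes with conjugation. The second equation is the conjugate of the first.\<close>

lemma moebius_Im:
  assumes "g \<in> Sp4" "Z \<in> siegel"
  defines "N \<equiv> denom g Z"
  shows "transpose N ** cmat (map_matrix Im (moebius g Z)) ** cnjm N = cmat (map_matrix Im Z)"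
    "transpose (cnjm N) ** cmat (map_matrix Im (moebius g Z)) ** N = cmat (map_matrix Im Z)"
proof -
  have W: "cmat g *v pv (cnjm Z *v q) q = pv (cnjm (moebius g Z) *v (cnjm N *v q)) (cnjm N *v q)"
      for q
  proof -
    have "pv (cnjm Z *v q) q = cnjv (pv (Z *v cnjv q) (cnjv q))"
      by (simp add: cnjv_pv flip: cnjm_mult_cnjv)
    hence "cmat g *v pv (cnjm Z *v q) q = cnjv (cmat g *v pv (Z *v cnjv q) (cnjv q))"
      by (simp add: cmat_mult_cnjv)
    also have "\<dots> = pv (cnjm (moebius g Z) *v (cnjm N *v q)) (cnjm N *v q)"
      unfolding moebius_graph[OF assms(1,2)] N_def by (simp add: cnjv_pv flip: cnjm_mult_cnjv)
    finally show ?thesis .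
  qed
  have im: "X - cnjm X = mat (2 * \<i>) ** cmat (map_matrix Im X)" for X :: "complex^2^2"
    by (simp add: mat2_eq complex_eq_iff)
  have "transpose N ** (moebius g Z - cnjm (moebius g Z)) ** cnjm N = Z - cnjm Z"
    unfolding N_def by (rule moebius_difference[OF assms(1,2)]) (rule W[unfolded N_def])
  hence "transpose N ** (mat (2 * \<i>) ** cmat (map_matrix Im (moebius g Z))) ** cnjm N
      = mat (2 * \<i>) ** cmat (map_matrix Im Z)"
    unfolding im .
  moreover have "transpose N ** (mat (2 * \<i>) ** cmat (map_matrix Im (moebius g Z))) ** cnjm N
      = mat (2 * \<i>) ** (transpose N ** cmat (map_matrix Im (moebius g Z)) ** cnjm N)"
    by (simp add: mat2_eq algebra_simps)
  moreover have "A = B" if "mat (2 * \<i>) ** A = mat (2 * \<i>) ** B" for A B :: "complex^2^2"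
    using that by (simp add: mat2_eq)
  ultimately show 1: "transpose N ** cmat (map_matrix Im (moebius g Z)) ** cnjm N = cmat
      (map_matrix Im Z)"
    by metis
  show "transpose (cnjm N) ** cmat (map_matrix Im (moebius g Z)) ** N = cmat (map_matrix Im Z)"
    using arg_cong[OF 1, of cnjm] by (simp add: cnjm_mult cnjm_transpose)
qed

lemma cmat_matrix_inv:
  assumes "invertible Y" shows "cmat (matrix_inv Y) ** cmat Y = mat 1" "cmat Y ** cmat (matrix_inv
      Y) = mat 1"
  using invertible_matrix_inv[OF assms] by (simp_all flip: cmat_mult)

lemma matrix_mul_cancel_left:
  fixes A :: "'a::field^2^2"
  assumes "invertible A" "A ** X = A ** Y" shows "X = Y"
proof -
  have "(matrix_inv A ** A) ** X = (matrix_inv A ** A) ** Y"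
    using assms(2) by (simp flip: matrix_mul_assoc)
  thus ?thesis by (simp add: invertible_matrix_inv[OF assms(1)])
qed

lemma transpose_invertible:
  fixes N :: "'a::field^'n^'n"
  assumes "invertible N" shows "invertible (transpose N)"
  using assms by (simp add: invertible_det_nz det_transpose)

lemma cnjm_inv:
  assumes "invertible N" shows "cnjm N ** cnjm (matrix_inv N) = mat 1" "cnjm (matrix_inv N) **
      cnjm N = mat 1"
  using invertible_matrix_inv[OF assms] by (simp_all flip: cnjm_mult)

text \<open>\<open>W'\<close> is real, so it equals both \<open>cnjm N ** W ** transpose N\<close>
  and the conjugate of this product. Inserting one expression at each of its two occurrences makes
  the factors cancel, up to one pair that meets under the trace.\<close>

lemma siegel_metric_moebius:
  assumes "g \<in> Sp4" "Z \<in> siegel"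
  defines "L \<equiv> matrix_inv (denom g Z)"
  shows "siegel_metric (moebius g Z) (transpose L ** U ** L) (transpose L ** V ** L) =
      siegel_metric Z U V"
proof -
  define N where "N = denom g Z"
  have inv: "invertible N" unfolding N_def using assms by (intro denom_invertible)
  have NL: "N ** L = mat 1" "L ** N = mat 1" "cnjm N ** cnjm L = mat 1" "cnjm L ** cnjm N = mat 1"
    unfolding L_def N_def[symmetric] using invertible_matrix_inv[OF inv] cnjm_inv[OF inv] by auto
  have NL2: "transpose N ** transpose L = mat 1" "transpose (cnjm N) ** transpose (cnjm L) = mat 1"
    using NL by (simp_all flip: matrix_transpose_mul)
  let ?Y = "map_matrix Im Z" and ?Y' = "map_matrix Im (moebius g Z)"
  define W W' where "W = cmat (matrix_inv ?Y)" and "W' = cmat (matrix_inv ?Y')"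
  have pd: "invertible ?Y" "invertible ?Y'"
    using assms(2) moebius_siegel[OF assms(1,2)] by (auto simp: siegel_sym_posdef intro:
        posdef_invertible)
  note YW = cmat_matrix_inv[OF pd(1), folded W_def] cmat_matrix_inv[OF pd(2), folded W'_def]
  note Im = moebius_Im[OF assms(1,2), folded N_def]
  have W1: "W' = cnjm N ** W ** transpose N"
  proof -
    have "transpose N ** (cmat ?Y' ** (cnjm N ** W ** transpose N)) = (transpose N ** cmat ?Y' **
        cnjm N) ** W ** transpose N"
      by (simp add: matrix_mul_assoc)
    also have "\<dots> = transpose N ** mat 1" unfolding Im YW by simp
    finally have e: "cmat ?Y' ** (cnjm N ** W ** transpose N) = mat 1"
      by (rule matrix_mul_cancel_left[OF transpose_invertible[OF inv]])
    have "W' = W' ** (cmat ?Y' ** (cnjm N ** W ** transpose N))" unfolding e by simp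
    also have "\<dots> = (W' ** cmat ?Y') ** (cnjm N ** W ** transpose N)" by (simp only:
        matrix_mul_assoc)
    finally show ?thesis unfolding YW(3) by simp
  qed
  have "W' = cnjm W'" by (simp add: W'_def)
  also have "\<dots> = N ** W ** transpose (cnjm N)"
    unfolding W1 by (simp add: cnjm_mult cnjm_transpose W_def)
  finally have W2: "W' = N ** W ** transpose (cnjm N)" .
  have "W' ** (transpose L ** U ** L) ** W' ** cnjm (transpose L ** V ** L)
    = (cnjm N ** W ** transpose N) ** (transpose L ** U ** L) ** (N ** W ** transpose (cnjm N)) **
        (transpose (cnjm L) ** cnjm V ** cnjm L)"
    by (subst W1, subst W2) (simp add: cnjm_mult cnjm_transpose)
  also have "\<dots> = cnjm N ** W ** (transpose N ** transpose L) ** U ** (L ** N) ** W **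
      (transpose (cnjm N) ** transpose (cnjm L)) ** cnjm V ** cnjm L"
    by (simp add: matrix_mul_assoc)
  also have "\<dots> = cnjm N ** (W ** U ** W ** cnjm V ** cnjm L)"
    unfolding NL NL2 by (simp add: matrix_mul_assoc)
  finally have "trace (W' ** (transpose L ** U ** L) ** W' ** cnjm (transpose L ** V ** L))
    = trace (cnjm N ** (W ** U ** W ** cnjm V ** cnjm L))" by (rule arg_cong)
  also have "\<dots> = trace ((W ** U ** W ** cnjm V ** cnjm L) ** cnjm N)" by (rule trace_mul_sym)
  also have "(W ** U ** W ** cnjm V ** cnjm L) ** cnjm N = W ** U ** W ** cnjm V ** (cnjm L **
      cnjm N)"
    by (simp add: matrix_mul_assoc)
  finally show ?thesis
    by (simp add: siegel_metric_def Let_def NL W_def W'_def)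
qed

section \<open>Tangent vectors under the action\<close>

lemma tendsto_vec_iff: "(f \<longlongrightarrow> l) F \<longleftrightarrow> (\<forall>i. ((\<lambda>x. f x $ i) \<longlongrightarrow> l $ i) F)"
  by (auto intro: tendsto_vec_nth vec_tendstoI)

lemma tendsto_matrix_mult:
  fixes f g :: "'b \<Rightarrow> complex^2^2"
  assumes "(f \<longlongrightarrow> A) F" "(g \<longlongrightarrow> B) F"
  shows "((\<lambda>x. f x ** g x) \<longlongrightarrow> A ** B) F"
  unfolding tendsto_vec_iff matrix_matrix_mult_2
  by (intro allI tendsto_intros assms)

lemma has_vector_derivative_matrix_iff:
  fixes f :: "real \<Rightarrow> complex^2^2"
  shows "(f has_vector_derivative U) (at 0) \<longleftrightarrow> ((\<lambda>t. (1 / t) *\<^sub>R (f t - f 0)) \<longlongrightarrow> U) (at 0)"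
    and "(f has_vector_derivative U) (at 0) \<longleftrightarrow>
      (\<forall>i j. ((\<lambda>t. f t $ i $ j) has_vector_derivative U $ i $ j) (at 0))"
proof -
  show 1: "(f has_vector_derivative U) (at 0) \<longleftrightarrow>
      (\<forall>i j. ((\<lambda>t. f t $ i $ j) has_vector_derivative U $ i $ j) (at 0))"
    by (simp add: has_vector_derivative_def has_derivative_def tendsto_vec_iff
        bounded_linear_scaleR_left)
  have "((\<lambda>t. h t) has_vector_derivative u) (at 0) \<longleftrightarrow> ((\<lambda>t. (1 / t) *\<^sub>R (h t - h 0)) \<longlongrightarrow> u) (at 0)"
    for h :: "real \<Rightarrow> complex" and u
    by (simp add: has_vector_derivative_complex_iff DERIV_def tendsto_complex_iff divide_inverse
        mult.commute)
  thus "(f has_vector_derivative U) (at 0) \<longleftrightarrow> ((\<lambda>t. (1 / t) *\<^sub>R (f t - f 0)) \<longlongrightarrow> U) (at 0)"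
    unfolding 1 tendsto_vec_iff by simp
qed

lemma matrix_inv_2:
  fixes M :: "complex^2^2"
  assumes "invertible M"
  shows "matrix_inv M = vector [vector [M $ 2 $ 2 / det M, - M $ 1 $ 2 / det M],
                                vector [- M $ 2 $ 1 / det M, M $ 1 $ 1 / det M]]"
proof (rule matrix_inv_eq)
  have "det M \<noteq> 0" using assms by (simp add: invertible_det_nz)
  thus "M ** vector [vector [M $ 2 $ 2 / det M, - M $ 1 $ 2 / det M],
                     vector [- M $ 2 $ 1 / det M, M $ 1 $ 1 / det M]] = mat 1"
    by (simp add: mat2_eq field_simps) (simp add: det_2 algebra_simps)
qed

lemma tendsto_matrix_inv:
  fixes f :: "'b \<Rightarrow> complex^2^2"
  assumes "(f \<longlongrightarrow> A) F" "\<forall>\<^sub>F x in F. invertible (f x)" "invertible A"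
  shows "((\<lambda>x. matrix_inv (f x)) \<longlongrightarrow> matrix_inv A) F"
proof (rule Lim_transform_eventually)
  let ?inv = "\<lambda>M :: complex^2^2. vector [vector [M $ 2 $ 2 / det M, - M $ 1 $ 2 / det M],
    vector [- M $ 2 $ 1 / det M, M $ 1 $ 1 / det M]] :: complex^2^2"
  have "det A \<noteq> 0" using assms(3) by (simp add: invertible_det_nz)
  moreover have "((\<lambda>x. det (f x)) \<longlongrightarrow> det A) F"
    unfolding det_2 by (intro tendsto_intros assms(1))
  ultimately show "((\<lambda>x. ?inv (f x)) \<longlongrightarrow> matrix_inv A) F"
    unfolding matrix_inv_2[OF assms(3)] tendsto_vec_iff forall_2 vector_2
    by (intro conjI tendsto_intros assms(1)) auto
  show "\<forall>\<^sub>F x in F. ?inv (f x) = matrix_inv (f x)"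
    using assms(2) by eventually_elim (rule matrix_inv_2[symmetric])
qed

text \<open>The exact difference formula, divided by t, converges once the inverse denominators do.
  Hence no inverse has to be differentiated, and continuity suffices.\<close>

lemma tangent_to_moebius:
  assumes g: "g \<in> Sp4" and S: "S \<subseteq> siegel" and U: "tangent_to S Z U"
  defines "L \<equiv> matrix_inv (denom g Z)"
  shows "tangent_to (moebius g ` S) (moebius g Z) (transpose L ** U ** L)"
proof -
  obtain \<gamma> \<epsilon> where \<gamma>: "\<epsilon> > 0" "\<And>t::real. \<bar>t\<bar> < \<epsilon> \<Longrightarrow> \<gamma> t \<in> S" "\<gamma> 0 = Z"
    "(\<gamma> has_vector_derivative U) (at 0)"
    using U unfolding tangent_to_def by blast
  have Z: "Z \<in> siegel" using \<gamma>(1,2,3) S by force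
  have inv: "invertible (denom g Z)" using g Z by (rule denom_invertible)
  have ev: "\<forall>\<^sub>F t in at 0. \<gamma> t \<in> siegel"
    using \<gamma>(1,2) S unfolding eventually_at by (intro exI[of _ \<epsilon>]) auto
  have "isCont \<gamma> 0" using \<gamma>(4) by (rule has_vector_derivative_continuous)
  hence lim\<gamma>: "(\<gamma> \<longlongrightarrow> Z) (at 0)" using \<gamma>(3) by (simp add: isCont_def)
  have "((\<lambda>t. denom g (\<gamma> t)) \<longlongrightarrow> denom g Z) (at 0)"
    unfolding denom_def by (intro tendsto_add tendsto_matrix_mult tendsto_const lim\<gamma>)
  hence limN: "((\<lambda>t. matrix_inv (denom g (\<gamma> t))) \<longlongrightarrow> L) (at 0)"
    unfolding L_def
    by (rule tendsto_matrix_inv) (use ev in eventually_elim, auto intro: denom_invertible g inv)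
  have diff: "moebius g W - moebius g Z = transpose L ** (W - Z) ** matrix_inv (denom g W)"
    if "W \<in> siegel" for W
  proof -
    let ?K = "matrix_inv (denom g W)"
    have KW: "denom g W ** ?K = mat 1" using invertible_matrix_inv denom_invertible g that by blast
    have LN: "transpose L ** transpose (denom g Z) = mat 1"
      unfolding L_def using invertible_matrix_inv[OF inv] by (simp flip: matrix_transpose_mul)
    have "transpose (denom g Z) ** (moebius g Z - moebius g W) ** denom g W = Z - W"
      by (rule moebius_difference[OF g Z moebius_graph[OF g that]])
    hence "transpose L ** (Z - W) ** ?K = transpose L ** (transpose (denom g Z) ** (moebius g Z -
        moebius g W) ** denom g W) ** ?K"
      by simp
    also have "\<dots> = (transpose L ** transpose (denom g Z)) ** (moebius g Z - moebius g W) ** (denom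
        g W ** ?K)"
      by (simp only: matrix_mul_assoc)
    finally have e: "transpose L ** (Z - W) ** ?K = moebius g Z - moebius g W"
      unfolding KW LN by simp
    have "transpose L ** (W - Z) ** ?K = - (transpose L ** (Z - W) ** ?K)"
      by (simp add: matrix_mult_diff)
    thus ?thesis unfolding e by simp
  qed
  have "((\<lambda>t. transpose L ** ((1 / t) *\<^sub>R (\<gamma> t - \<gamma> 0)) ** matrix_inv (denom g (\<gamma> t))) \<longlongrightarrow> transpose
      L ** U ** L) (at 0)"
    using \<gamma>(4) unfolding has_vector_derivative_matrix_iff(1)
    by (intro tendsto_matrix_mult tendsto_const limN)
  hence "((\<lambda>t. (1 / t) *\<^sub>R (moebius g (\<gamma> t) - moebius g (\<gamma> 0))) \<longlongrightarrow> transpose L ** U ** L) (at 0)"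
  proof (rule Lim_transform_eventually)
    have sc: "A ** (r *\<^sub>R B) ** C = r *\<^sub>R (A ** B ** C)" for A B C :: "complex^2^2" and r
      by (simp add: mat2_eq algebra_simps)
    show "\<forall>\<^sub>F t in at 0. transpose L ** ((1 / t) *\<^sub>R (\<gamma> t - \<gamma> 0)) ** matrix_inv (denom g (\<gamma> t)) =
       (1 / t) *\<^sub>R (moebius g (\<gamma> t) - moebius g (\<gamma> 0))"
      using ev by eventually_elim (simp only: sc \<gamma>(3) diff)
  qed
  hence "((\<lambda>t. moebius g (\<gamma> t)) has_vector_derivative transpose L ** U ** L) (at 0)"
    unfolding has_vector_derivative_matrix_iff(1) .
  thus ?thesis
    unfolding tangent_to_def using \<gamma>(1-3)
    by (intro exI[of _ "\<lambda>t. moebius g (\<gamma> t)"] exI[of _ \<epsilon>]) auto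
qed

lemma moebius_image_inv:
  assumes "g \<in> Sp4" "S \<subseteq> siegel" shows "moebius (matrix_inv g) ` moebius g ` S = S"
proof -
  have "moebius (matrix_inv g) ` moebius g ` S = (\<lambda>Z. Z) ` S"
    unfolding image_image by (rule image_cong[OF refl]) (use assms moebius_inv in auto)
  thus ?thesis by simp
qed

lemma orthogonal_moebius:
  assumes g: "g \<in> Sp4" and ST: "S \<subseteq> siegel" "T \<subseteq> siegel" and orth: "orthogonal_in_siegel S T"
  shows "orthogonal_in_siegel (moebius g ` S) (moebius g ` T)"
  unfolding orthogonal_in_siegel_def
proof (intro conjI ballI allI impI)
  show "moebius g ` S \<inter> moebius g ` T \<noteq> {}" using orth unfolding orthogonal_in_siegel_def by blast
  fix Z U V
  assume Z: "Z \<in> moebius g ` S \<inter> moebius g ` T"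
    and UV: "tangent_to (moebius g ` S) Z U" "tangent_to (moebius g ` T) Z V"
  let ?h = "matrix_inv g"
  have h: "?h \<in> Sp4" using g by (rule Sp4_inv)
  have sub: "moebius g ` S \<subseteq> siegel" "moebius g ` T \<subseteq> siegel"
    using ST g moebius_siegel by blast+
  have "moebius ?h Z \<in> moebius ?h ` moebius g ` S" "moebius ?h Z \<in> moebius ?h ` moebius g ` T"
    using Z by blast+
  hence Z': "moebius ?h Z \<in> S \<inter> T" using moebius_image_inv[OF g] ST by simp
  let ?L = "matrix_inv (denom ?h Z)"
  have "tangent_to S (moebius ?h Z) (transpose ?L ** U ** ?L)"
    "tangent_to T (moebius ?h Z) (transpose ?L ** V ** ?L)"
    using tangent_to_moebius[OF h sub(1) UV(1)] tangent_to_moebius[OF h sub(2) UV(2)]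
    by (simp_all add: moebius_image_inv g ST)
  hence "siegel_metric (moebius ?h Z) (transpose ?L ** U ** ?L) (transpose ?L ** V ** ?L) = 0"
    using orth Z' unfolding orthogonal_in_siegel_def by blast
  thus "siegel_metric Z U V = 0"
    using siegel_metric_moebius[OF h, of Z U V] Z sub by auto
qed

lemma orthogonal_tube_act:
  assumes "g \<in> Sp4" "a \<in> lags" "b \<in> lags" "c \<in> lags" "d \<in> lags"
  shows "orthogonal_in_siegel (tube (act g a) (act g b)) (tube (act g c) (act g d)) \<longleftrightarrow>
    orthogonal_in_siegel (tube a b) (tube c d)"
proof
  assume "orthogonal_in_siegel (tube a b) (tube c d)"
  thus "orthogonal_in_siegel (tube (act g a) (act g b)) (tube (act g c) (act g d))"
    unfolding tube_act[OF assms(1-3), symmetric] tube_act[OF assms(1,4,5), symmetric]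
    by (rule orthogonal_moebius[OF assms(1) tube_subset_siegel tube_subset_siegel])
next
  assume "orthogonal_in_siegel (tube (act g a) (act g b)) (tube (act g c) (act g d))"
  hence "orthogonal_in_siegel (moebius (matrix_inv g) ` tube (act g a) (act g b))
      (moebius (matrix_inv g) ` tube (act g c) (act g d))"
    by (rule orthogonal_moebius[OF Sp4_inv[OF assms(1)] tube_subset_siegel tube_subset_siegel])
  thus "orthogonal_in_siegel (tube a b) (tube c d)"
    by (simp only: tube_act[OF Sp4_inv[OF assms(1)]] lags_act assms act_inv)
qed

section \<open>Orthogonal tubes have harmonic endpoints\<close>

lemma tangent_to_linear_constraint:
  assumes U: "tangent_to S Z U" and f: "bounded_linear f" "\<And>W. W \<in> S \<Longrightarrow> f W = (0 :: real)"
  shows "f U = 0"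
proof -
  obtain \<gamma> \<epsilon> where \<gamma>: "\<epsilon> > 0" "\<And>t::real. \<bar>t\<bar> < \<epsilon> \<Longrightarrow> \<gamma> t \<in> S"
    "(\<gamma> has_vector_derivative U) (at 0)"
    using U unfolding tangent_to_def by blast
  have "((\<lambda>t. f (\<gamma> t)) has_vector_derivative f U) (at 0)"
    by (rule bounded_linear.has_vector_derivative[OF f(1) \<gamma>(3)])
  moreover have "((\<lambda>t. f (\<gamma> t)) has_vector_derivative 0) (at 0)"
  proof (rule has_vector_derivative_transform_within)
    show "((\<lambda>t. 0) has_vector_derivative 0) (at 0)" by (rule has_vector_derivative_const)
    show "0 = f (\<gamma> t)" if "dist t 0 < \<epsilon>" for t using that f(2) \<gamma>(2) by (simp add: dist_real_def)
  qed (use \<gamma>(1) in auto)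
  ultimately show ?thesis by (rule vector_derivative_unique_at)
qed

lemma tangent_to_imaginary_tube:
  assumes "tangent_to (tube infty_lag (mat_lag 0)) Z U" shows "map_matrix Re U = 0"
proof -
  have "Re (U $ i $ j) = 0" for i j
  proof (rule tangent_to_linear_constraint[OF assms, of "\<lambda>W. Re (W $ i $ j)"])
    show "bounded_linear (\<lambda>W :: complex^2^2. Re (W $ i $ j))"
      using bounded_linear_Re[THEN bounded_linear_compose, of "\<lambda>W. W $ i $ j"]
        bounded_linear_compose[OF bounded_linear_vec_nth bounded_linear_vec_nth] by blast
    show "Re (W $ i $ j) = 0" if "W \<in> tube infty_lag (mat_lag 0)" for W
      using that by (auto simp: tube_infty_0)
  qed
  thus ?thesis by (simp add: vec_eq_iff)
qed

text \<open>The tubes meet only in i Id. A quarter turn fixes this point, carries one tube to the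
  other and has a multiple of i as derivative there, so tangent vectors are imaginary for one tube
  and real for the other.\<close>

lemma orthogonal_standard_tubes:
  "orthogonal_in_siegel (tube infty_lag (mat_lag 0)) (tube (mat_lag (- mat 1)) (mat_lag (mat 1)))"
proof -
  define s where "s = 1 / sqrt (2 :: real)"
  \<comment> \<open>The quarter turn is \<open>k\<close> below, and \<open>k'\<close> is its
    inverse.\<close>
  have s: "s * s = 1 / 2" "s > 0" by (simp_all add: s_def)
  define k where "k = diag_sp s s (-s) s s s (-s) s"
  define k' where "k' = diag_sp s (-s) s s s (-s) s s"
  have k: "k \<in> Sp4" "k' \<in> Sp4" unfolding k_def k'_def using s by (auto intro!: diag_sp_Sp4)
  have actk: "act k infty_lag = mat_lag (- mat 1)" "act k (mat_lag 0) = mat_lag (mat 1)"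
    "act k' (mat_lag (- mat 1)) = infty_lag" "act k' (mat_lag (mat 1)) = mat_lag 0"
    using s unfolding k_def k'_def diag2_one diag2_uminus diag2_zero
    by (simp_all add: diag_sp_infty diag_sp_mat_lag diag_sp_mat_infty)
  have sym: "sym_mat (- mat 1)" by (simp add: sym_mat_2)
  note lag = mat_lag_in_lags[OF sym] mat_lag_in_lags[OF sym_1]
  let ?I = "tube infty_lag (mat_lag 0)" and ?T = "tube (mat_lag (- mat 1)) (mat_lag (mat 1 ::
      real^2^2))"
  let ?i = "complex_mat 0 (mat 1)"
  have T: "moebius k ` ?I = ?T" using tube_act[OF k(1), of infty_lag "mat_lag 0"] by (simp add:
      actk)
  have T': "moebius k' ` ?T = ?I" using tube_act[OF k(2) lag] by (simp only: actk)
  have iI: "?i \<in> ?I" unfolding tube_infty_0 by auto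
  have iS: "?i \<in> siegel" using iI tube_subset_siegel by blast
  have ki: "moebius k ?i = ?i"
    unfolding k_def diag_sp_def
    by (rule moebius_eqI[OF k(1)[unfolded k_def diag_sp_def] iS])
      (simp add: mat2_eq complex_eq_iff)
  have "?i \<in> ?T" using iI ki T by (metis imageI)
  have only_i: "Z = ?i" if Z: "Z \<in> ?I" "Z \<in> ?T" for Z
  proof -
    obtain Y where Y: "Z = complex_mat 0 Y" "posdef_mat Y" using Z(1) unfolding tube_infty_0 by
        blast
    have "moebius k' Z \<in> ?I" using Z(2) T' by blast
    then obtain X where X: "moebius k' Z = complex_mat 0 X" "posdef_mat X" unfolding tube_infty_0
        by blast
    \<comment> \<open>Its imaginary part gives X = Y, its real part X Y = Id; uniqueness of positive
      square roots then leaves Y = Id.\<close>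
    have E: "complex_mat 0 X ** (cmat (diag2 s s) ** Z + cmat (diag2 s s)) = cmat (diag2 s s) ** Z
        + cmat (diag2 (-s) (-s))"
      using moebius_denom[OF k(2)[unfolded k'_def diag_sp_def], of Z] Z(1) tube_subset_siegel X(1)
      unfolding k'_def diag_sp_def by auto
    hence XY: "X = Y"
      using s(2) unfolding Y(1) by (auto simp: mat2_eq complex_eq_iff)
    have "s * (Y ** Y) $ i $ j = s * (mat 1 ** mat 1 :: real^2^2) $ i $ j" for i j
      using E[unfolded XY Y(1)] exhaust_2[of i] exhaust_2[of j]
      by (auto simp: mat2_eq complex_eq_iff algebra_simps)
    hence "Y ** Y = mat 1 ** mat 1" using s(2) by (simp add: vec_eq_iff)
    hence "Y = mat 1" using posdef_sqrt_unique[OF Y(2) posdef_one] by simp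
    thus ?thesis using Y by simp
  qed
  show ?thesis
    unfolding orthogonal_in_siegel_def
  proof (intro conjI ballI allI impI)
    show "?I \<inter> ?T \<noteq> {}" using iI \<open>?i \<in> ?T\<close> by blast
    fix Z U V assume Z: "Z \<in> ?I \<inter> ?T" and U: "tangent_to ?I Z U" and V: "tangent_to ?T Z V"
    have Zi: "Z = ?i" using Z only_i by blast
    have ReU: "Re (U $ i $ j) = 0" for i j
      using tangent_to_imaginary_tube[OF U] by (simp add: vec_eq_iff)
    \<comment> \<open>Inverse of the denominator s i + s of \<open>k'\<close> at i. The derivative
      there is multiplication by the square of this number, which is -i.\<close>
    let ?c = "1 / (of_real s * (1 + \<i>))"
    have N: "denom k' ?i = mat (of_real s * (1 + \<i>))"
      unfolding k'_def diag_sp_def denom_block by (simp add: mat2_eq complex_eq_iff)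
    have Ni: "matrix_inv (denom k' ?i) = mat ?c"
    proof -
      have "of_real s * (1 + \<i>) \<noteq> 0" using s(2) by (simp add: complex_eq_iff)
      moreover have "mat x ** mat y = (mat (x * y) :: complex^2^2)" for x y by (simp add: mat2_eq)
      ultimately show ?thesis unfolding N by (intro matrix_inv_eq) simp
    qed
    have c2: "?c * ?c = - \<i>"
    proof -
      have "?c * ?c = 1 / (of_real (s * s) * ((1 + \<i>) * (1 + \<i>)))" by (simp add: algebra_simps)
      also have "\<dots> = - \<i>" unfolding s(1) by (simp add: algebra_simps)
      finally show ?thesis .
    qed
    have "tangent_to ?I (moebius k' ?i) (transpose (mat ?c) ** V ** mat ?c)"
      using tangent_to_moebius[OF k(2) tube_subset_siegel V[unfolded Zi]] unfolding T' Ni .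
    hence "Re ((transpose (mat ?c) ** V ** mat ?c) $ i $ j) = 0" for i j
      using tangent_to_imaginary_tube by (simp add: vec_eq_iff)
    moreover have "transpose (mat ?c) ** V ** mat ?c = mat (- \<i>) ** V"
      unfolding c2[symmetric] by (simp add: mat2_eq algebra_simps transpose_mat)
    moreover have "(mat (- \<i>) ** V) $ i $ j = - \<i> * V $ i $ j" for i j
      using exhaust_2[of i] by (auto simp: matrix_matrix_mult_2)
    ultimately have ImV: "Im (V $ i $ j) = 0" for i j by simp
    have im: "map_matrix Im ?i = mat 1" by (simp add: vec_eq_iff)
    have mi: "matrix_inv (mat 1 :: real^2^2) = mat 1" by (rule matrix_inv_eq) simp
    show "siegel_metric Z U V = 0"
      unfolding Zi siegel_metric_def Let_def im mi
      by (simp add: trace_def sum_2 matrix_matrix_mult_2 ReU ImV)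
  qed
qed

lemma complexify_mat_lag:
  assumes "sym_mat X" shows "pv x y \<in> complexify (mat_lag X) \<longleftrightarrow> x = cmat X *v y"
proof -
  obtain a b where x: "x = cvec a + \<i> *s cvec b" by (rule cvec_cases)
  obtain c d where y: "y = cvec c + \<i> *s cvec d" by (rule cvec_cases)
  have e: "pv x y = cvec (pv a c) + \<i> *s cvec (pv b d)"
    unfolding x y by (rule vec_sum_eqI) simp_all
  have "x = cmat X *v y \<longleftrightarrow> a = X *v c \<and> b = X *v d"
    unfolding x y by (auto simp: matrix_vector_right_distrib matrix_vector_mult_scale
        cmat_mult_cvec vec_eq_iff complex_eq_iff)
  thus ?thesis unfolding e
    by (simp add: cvec_in_complexify_iff lags_subspace mat_lag_in_lags[OF assms])
qed

text \<open>In each diagonal entry this is the point with real part x on the half circle with ends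
  -1 and f, where f is p or q: its height squared is (f - x) (1 + x).\<close>

lemma diagonal_in_tube:
  assumes "p > 0" "q > 0" "- 1 < x" "x < p" "x < q"
  shows "complex_mat (diag2 x x) (diag2 (sqrt ((p - x) * (1 + x))) (sqrt ((q - x) * (1 + x))))
    \<in> tube (mat_lag (- mat 1)) (mat_lag (diag2 p q))" (is "?Z \<in> _")
proof -
  have sym: "sym_mat (- mat 1)" by (simp add: sym_mat_2)
  note lag = mat_lag_in_lags[OF sym] mat_lag_in_lags[OF diag2_sym[of p q]]
  define z where "z f = Complex x (sqrt ((f - x) * (1 + x)))" for f
  have Z: "?Z $ 1 $ 1 = z p" "?Z $ 1 $ 2 = 0" "?Z $ 2 $ 1 = 0" "?Z $ 2 $ 2 = z q"
    by (simp_all add: z_def complex_eq_iff)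
  have nz: "complex_of_real f - z f \<noteq> 0" if "x < f" for f
    using that by (simp add: z_def complex_eq_iff)
  \<comment> \<open>Thales: z sees the diameter from -1 to f under a right angle, so (1 + z) times
    the conjugate of z - f is purely imaginary.\<close>
  have circle: "(1 + z f) * (cnj (z f) - of_real f) = (1 + cnj (z f)) * (of_real f - z f)" if "x <
      f" for f
  proof -
    have "sqrt ((f - x) * (1 + x)) * sqrt ((f - x) * (1 + x)) = (f - x) * (1 + x)"
      using that assms by simp
    thus ?thesis by (simp add: z_def complex_eq_iff algebra_simps)
  qed
  show ?thesis
    unfolding tube_iff[OF lag]
  proof (intro conjI ballI)
    have "posdef_mat (diag2 (sqrt ((p - x) * (1 + x))) (sqrt ((q - x) * (1 + x))))"
      using assms by simp
    thus "?Z \<in> siegel" unfolding siegel_def using diag2_sym by blast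
    fix v assume v: "v \<in> complexify (mat_lag (- mat 1 :: real^2^2))"
    obtain a y where ay: "v = pv a y" by (rule pv_cases)
    have "a = cmat (- mat 1) *v y" using v unfolding ay complexify_mat_lag[OF sym] .
    hence a: "a $ 1 = - y $ 1" "a $ 2 = - y $ 2" by (simp_all add: matrix_vector_mult_2)
    \<comment> \<open>Solves f s - y = z (y + s) in each coordinate, which is the condition that v +
      w lies on the graph.\<close>
    define s :: "complex^2" where "s = vector [y $ 1 * (1 + z p) / (of_real p - z p), y $ 2 * (1 +
        z q) / (of_real q - z q)]"
    define w where "w = pv (cmat (diag2 p q) *v s) s"
    have eq1: "of_real f * (u * (1 + z f) / (of_real f - z f)) - u = z f * (u + u * (1 + z f) /
        (of_real f - z f))"
      if "x < f" for f u
      using nz[OF that] by (simp add: field_simps)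
    have eq2: "- u - of_real f * (u * (1 + z f) / (of_real f - z f)) = cnj (z f) * (u - u * (1 + z
        f) / (of_real f - z f))"
      if "x < f" for f u
    proof -
      have "u * (1 + z f) / (of_real f - z f) * (cnj (z f) - of_real f) = u * (1 + cnj (z f))"
      proof -
        have "u * (1 + z f) / (of_real f - z f) * (cnj (z f) - of_real f)
          = u * ((1 + z f) * (cnj (z f) - of_real f)) / (of_real f - z f)" by (simp add: mult.assoc)
        thus ?thesis unfolding circle[OF that] using nz[OF that] by simp
      qed
      thus ?thesis by (simp only: right_diff_distrib) (simp add: algebra_simps)
    qed
    have s: "s $ 1 = y $ 1 * (1 + z p) / (of_real p - z p)" "s $ 2 = y $ 2 * (1 + z q) / (of_real
        q - z q)"
      by (simp_all add: s_def)
    have "w \<in> complexify (mat_lag (diag2 p q))"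
      unfolding w_def complexify_mat_lag[OF diag2_sym] ..
    moreover have "v + w \<in> mat_lag ?Z"
      unfolding w_def ay pv_add pv_in_mat_lag vec_eq_iff forall_2 matrix_vector_mult_2 Z
      using eq1[of p "y $ 1"] eq1[of q "y $ 2"] assms by (simp add: matrix_vector_mult_2 a flip: s)
    moreover have "v - w \<in> conj_lag (mat_lag ?Z)"
    proof -
      have "(a $ 1 - of_real p * s $ 1) = cnj (z p) * (y $ 1 - s $ 1)"
        "(a $ 2 - of_real q * s $ 2) = cnj (z q) * (y $ 2 - s $ 2)"
        unfolding s a using eq2[of p "y $ 1"] eq2[of q "y $ 2"] assms by simp_all
      hence "cnj (a $ 1 - of_real p * s $ 1) = z p * cnj (y $ 1 - s $ 1)"
        "cnj (a $ 2 - of_real q * s $ 2) = z q * cnj (y $ 2 - s $ 2)"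
        by (metis complex_cnj_cnj complex_cnj_mult)+
      thus ?thesis
        unfolding w_def ay pv_diff in_conj_lag cnjv_pv pv_in_mat_lag vec_eq_iff forall_2
            matrix_vector_mult_2 Z
        by (simp add: matrix_vector_mult_2)
    qed
    ultimately show "\<exists>w\<in>complexify (mat_lag (diag2 p q)). v + w \<in> mat_lag ?Z \<and> v - w \<in> conj_lag
        (mat_lag ?Z)"
      by blast
  qed
qed

text \<open>Along the diagonal the tubes are products of hyperbolic geodesics, and a half circle meets
  the imaginary axis orthogonally only if its endpoints are opposite.\<close>

lemma orthogonal_diagonal:
  assumes pq: "p > 0" "q > 0"
    and orth: "orthogonal_in_siegel (tube infty_lag (mat_lag 0)) (tube (mat_lag (- mat 1))
        (mat_lag (diag2 p q)))"
  shows "p = 1 \<and> q = 1"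
proof -
  let ?I = "tube infty_lag (mat_lag 0)" and ?T = "tube (mat_lag (- mat 1)) (mat_lag (diag2 p q))"
  define y where "y f x = sqrt ((f - x) * (1 + x))" for f x :: real
  define Z where "Z = complex_mat 0 (diag2 (sqrt p) (sqrt q))"
  define \<gamma> where "\<gamma> x = complex_mat (diag2 x x) (diag2 (y p x) (y q x))" for x
  \<comment> \<open>Velocity of \<gamma> at 0: the real part moves with speed 1, and the height has
    derivative (f - 1) / (2 sqrt f), which vanishes only for f = 1.\<close>
  define V where "V = complex_mat (mat 1) (diag2 ((p - 1) / (2 * sqrt p)) ((q - 1) / (2 * sqrt q)))"
  define \<epsilon> where "\<epsilon> = min 1 (min p q)"
  have \<epsilon>: "\<epsilon> > 0" using pq by (simp add: \<epsilon>_def)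
  have \<gamma>T: "\<gamma> t \<in> ?T" if "\<bar>t\<bar> < \<epsilon>" for t
    unfolding \<gamma>_def y_def by (rule diagonal_in_tube) (use that pq in \<open>auto simp: \<epsilon>_def\<close>)
  have \<gamma>0: "\<gamma> 0 = Z" by (simp add: \<gamma>_def Z_def y_def diag2_zero)
  have dy: "(y f has_field_derivative (f - 1) / (2 * sqrt f)) (at 0)" if "f > 0" for f
    unfolding y_def using that
    by (auto intro!: derivative_eq_intros simp: field_simps)
  have "(\<gamma> has_vector_derivative V) (at 0)"
    unfolding has_vector_derivative_matrix_iff(2) forall_2 has_vector_derivative_complex_iff \<gamma>_def
        V_def
    using dy[OF pq(1)] dy[OF pq(2)] by simp
  hence TV: "tangent_to ?T Z V"
    unfolding tangent_to_def using \<epsilon> \<gamma>T \<gamma>0 by blast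
  have ZT: "Z \<in> ?T" using \<gamma>T[of 0] \<epsilon> \<gamma>0 by simp
  have ZI: "Z \<in> ?I" unfolding tube_infty_0 Z_def using pq by auto
  have TU: "tangent_to ?I Z (complex_mat 0 (diag2 a b))" for a b
    unfolding tangent_to_def
  proof (intro exI conjI)
    \<comment> \<open>Keeps both diagonal entries positive for |t| < d; the summand 1 makes the
      denominator positive also when a = b = 0.\<close>
    define d where "d = min (sqrt p) (sqrt q) / (1 + \<bar>a\<bar> + \<bar>b\<bar>)"
    let ?\<eta> = "\<lambda>t. complex_mat 0 (diag2 (sqrt p + t * a) (sqrt q + t * b))"
    show "d > 0" using pq by (simp add: d_def add_pos_nonneg)
    show "\<forall>t. \<bar>t\<bar> < d \<longrightarrow> ?\<eta> t \<in> ?I"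
    proof (intro allI impI)
      fix t :: real assume "\<bar>t\<bar> < d"
      hence 1: "\<bar>t\<bar> * (1 + \<bar>a\<bar> + \<bar>b\<bar>) < min (sqrt p) (sqrt q)"
        unfolding d_def by (subst (asm) pos_less_divide_eq) auto
      have "\<bar>t * a\<bar> \<le> \<bar>t\<bar> * (1 + \<bar>a\<bar> + \<bar>b\<bar>)" "\<bar>t * b\<bar> \<le> \<bar>t\<bar> * (1 + \<bar>a\<bar> + \<bar>b\<bar>)"
        unfolding abs_mult by (intro mult_left_mono; simp)+
      hence "\<bar>t * a\<bar> < sqrt p" "\<bar>t * b\<bar> < sqrt q" using 1 by auto
      thus "?\<eta> t \<in> ?I" unfolding tube_infty_0 by (auto simp: abs_less_iff)
    qed
    show "?\<eta> 0 = Z" by (simp add: Z_def)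
    show "(?\<eta> has_vector_derivative complex_mat 0 (diag2 a b)) (at 0)"
      unfolding has_vector_derivative_matrix_iff(2) forall_2 has_vector_derivative_complex_iff
      by (auto intro!: derivative_eq_intros)
  qed
  have m: "siegel_metric Z (complex_mat 0 (diag2 a b)) V = 0" for a b
    using orth ZT ZI TV TU unfolding orthogonal_in_siegel_def by blast
  have im: "map_matrix Im Z = diag2 (sqrt p) (sqrt q)" by (simp add: vec_eq_iff Z_def)
  have mi: "matrix_inv (diag2 (sqrt p) (sqrt q)) = diag2 (1 / sqrt p) (1 / sqrt q)"
    by (rule matrix_inv_eq) (use pq in \<open>simp add: diag2_mult diag2_one\<close>)
  have metric: "siegel_metric Z (complex_mat 0 (diag2 a b)) V =
      a * (p - 1) / (2 * sqrt p * \<bar>p\<bar>) + b * (q - 1) / (2 * sqrt q * \<bar>q\<bar>)" for a b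
    unfolding siegel_metric_def Let_def im mi V_def
    by (simp add: trace_def sum_2 matrix_matrix_mult_2)
  show ?thesis
    using m[of 1 0] m[of 0 1] pq unfolding metric by simp
qed

text \<open>Both sides are invariant, so (a, c, b) may be put at (infinity, -Id, 0). Rotations fix
  these three, and one of them diagonalises d; what remains is the diagonal case.\<close>

theorem orthogonal_tubes_iff_harmonic:
  assumes M: "maximal_triple a c b" "maximal_triple a b d"
  shows "orthogonal_in_siegel (tube a b) (tube c d) \<longleftrightarrow> harmonic a c b d"
proof
  assume "harmonic a c b d"
  then obtain g where g: "g \<in> Sp4" "a = act g infty_lag" "c = act g (mat_lag (- mat 1))"
    "b = act g (mat_lag 0)" "d = act g (mat_lag (mat 1))" unfolding harmonic_def by blast
  have "sym_mat (- mat 1)" by (simp add: sym_mat_2)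
  thus "orthogonal_in_siegel (tube a b) (tube c d)"
    unfolding g using orthogonal_tube_act[OF g(1)] orthogonal_standard_tubes
    by (simp add: mat_lag_in_lags)
next
  assume orth: "orthogonal_in_siegel (tube a b) (tube c d)"
  note lags = maximal_triple_lags[OF M(1)] maximal_triple_lags[OF M(2)]
  \<comment> \<open>The auxiliary d' completes (a, c, b) to a harmonic quadruple and thereby yields
    a map that normalises these three.\<close>
  obtain d' where "harmonic a c b d'" using M(1) by (rule harmonic_exists_4)
  then obtain h where h: "h \<in> Sp4" "a = act h infty_lag" "c = act h (mat_lag (- mat 1))"
    "b = act h (mat_lag 0)" unfolding harmonic_def by blast
  have "maximal_triple infty_lag (mat_lag 0) (act (matrix_inv h) d)"
    using maximal_triple_act[OF Sp4_inv[OF h(1)] M(2)] by (simp only: h act_inv[OF h(1)])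
  then obtain F where F: "posdef_mat F" "act (matrix_inv h) d = mat_lag F"
    by (auto simp: maximal_triple_infty_iff)
  obtain p q t where pq: "p > 0" "q > 0" "F = rot t ** diag2 p q ** transpose (rot t)"
    using posdef_diagonalize[OF F(1)] .
  define g where "g = h ** affine_sp (rot t) 0"
  have g: "g \<in> Sp4" unfolding g_def by (intro Sp4_mult h(1) affine_sp_Sp4 rot_invertible sym_0)
  have e: "a = act g infty_lag" "c = act g (mat_lag (- mat 1))" "b = act g (mat_lag 0)"
    "d = act g (mat_lag (diag2 p q))"
  proof -
    have r: "act (affine_sp (rot t) 0) infty_lag = infty_lag"
      "act (affine_sp (rot t) 0) (mat_lag (- mat 1)) = mat_lag (- mat 1)"
      "act (affine_sp (rot t) 0) (mat_lag 0) = mat_lag 0"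
      "act (affine_sp (rot t) 0) (mat_lag (diag2 p q)) = mat_lag F"
      by (simp_all add: affine_sp_infty affine_sp_mat_lag rot_invertible matrix_neg_mult pq)
    show "a = act g infty_lag" "c = act g (mat_lag (- mat 1))" "b = act g (mat_lag 0)"
      unfolding g_def act_act[symmetric] r h by (rule refl)+
    show "d = act g (mat_lag (diag2 p q))"
      unfolding g_def act_act[symmetric] r F(2)[symmetric] act_inv[OF h(1)] by (rule refl)
  qed
  have "sym_mat (- mat 1)" by (simp add: sym_mat_2)
  hence "orthogonal_in_siegel (tube infty_lag (mat_lag 0)) (tube (mat_lag (- mat 1)) (mat_lag
      (diag2 p q)))"
    using orth unfolding e by (subst (asm) orthogonal_tube_act[OF g]) (simp_all add:
        mat_lag_in_lags)
  hence "p = 1 \<and> q = 1" by (rule orthogonal_diagonal[OF pq(1,2)])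
  thus "harmonic a c b d"
    unfolding harmonic_def using g e by (intro bexI[of _ g]) (simp_all add: diag2_one)
qed

section \<open>Ordered hexagons and maximal 6-tuples\<close>

definition tubes :: "(nat \<Rightarrow> lag) \<Rightarrow> (nat \<Rightarrow> lag) \<Rightarrow> (complex^2^2) set list" where
  "tubes P Q = [tube (P 1) (P 2), tube (Q 1) (Q 2), tube (P 3) (P 4),
     tube (Q 3) (Q 4), tube (P 5) (P 6), tube (Q 5) (Q 6)]"

definition hexagon :: "(nat \<Rightarrow> lag) \<Rightarrow> (nat \<Rightarrow> lag) \<Rightarrow> ordered_hexagon" where
  "hexagon P Q = (cyclic_seq (tubes P Q), tube (P 1) (P 2))"

lemma all_less_6: "(\<forall>i<6. R i) \<longleftrightarrow> R 0 \<and> R 1 \<and> R 2 \<and> R 3 \<and> R 4 \<and> R (5 :: nat)"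
proof -
  have "{..<6} = {0, 1, 2, 3, 4, 5 :: nat}" by auto
  thus ?thesis by (metis (no_types, lifting) insert_iff lessThan_iff empty_iff)
qed

lemma hexagon_with_endpoints_iff:
  "hexagon_with_endpoints P Q Y \<longleftrightarrow> harmonic_hexagon P Q \<and> Y = tubes P Q"
proof (cases "maximal_tuple [P 1, Q 6, Q 1, P 2, P 3, Q 2, Q 3, P 4, P 5, Q 4, Q 5, P 6]")
  case True
  let ?M = maximal_triple
  note L = True[unfolded maximal_tuple_Cons, simplified]
  have three: "?M x y z" if "?M (P 1) x y" "?M (P 1) y z" for x y z
    using that by (rule maximal_triple_trans(2))
  note cyc = maximal_triple_cyc
  have m1: "?M (P 1) (Q 1) (P 2)" "?M (P 1) (P 2) (Q 2)" using L by auto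
  have m2: "?M (Q 1) (P 3) (Q 2)" "?M (Q 1) (Q 2) (P 4)" by (rule three; use L in simp)+
  have m3: "?M (P 3) (Q 3) (P 4)" "?M (P 3) (P 4) (Q 4)" by (rule three; use L in simp)+
  have m4: "?M (Q 3) (P 5) (Q 4)" "?M (Q 3) (Q 4) (P 6)" by (rule three; use L in simp)+
  have m5: "?M (P 5) (Q 5) (P 6)" by (rule three; use L in simp)
  \<comment> \<open>From here on the triples run past the base point P 1, so they are first turned
    cyclically.\<close>
  have m5': "?M (P 5) (P 6) (Q 6)" by (rule cyc, rule three; use L in simp)
  have m6: "?M (Q 5) (P 1) (Q 6)" by (rule cyc, rule cyc) (use L in simp)
  have m6': "?M (Q 5) (Q 6) (P 2)" by (rule cyc, rule cyc, rule three; use L in simp)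
  show ?thesis
    unfolding hexagon_with_endpoints_def harmonic_hexagon_def tubes_def
      orthogonal_tubes_iff_harmonic[OF m1, symmetric] orthogonal_tubes_iff_harmonic[OF m2,
          symmetric]
      orthogonal_tubes_iff_harmonic[OF m3, symmetric] orthogonal_tubes_iff_harmonic[OF m4,
          symmetric]
      orthogonal_tubes_iff_harmonic[OF m5 m5', symmetric] orthogonal_tubes_iff_harmonic[OF m6 m6',
          symmetric]
    using True by (auto simp: all_less_6 simp del: One_nat_def)
qed (simp add: hexagon_with_endpoints_def harmonic_hexagon_def)

lemma harmonic_hexagon_lags:
  assumes "harmonic_hexagon P Q" "i \<in> {1..6}" shows "P i \<in> lags" "Q i \<in> lags"
proof -
  have "\<forall>i\<in>{1..6}. P i \<in> lags \<and> Q i \<in> lags"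
    using assms(1) maximal_triple_lags unfolding harmonic_hexagon_def maximal_tuple_Cons ball_1_6
    by (auto simp del: One_nat_def)
  thus "P i \<in> lags" "Q i \<in> lags" using assms(2) by auto
qed

lemma harmonic_hexagon_act:
  assumes "g \<in> Sp4" "harmonic_hexagon P Q"
  shows "harmonic_hexagon (\<lambda>i. act g (P i)) (\<lambda>i. act g (Q i))"
  using assms(2) unfolding harmonic_hexagon_def maximal_tuple_Cons
  by (simp add: maximal_triple_act_iff assms(1) harmonic_act_iff del: One_nat_def)

lemma map_cyclic_seq: "map f ` cyclic_seq ys = cyclic_seq (map f ys)"
  unfolding cyclic_seq_def by (auto simp: rotate_map)

lemma act_hexagon_hexagon:
  assumes g: "g \<in> Sp4" and h: "harmonic_hexagon P Q"
  shows "act_hexagon g (hexagon P Q) = hexagon (\<lambda>i. act g (P i)) (\<lambda>i. act g (Q i))"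
  unfolding hexagon_def act_hexagon_def prod.case map_cyclic_seq tubes_def
  by (simp add: tube_act g harmonic_hexagon_lags[OF h] del: One_nat_def)

lemma ordered_hexagons_eq: "ordered_hexagons = {hexagon P Q | P Q. harmonic_hexagon P Q}"
  unfolding ordered_hexagons_def hexagon_with_endpoints_iff hexagon_def
  by (auto simp: tubes_def)

lemma hexagon_cong: "same_ends P Q P' Q' \<Longrightarrow> hexagon P Q = hexagon P' Q'"
  by (simp add: same_ends_def ball_1_6 hexagon_def tubes_def del: One_nat_def)

lemma hexagon_of_tuple_eq:
  assumes "harmonic_hexagon P Q"
  shows "hexagon_of_tuple (P 2, Q 2, P 4, P 5, Q 5, P 1) = hexagon P Q"
  unfolding hexagon_of_tuple_def
proof (rule the_equality)
  show "\<exists>P' Q' Y. hexagon_with_endpoints P' Q' Y \<and> hexagon P Q = (cyclic_seq Y, Y ! 0) \<and>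
      (P 2, Q 2, P 4, P 5, Q 5, P 1) = (P' 2, Q' 2, P' 4, P' 5, Q' 5, P' 1)"
    unfolding hexagon_with_endpoints_iff hexagon_def using assms
    by (intro exI[of _ P] exI[of _ Q] exI[of _ "tubes P Q"]) (simp add: tubes_def)
next
  fix h assume "\<exists>P' Q' Y. hexagon_with_endpoints P' Q' Y \<and> h = (cyclic_seq Y, Y ! 0) \<and>
      (P 2, Q 2, P 4, P 5, Q 5, P 1) = (P' 2, Q' 2, P' 4, P' 5, Q' 5, P' 1)"
  then obtain P' Q' where *: "harmonic_hexagon P' Q'" "h = hexagon P' Q'"
    "(P' 2, Q' 2, P' 4, P' 5, Q' 5, P' 1) = (P 2, Q 2, P 4, P 5, Q 5, P 1)"
    unfolding hexagon_with_endpoints_iff hexagon_def by (auto simp: tubes_def)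
  thus "h = hexagon P Q" using harmonic_hexagon_unique[OF *(1) assms *(3)] hexagon_cong by blast
qed

lemma maximal_triple_distinct:
  assumes "maximal_triple a b c" shows "a \<noteq> b" "a \<noteq> c" "b \<noteq> c"
  using assms maximal_triple_antisym maximal_triple_cyc by blast+

text \<open>P 1 is an end of none of the other five tubes, so the distinguished tube occurs once in
  the list and the rotation relating the two lists is trivial. Corresponding tubes then have equal
  unordered ends, and maximality orders them.\<close>

lemma hexagon_inject:
  assumes h: "harmonic_hexagon P Q" and h': "harmonic_hexagon P' Q'" and eq: "hexagon P Q =
      hexagon P' Q'"
  shows "same_ends P Q P' Q'"
proof -
  note m = h[unfolded harmonic_hexagon_def, THEN conjunct1] and m' = h'[unfolded
      harmonic_hexagon_def, THEN conjunct1]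
  note L = m[unfolded maximal_tuple_Cons, simplified]
  have ends: "{a, b} = {c, d}" if "maximal_triple a b x" "c \<in> lags" "d \<in> lags" "tube a b = tube c
      d" for a b c d x
    using that by (rule tube_determines_ends)
  have Y: "cyclic_seq (tubes P Q) = cyclic_seq (tubes P' Q')" "tube (P 1) (P 2) = tube (P' 1) (P'
      2)"
    using eq by (simp_all add: hexagon_def)
  have "tubes P' Q' \<in> cyclic_seq (tubes P' Q')" unfolding cyclic_seq_def
    by (rule CollectI, rule exI[of _ 0]) simp
  hence "tubes P' Q' \<in> cyclic_seq (tubes P Q)" using Y(1) by simp
  then obtain n where "tubes P' Q' = rotate n (tubes P Q)" unfolding cyclic_seq_def by blast
  hence n: "tubes P' Q' = rotate (n mod 6) (tubes P Q)"
    using rotate_conv_mod[of n "tubes P Q"] by (simp add: tubes_def)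
  have "tubes P Q ! (n mod 6) = tube (P 1) (P 2)"
  proof -
    have "rotate (n mod 6) (tubes P Q) ! 0 = tubes P Q ! (n mod 6)"
      by (subst nth_rotate) (simp_all add: tubes_def)
    thus ?thesis unfolding n[symmetric] using Y(2) by (simp add: tubes_def)
  qed
  moreover have "tubes P Q ! i \<noteq> tube (P 1) (P 2)" if "i \<in> {1, 2, 3, 4, 5}" for i
  proof
    assume e: "tubes P Q ! i = tube (P 1) (P 2)"
    have P12: "maximal_triple (P 1) (P 2) (P 3)" using L by simp
    have lg: "Q 1 \<in> lags" "Q 2 \<in> lags" "P 3 \<in> lags" "P 4 \<in> lags" "Q 3 \<in> lags" "Q 4 \<in> lags"
      "P 5 \<in> lags" "P 6 \<in> lags" "Q 5 \<in> lags" "Q 6 \<in> lags"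
      by (rule harmonic_hexagon_lags[OF h]; simp)+
    have "tube (P 1) (P 2) = tube (Q 1) (Q 2) \<or> tube (P 1) (P 2) = tube (P 3) (P 4) \<or>
      tube (P 1) (P 2) = tube (Q 3) (Q 4) \<or> tube (P 1) (P 2) = tube (P 5) (P 6) \<or>
      tube (P 1) (P 2) = tube (Q 5) (Q 6)"
      using that e[symmetric] unfolding tubes_def
      by (elim insertE emptyE) (simp_all only: nth_Cons_0 nth_Cons_Suc numeral_nat One_nat_def
          simp_thms)
    hence "{P 1, P 2} = {Q 1, Q 2} \<or> {P 1, P 2} = {P 3, P 4} \<or> {P 1, P 2} = {Q 3, Q 4} \<or>
      {P 1, P 2} = {P 5, P 6} \<or> {P 1, P 2} = {Q 5, Q 6}"
      using ends[OF P12 lg(1,2)] ends[OF P12 lg(3,4)] ends[OF P12 lg(5,6)]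
        ends[OF P12 lg(7,8)] ends[OF P12 lg(9,10)] by argo
    moreover have d: "x = a \<or> x = b" if "{x, y} = {a, b}" for x y a b :: lag
      using that by blast
    ultimately have "P 1 = Q 1 \<or> P 1 = Q 2 \<or> P 1 = P 3 \<or> P 1 = P 4 \<or> P 1 = Q 3 \<or> P 1 = Q 4 \<or>
      P 1 = P 5 \<or> P 1 = P 6 \<or> P 1 = Q 5 \<or> P 1 = Q 6"
      using d[of "P 1" "P 2" "Q 1" "Q 2"] d[of "P 1" "P 2" "P 3" "P 4"] d[of "P 1" "P 2" "Q 3" "Q
          4"]
        d[of "P 1" "P 2" "P 5" "P 6"] d[of "P 1" "P 2" "Q 5" "Q 6"] by argo
    moreover have "P 1 \<noteq> Q 1" "P 1 \<noteq> Q 2" "P 1 \<noteq> P 3" "P 1 \<noteq> P 4" "P 1 \<noteq> Q 3" "P 1 \<noteq> Q 4"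
      "P 1 \<noteq> P 5" "P 1 \<noteq> Q 5"
      by (rule maximal_triple_distinct(1)[of _ _ "P 6"], use L in simp)+
    moreover have "P 1 \<noteq> P 6" by (rule maximal_triple_distinct(2)[of _ "P 2"]) (use L in simp)
    moreover have "P 1 \<noteq> Q 6" by (rule maximal_triple_distinct(1)[of _ _ "P 2"]) (use L in simp)
    ultimately show False by argo
  qed
  ultimately have "n mod 6 \<notin> {1, 2, 3, 4, 5}" by blast
  moreover have "n mod 6 < 6" by simp
  ultimately have "n mod 6 = 0" by auto
  hence "tubes P Q = tubes P' Q'" using n by simp
  hence t: "tube (P 1) (P 2) = tube (P' 1) (P' 2)" "tube (Q 1) (Q 2) = tube (Q' 1) (Q' 2)"
    "tube (P 3) (P 4) = tube (P' 3) (P' 4)" "tube (Q 3) (Q 4) = tube (Q' 3) (Q' 4)"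
    "tube (P 5) (P 6) = tube (P' 5) (P' 6)" "tube (Q 5) (Q 6) = tube (Q' 5) (Q' 6)"
    by (simp_all add: tubes_def)
  note lag = harmonic_hexagon_lags[OF h']
  have three: "maximal_triple x y z" if "maximal_triple (P 1) x y" "maximal_triple (P 1) y z" for
      x y z
    using that by (rule maximal_triple_trans(2))
  have w: "maximal_triple x y (P 1)" if "maximal_triple (P 1) x y" for x y
    using that by (rule maximal_triple_cyc)
  show ?thesis
  proof (rule maximal_tuple_doubleton_unique[OF m m'])
    show "{P 1, P 2} = {P' 1, P' 2}" by (rule ends[OF _ _ _ t(1), of "P 3"]) (use L lag in auto)
    show "{Q 1, Q 2} = {Q' 1, Q' 2}" by (rule ends[OF w _ _ t(2)]) (use L lag in auto)
    show "{P 3, P 4} = {P' 3, P' 4}" by (rule ends[OF w _ _ t(3)]) (use L lag in auto)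
    show "{Q 3, Q 4} = {Q' 3, Q' 4}" by (rule ends[OF w _ _ t(4)]) (use L lag in auto)
    show "{P 5, P 6} = {P' 5, P' 6}" by (rule ends[OF w _ _ t(5)]) (use L lag in auto)
    have "maximal_triple (Q 5) (Q 6) (P 2)"
      by (rule maximal_triple_cyc, rule maximal_triple_cyc, rule three) (use L in auto)
    thus "{Q 5, Q 6} = {Q' 5, Q' 6}" by (rule ends[OF _ _ _ t(6)]) (use lag in auto)
  qed
qed

section \<open>Orbits of maximal 6-tuples\<close>

definition act6 :: "real^(2 + 2)^(2 + 2) \<Rightarrow> lag \<times> lag \<times> lag \<times> lag \<times> lag \<times> lag \<Rightarrow>
    lag \<times> lag \<times> lag \<times> lag \<times> lag \<times> lag" where
  "act6 g = (\<lambda>(a, b, c, d, e, f). (act g a, act g b, act g c, act g d, act g e, act g f))"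

text \<open>The last component is moved to the front, where it serves as base point; in the arc
  normal form it is infinity.\<close>

definition maximal6 :: "lag \<times> lag \<times> lag \<times> lag \<times> lag \<times> lag \<Rightarrow> bool" where
  "maximal6 = (\<lambda>(p2, q2, p4, p5, q5, p1). maximal_tuple [p1, p2, q2, p4, p5, q5])"

lemma maximal6_hexagon:
  assumes "maximal6 t"
  obtains P Q where "harmonic_hexagon P Q" "t = (P 2, Q 2, P 4, P 5, Q 5, P 1)" "hexagon_of_tuple
      t = hexagon P Q"
proof -
  obtain p2 q2 p4 p5 q5 p1 where t: "t = (p2, q2, p4, p5, q5, p1)" by (cases t)
  obtain P Q where PQ: "harmonic_hexagon P Q" "(P 2, Q 2, P 4, P 5, Q 5, P 1) = (p2, q2, p4, p5,
      q5, p1)"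
    using assms harmonic_hexagon_exists[of p1 p2 q2 p4 p5 q5] unfolding t maximal6_def by auto
  show ?thesis using that[OF PQ(1)] hexagon_of_tuple_eq[OF PQ(1)] unfolding t PQ(2)[symmetric] by
      blast
qed

lemma harmonic_hexagon_maximal6:
  "harmonic_hexagon P Q \<Longrightarrow> maximal6 (P 2, Q 2, P 4, P 5, Q 5, P 1)"
  by (simp add: harmonic_hexagon_def maximal6_def maximal_tuple_Cons del: One_nat_def)

lemma maximal6_ordered: "maximal6 t \<Longrightarrow> hexagon_of_tuple t \<in> ordered_hexagons"
  unfolding ordered_hexagons_eq by (elim maximal6_hexagon) auto

lemma ordered_hexagon_maximal6:
  assumes "h \<in> ordered_hexagons" obtains t where "maximal6 t" "h = hexagon_of_tuple t"
proof -
  obtain P Q where PQ: "harmonic_hexagon P Q" "h = hexagon P Q" using assms unfolding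
      ordered_hexagons_eq by blast
  show ?thesis using that[OF harmonic_hexagon_maximal6[OF PQ(1)]] hexagon_of_tuple_eq[OF PQ(1)]
      PQ(2) by simp
qed

lemma maximal6_act:
  assumes "g \<in> Sp4" "maximal6 t"
  shows "maximal6 (act6 g t)" "act_hexagon g (hexagon_of_tuple t) = hexagon_of_tuple (act6 g t)"
proof -
  obtain P Q where PQ: "harmonic_hexagon P Q" "t = (P 2, Q 2, P 4, P 5, Q 5, P 1)"
      "hexagon_of_tuple t = hexagon P Q"
    using assms(2) by (rule maximal6_hexagon)
  note h = harmonic_hexagon_act[OF assms(1) PQ(1)]
  show "maximal6 (act6 g t)" using harmonic_hexagon_maximal6[OF h] by (simp add: PQ(2) act6_def)
  show "act_hexagon g (hexagon_of_tuple t) = hexagon_of_tuple (act6 g t)"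
    using hexagon_of_tuple_eq[OF h]
    unfolding PQ(3) act_hexagon_hexagon[OF assms(1) PQ(1)] by (simp add: PQ(2) act6_def)
qed

lemma hexagon_of_tuple_inject:
  assumes "maximal6 t" "maximal6 t'" "hexagon_of_tuple t = hexagon_of_tuple t'" shows "t = t'"
proof -
  obtain P Q where PQ: "harmonic_hexagon P Q" "t = (P 2, Q 2, P 4, P 5, Q 5, P 1)"
      "hexagon_of_tuple t = hexagon P Q"
    using assms(1) by (rule maximal6_hexagon)
  obtain P' Q' where PQ': "harmonic_hexagon P' Q'" "t' = (P' 2, Q' 2, P' 4, P' 5, Q' 5, P' 1)"
    "hexagon_of_tuple t' = hexagon P' Q'"
    using assms(2) by (rule maximal6_hexagon)
  have "same_ends P Q P' Q'" using hexagon_inject[OF PQ(1) PQ'(1)] assms(3) PQ(3) PQ'(3) by simp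
  thus ?thesis by (simp add: PQ(2) PQ'(2) same_ends_def ball_1_6 del: One_nat_def)
qed

lemma act6_act6: "act6 g (act6 h t) = act6 (g ** h) t"
  by (cases t) (simp add: act6_def act_act)

lemma act6_one: "act6 (mat 1) t = t"
  by (cases t) (simp add: act6_def)

lemma act6_inv: "g \<in> Sp4 \<Longrightarrow> act6 (matrix_inv g) (act6 g t) = t"
  by (cases t) (simp only: act6_def prod.case act_inv)

lemma PSp4_orbit_eq: "PSp4_orbit h = {act_hexagon g h | g. g \<in> Sp4}"
proof -
  have "(\<exists>p\<in>PSp4. g \<in> p) \<longleftrightarrow> g \<in> Sp4" for g
    unfolding PSp4_def quotient_def by auto
  thus ?thesis unfolding PSp4_orbit_def by blast
qed

text \<open>Since \<open>hexagon_of_tuple\<close> is injective and equivariant on maximal tuples,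
  equality of orbits of hexagons becomes a question about six Lagrangians.\<close>

lemma PSp4_orbit_eq_iff:
  assumes "maximal6 t" "maximal6 t'"
  shows "PSp4_orbit (hexagon_of_tuple t) = PSp4_orbit (hexagon_of_tuple t') \<longleftrightarrow> (\<exists>g\<in>Sp4. t' = act6 g
      t)"
proof -
  have orb: "PSp4_orbit (hexagon_of_tuple t) = {hexagon_of_tuple (act6 g t) | g. g \<in> Sp4}" if
      "maximal6 t" for t
    unfolding PSp4_orbit_eq using maximal6_act(2)[OF _ that] by force
  show ?thesis
  proof
    assume "PSp4_orbit (hexagon_of_tuple t) = PSp4_orbit (hexagon_of_tuple t')"
    moreover have "hexagon_of_tuple t' \<in> PSp4_orbit (hexagon_of_tuple t')"
      unfolding orb[OF assms(2)] by (intro CollectI exI[of _ "mat 1"]) (simp add: act6_one)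
    ultimately obtain g where g: "g \<in> Sp4" "hexagon_of_tuple t' = hexagon_of_tuple (act6 g t)"
      using orb[OF assms(1)] by blast
    hence "t' = act6 g t" using hexagon_of_tuple_inject assms maximal6_act(1) by blast
    thus "\<exists>g\<in>Sp4. t' = act6 g t" using g by blast
  next
    assume "\<exists>g\<in>Sp4. t' = act6 g t"
    then obtain g where g: "g \<in> Sp4" "t' = act6 g t" by blast
    hence t: "t = act6 (matrix_inv g) t'" by (simp add: act6_inv)
    have sub: "{hexagon_of_tuple (act6 h (act6 g s)) | h. h \<in> Sp4} \<subseteq> {hexagon_of_tuple (act6 h s)
        | h. h \<in> Sp4}"
      if "g \<in> Sp4" for g s
      using that Sp4_mult unfolding act6_act6 by blast
    show "PSp4_orbit (hexagon_of_tuple t) = PSp4_orbit (hexagon_of_tuple t')"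
      unfolding orb[OF assms(1)] orb[OF assms(2)]
      using sub[OF g(1), of t] sub[OF Sp4_inv[OF g(1)], of t'] by (simp flip: g(2) t)
  qed
qed

section \<open>Arc coordinates\<close>

definition orth_mat :: "real^2^2 \<Rightarrow> bool" where
  "orth_mat K \<longleftrightarrow> K ** transpose K = mat 1"

abbreviation refl_mat :: "real^2^2" where
  "refl_mat \<equiv> diag2 1 (- 1)"

lemma orth_mat_left: "orth_mat K \<Longrightarrow> transpose K ** K = mat 1"
  unfolding orth_mat_def by (rule matrix_left_right_inverse[THEN iffD1])

lemma orth_mat_invertible: "orth_mat K \<Longrightarrow> invertible K"
  unfolding invertible_def using orth_mat_left orth_mat_def by blast

lemma orth_mat_rot [simp]: "orth_mat (rot t)"
  by (simp add: orth_mat_def)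

lemma orth_mat_mult:
  assumes "orth_mat K" "orth_mat L" shows "orth_mat (K ** L)"
proof -
  have "(K ** L) ** transpose (K ** L) = K ** (L ** transpose L) ** transpose K"
    by (simp add: matrix_transpose_mul matrix_mul_assoc)
  thus ?thesis using assms by (simp add: orth_mat_def)
qed

lemma orth_mat_refl [simp]: "orth_mat refl_mat"
  by (simp add: orth_mat_def diag2_transpose diag2_mult diag2_one)

lemma orth_mat_cases:
  assumes "orth_mat K"
  obtains t where "K = rot t" | t where "K = rot t ** refl_mat"
proof -
  have K: "K $ 1 $ 1 * K $ 1 $ 1 + K $ 2 $ 1 * K $ 2 $ 1 = 1"
    "K $ 1 $ 1 * K $ 1 $ 2 + K $ 2 $ 1 * K $ 2 $ 2 = 0"
    "K $ 1 $ 2 * K $ 1 $ 2 + K $ 2 $ 2 * K $ 2 $ 2 = 1"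
    using orth_mat_left[OF assms] by (simp_all add: mat2_eq)
  obtain t where t: "K $ 1 $ 1 = cos t" "K $ 2 $ 1 = sin t"
    using sincos_total_2pi[of "K $ 1 $ 1" "K $ 2 $ 1"] K(1) by (auto simp: power2_eq_square)
  \<comment> \<open>This is the determinant of K, which separates rotations from
    reflections.\<close>
  define d where "d = K $ 2 $ 2 * cos t - K $ 1 $ 2 * sin t"
  have cs: "cos t * cos t + sin t * sin t = 1" using K(1) t by simp
  have K12: "K $ 1 $ 2 = - d * sin t" and K22: "K $ 2 $ 2 = d * cos t" and "d * d = 1"
    unfolding d_def using K cs unfolding t by algebra+
  from \<open>d * d = 1\<close> have "d = 1 \<or> d = -1" using power2_eq_1_iff[of d] by (simp add: power2_eq_square)
  thus ?thesis
  proof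
    assume "d = 1" hence "K = rot t" using t K12 K22 by (simp add: mat2_eq)
    thus ?thesis using that by blast
  next
    assume "d = -1" hence "K = rot t ** refl_mat" using t K12 K22 by (simp add: mat2_eq)
    thus ?thesis using that by blast
  qed
qed

lemma rot_sym_polar: "rot t ** sym_polar p q a ** transpose (rot t) = sym_polar p q (a + 2 * t)"
proof -
  have "rot t ** sym_polar p q a ** transpose (rot t)
      = (rot t ** rot (a / 2)) ** diag2 p q ** (transpose (rot (a / 2)) ** transpose (rot t))"
    by (simp add: sym_polar_rot matrix_mul_assoc)
  also have "\<dots> = sym_polar p q (a + 2 * t)"
    unfolding matrix_transpose_mul[symmetric] rot_add sym_polar_rot by (simp add: field_simps)
  finally show ?thesis .
qed

lemma refl_sym_polar: "refl_mat ** sym_polar p q a ** transpose refl_mat = sym_polar p q (- a)"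
  by (simp add: mat2_eq)

lemma sym_polar_sym [simp]: "sym_mat (sym_polar p q a)"
  by (simp add: sym_mat_2)

lemma sym_polar_posdef [simp]: "posdef_mat (sym_polar p q a) \<longleftrightarrow> p > 0 \<and> q > 0"
  by (simp add: sym_polar_rot posdef_orth_conj)

lemma sym_polar_diff_1: "sym_polar p q a - mat 1 = sym_polar (p - 1) (q - 1) a"
  and one_diff_sym_polar: "mat 1 - sym_polar p q a = sym_polar (1 - p) (1 - q) a"
  by (simp_all add: mat2_eq field_simps)

lemma sym_polar_0: "sym_polar p q 0 = diag2 p q"
  by (simp add: mat2_eq field_simps)

lemma sym_polar_eq_iff: "sym_polar p q a = sym_polar p q a' \<longleftrightarrow> p = q \<or> [a = a'] (rmod (2 * pi))"
proof -
  have "[a = a'] (rmod (2 * pi)) \<longleftrightarrow> cos a = cos a' \<and> sin a = sin a'"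
    by (simp add: complex_eq_iff flip: cis_eq_iff)
  thus ?thesis by (auto simp: mat2_eq)
qed

text \<open>Orthogonal conjugation preserves trace and determinant, and an ordered pair of reals is
  determined by its sum and product.\<close>

lemma sym_polar_eigenvalues:
  assumes "orth_mat K" "p \<ge> q" "p' \<ge> q'"
    and eq: "sym_polar p' q' a' = K ** sym_polar p q a ** transpose K"
  shows "p' = p \<and> q' = q"
proof -
  have tr: "trace (sym_polar p q a) = p + q" and dt: "det (sym_polar p q a) = p * q" for p q a
  proof -
    show "trace (sym_polar p q a) = p + q" by (simp add: trace_def sum_2 field_simps)
    have "det (sym_polar p q a) = det (rot (a / 2)) * det (diag2 p q) * det (rot (a / 2))"
      by (simp add: sym_polar_rot det_mul det_transpose)
    moreover have "det (rot t) = 1" for t by (simp add: det_2 flip: power2_eq_square)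
    ultimately show "det (sym_polar p q a) = p * q" by (simp add: det_2)
  qed
  have "trace (K ** sym_polar p q a ** transpose K) = trace (transpose K ** (K ** sym_polar p q a))"
    by (rule trace_mul_sym)
  also have "\<dots> = trace (sym_polar p q a)"
    by (simp add: matrix_mul_assoc orth_mat_left[OF assms(1)])
  finally have s: "p' + q' = p + q" unfolding eq[symmetric] tr .
  have "det K * det K = 1"
    using arg_cong[OF assms(1)[unfolded orth_mat_def], of det] by (simp add: det_mul det_transpose)
  hence d: "p' * q' = p * q"
    using arg_cong[OF eq, of det] by (simp add: det_mul det_transpose dt)
  have "(p' - q')\<^sup>2 = (p - q)\<^sup>2" using s d by algebra
  hence "p' - q' = p - q" using assms(2,3) by (simp add: power2_eq_iff_nonneg)
  thus ?thesis using s by auto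
qed

text \<open>The sign comes from the transposed rotation on the left of A and is the reason why the
  two angles move in opposite directions. The eigenvalue with b2 stands first because it is the
  larger one.\<close>

lemma arc_A_polar: "arc_A (b1, b2) \<alpha> = sym_polar (exp (- b2)) (exp (- b1)) (- \<alpha>)"
  by (simp add: arc_A_def sym_polar_rot rot_half_rot rot_transpose)

lemma arc_C_polar: "arc_C (c1, c2) = sym_polar (exp c1) (exp c2) 0"
  by (simp add: arc_C_def sym_polar_0)

lemma arc_D_polar:
  "arc_D c (d1, d2) \<alpha> = arc_M c ** sym_polar (exp d1) (exp d2) \<alpha> ** transpose (arc_M c)"
  by (simp add: arc_D_def sym_polar_rot rot_half_rot matrix_mul_assoc)

lemma arc_M_nth [simp]:
  "arc_M (c1, c2) $ 1 $ 1 = 0" "arc_M (c1, c2) $ 1 $ 2 = sqrt (exp c1)"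
  "arc_M (c1, c2) $ 2 $ 1 = - sqrt (exp c2)" "arc_M (c1, c2) $ 2 $ 2 = 0"
  by (simp_all add: arc_M_def)

text \<open>The purpose of M: writing D = M N M^T turns D - C > 0 into N - Id > 0, so the logarithms
  of the eigenvalues of N are positive coordinates.\<close>

lemma arc_M_mult: "arc_M c ** transpose (arc_M c) = arc_C c"
  by (cases c) (simp add: mat2_eq arc_C_def)

lemma arc_M_invertible: "invertible (arc_M c)"
  by (cases c) (simp add: invertible_det_nz det_2)

lemma arc_M_congruent_inject:
  "arc_M c ** X ** transpose (arc_M c) = arc_M c ** Y ** transpose (arc_M c) \<Longrightarrow> X = Y"
proof -
  let ?M = "arc_M c"
  assume *: "?M ** X ** transpose ?M = ?M ** Y ** transpose ?M"
  have "X = matrix_inv ?M ** (?M ** X ** transpose ?M) ** transpose (matrix_inv ?M)" for X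
  proof -
    have "matrix_inv ?M ** (?M ** X ** transpose ?M) ** transpose (matrix_inv ?M)
      = (matrix_inv ?M ** ?M) ** X ** (transpose ?M ** transpose (matrix_inv ?M))"
      by (simp add: matrix_mul_assoc)
    thus ?thesis
      using invertible_matrix_inv[OF arc_M_invertible] transpose_invertible_inv[OF
          arc_M_invertible] by simp
  qed
  thus "X = Y" using * by metis
qed

section \<open>The 6-tuple of arc coordinates and its stabiliser\<close>

definition arc_tuple :: "arc_params \<Rightarrow> lag \<times> lag \<times> lag \<times> lag \<times> lag \<times> lag" where
  "arc_tuple = (\<lambda>(b, c, d, \<alpha>1, \<alpha>2). (mat_lag 0, mat_lag (arc_A b \<alpha>1), mat_lag (mat 1),
     mat_lag (arc_C c), mat_lag (arc_D c d \<alpha>2), infty_lag))"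

lemma arc_hexagon_arc_tuple: "arc_hexagon x = hexagon_of_tuple (arc_tuple x)"
  by (cases x) (simp add: arc_hexagon_def arc_tuple_def)

lemma chamber_closed_iff: "(x1, x2) \<in> chamber_closed \<longleftrightarrow> x1 \<ge> x2 \<and> x2 > 0"
  by (auto simp: chamber_closed_def chamber_def chamber_diag_def)

lemma maximal6_standard_iff:
  "maximal6 (mat_lag 0, mat_lag A, mat_lag (mat 1), mat_lag C, mat_lag D, infty_lag) \<longleftrightarrow>
    posdef_mat A \<and> posdef_mat (mat 1 - A) \<and> posdef_mat (C - mat 1) \<and> posdef_mat (D - C)"
proof -
  have "sym_mat C" if "posdef_mat (C - mat 1)"
    using posdef_sym[OF posdef_add[OF that posdef_one]] by simp
  thus ?thesis
    unfolding maximal6_def prod.case maximal_tuple_Cons sorted_wrt2[OF transp_maximal_triple]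
        sorted_wrt1
    by (auto simp: maximal_triple_infty posdef_sym)
qed

lemma arc_tuple_maximal6:
  assumes "x \<in> arc_domain" shows "maximal6 (arc_tuple x)"
proof -
  obtain b1 b2 c1 c2 d1 d2 \<alpha>1 \<alpha>2 where x: "x = ((b1, b2), (c1, c2), (d1, d2), \<alpha>1, \<alpha>2)"
    by (metis surj_pair)
  have bcd: "b1 \<ge> b2" "b2 > 0" "c1 \<ge> c2" "c2 > 0" "d1 \<ge> d2" "d2 > 0"
    using assms unfolding x arc_domain_def by (auto simp: chamber_closed_iff)
  let ?M = "arc_M (c1, c2)"
  have "arc_D (c1, c2) (d1, d2) \<alpha>2 - arc_C (c1, c2)
      = ?M ** (sym_polar (exp d1) (exp d2) \<alpha>2 - mat 1) ** transpose ?M"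
    unfolding arc_D_polar arc_M_mult[symmetric] by (simp add: matrix_mult_diff)
  moreover have "posdef_mat (?M ** (sym_polar (exp d1) (exp d2) \<alpha>2 - mat 1) ** transpose ?M)"
    by (intro posdef_congruent arc_M_invertible) (use bcd in \<open>simp add: sym_polar_diff_1\<close>)
  ultimately have "posdef_mat (arc_D (c1, c2) (d1, d2) \<alpha>2 - arc_C (c1, c2))" by simp
  thus ?thesis
    unfolding x arc_tuple_def prod.case maximal6_standard_iff arc_A_polar arc_C_polar
    using bcd by (simp add: sym_polar_diff_1 one_diff_sym_polar)
qed

lemma act6_affine_orth:
  assumes "orth_mat K"
  shows "act6 (affine_sp K 0) (mat_lag 0, mat_lag A, mat_lag (mat 1), mat_lag C, mat_lag D,
      infty_lag)
    = (mat_lag 0, mat_lag (K ** A ** transpose K), mat_lag (mat 1), mat_lag (K ** C ** transpose K),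
       mat_lag (K ** D ** transpose K), infty_lag)"
  using assms orth_mat_invertible[OF assms]
  by (simp add: act6_def affine_sp_mat_lag affine_sp_infty orth_mat_def)

text \<open>The stabiliser of the maximal triple (infinity, 0, Id) is O(2), acting by conjugation.\<close>

lemma act6_standard_iff:
  "(\<exists>g\<in>Sp4. (mat_lag 0, mat_lag A', mat_lag (mat 1), mat_lag C', mat_lag D', infty_lag)
     = act6 g (mat_lag 0, mat_lag A, mat_lag (mat 1), mat_lag C, mat_lag D, infty_lag)) \<longleftrightarrow>
   (\<exists>K. orth_mat K \<and> A' = K ** A ** transpose K \<and> C' = K ** C ** transpose K \<and> D' = K ** D **
       transpose K)"
proof
  assume "\<exists>K. orth_mat K \<and> A' = K ** A ** transpose K \<and> C' = K ** C ** transpose K \<and> D' = K ** D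
      ** transpose K"
  then obtain K where K: "orth_mat K" "A' = K ** A ** transpose K" "C' = K ** C ** transpose K"
      "D' = K ** D ** transpose K"
    by blast
  have "affine_sp K 0 \<in> Sp4" by (intro affine_sp_Sp4 orth_mat_invertible K(1) sym_0)
  thus "\<exists>g\<in>Sp4. (mat_lag 0, mat_lag A', mat_lag (mat 1), mat_lag C', mat_lag D', infty_lag)
     = act6 g (mat_lag 0, mat_lag A, mat_lag (mat 1), mat_lag C, mat_lag D, infty_lag)"
    using act6_affine_orth[OF K(1)] K by metis
next
  assume "\<exists>g\<in>Sp4. (mat_lag 0, mat_lag A', mat_lag (mat 1), mat_lag C', mat_lag D', infty_lag)
     = act6 g (mat_lag 0, mat_lag A, mat_lag (mat 1), mat_lag C, mat_lag D, infty_lag)"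
  then obtain g where g: "g \<in> Sp4" "act g infty_lag = infty_lag" "act g (mat_lag 0) = mat_lag 0"
    "act g (mat_lag (mat 1)) = mat_lag (mat 1)" "mat_lag A' = act g (mat_lag A)" "mat_lag C' = act
        g (mat_lag C)"
    "mat_lag D' = act g (mat_lag D)"
    unfolding act6_def by auto
  from g(1,2) obtain K S where K: "invertible K" "sym_mat S" "g = affine_sp K S" by (rule
      stab_infty)
  have "S = 0" using g(3) unfolding K(3) affine_sp_mat_lag[OF K(1)] by simp
  moreover have "orth_mat K" using g(4) \<open>S = 0\<close> unfolding K(3) affine_sp_mat_lag[OF K(1)] by (simp
      add: orth_mat_def)
  ultimately show "\<exists>K. orth_mat K \<and> A' = K ** A ** transpose K \<and> C' = K ** C ** transpose K \<and> D' =
      K ** D ** transpose K"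
    using g(5-7) unfolding K(3) affine_sp_mat_lag[OF K(1)] by auto
qed

text \<open>For c1 = c2 the matrix M is a multiple of the rotation through -pi/2, and for sin t = 0
  the rotation is plus or minus Id.\<close>

lemma arc_M_rot:
  assumes "c1 = c2 \<or> sin t = 0" shows "rot t ** arc_M (c1, c2) = arc_M (c1, c2) ** rot t"
  using assms by (auto simp: mat2_eq)

lemma arc_M_refl: "refl_mat ** arc_M c = - (arc_M c ** refl_mat)"
  by (cases c) (simp add: mat2_eq)

text \<open>Conjugating by K changes the polar form inside D by the same conjugation, because K commutes
  with M up to sign.\<close>

lemma conj_arc_D:
  assumes "c1 = c2 \<or> sin t = 0"
  shows "rot t ** arc_D (c1, c2) (d1, d2) \<alpha> ** transpose (rot t) = arc_D (c1, c2) (d1, d2) (\<alpha> + 2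
      * t)"
    "refl_mat ** arc_D c (d1, d2) \<alpha> ** transpose refl_mat = arc_D c (d1, d2) (- \<alpha>)"
proof -
  let ?M = "arc_M (c1, c2)" and ?N = "sym_polar (exp d1) (exp d2) \<alpha>"
  have "rot t ** arc_D (c1, c2) (d1, d2) \<alpha> ** transpose (rot t)
    = (rot t ** ?M) ** ?N ** transpose (rot t ** ?M)"
    unfolding arc_D_polar matrix_transpose_mul by (simp add: matrix_mul_assoc)
  also have "\<dots> = ?M ** (rot t ** ?N ** transpose (rot t)) ** transpose ?M"
    unfolding arc_M_rot[OF assms] matrix_transpose_mul by (simp add: matrix_mul_assoc)
  finally show "rot t ** arc_D (c1, c2) (d1, d2) \<alpha> ** transpose (rot t) = arc_D (c1, c2) (d1, d2)
      (\<alpha> + 2 * t)"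
    unfolding rot_sym_polar arc_D_polar .
next
  let ?M = "arc_M c" and ?N = "sym_polar (exp d1) (exp d2) \<alpha>"
  have "refl_mat ** arc_D c (d1, d2) \<alpha> ** transpose refl_mat
    = (refl_mat ** ?M) ** ?N ** transpose (refl_mat ** ?M)"
    unfolding arc_D_polar matrix_transpose_mul by (simp add: matrix_mul_assoc)
  also have "\<dots> = ?M ** (refl_mat ** ?N ** transpose refl_mat) ** transpose ?M"
    unfolding arc_M_refl transpose_uminus matrix_transpose_mul
    by (simp add: matrix_neg_mult matrix_mul_assoc)
  finally show "refl_mat ** arc_D c (d1, d2) \<alpha> ** transpose refl_mat = arc_D c (d1, d2) (- \<alpha>)"
    unfolding refl_sym_polar arc_D_polar .
qed

lemma conj_arc_C:
  assumes "c1 = c2 \<or> sin t = 0"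
  shows "rot t ** arc_C (c1, c2) ** transpose (rot t) = arc_C (c1, c2)"
    "refl_mat ** arc_C (c1, c2) ** transpose refl_mat = arc_C (c1, c2)"
proof -
  show "rot t ** arc_C (c1, c2) ** transpose (rot t) = arc_C (c1, c2)"
    using assms unfolding arc_C_polar rot_sym_polar
    by (auto simp: mat2_eq cos_double_sin sin_double)
  show "refl_mat ** arc_C (c1, c2) ** transpose refl_mat = arc_C (c1, c2)"
    unfolding arc_C_polar refl_sym_polar by simp
qed

lemma arc_A_eq_iff: "arc_A (b1, b2) \<alpha> = arc_A (b1, b2) \<beta> \<longleftrightarrow> b1 = b2 \<or> [\<alpha> = \<beta>] (rmod (2 * pi))"
  unfolding arc_A_polar sym_polar_eq_iff by auto

lemma arc_D_eq_iff: "arc_D c (d1, d2) \<alpha> = arc_D c (d1, d2) \<beta> \<longleftrightarrow> d1 = d2 \<or> [\<alpha> = \<beta>] (rmod (2 * pi))"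
proof -
  have "arc_D c (d1, d2) \<alpha> = arc_D c (d1, d2) \<beta> \<longleftrightarrow> sym_polar (exp d1) (exp d2) \<alpha> = sym_polar (exp
      d1) (exp d2) \<beta>"
    unfolding arc_D_polar using arc_M_congruent_inject by metis
  thus ?thesis by (simp add: sym_polar_eq_iff)
qed

lemma conj_arc_A:
  "rot t ** arc_A (b1, b2) \<alpha> ** transpose (rot t) = arc_A (b1, b2) (\<alpha> - 2 * t)"
  "refl_mat ** arc_A (b1, b2) \<alpha> ** transpose refl_mat = arc_A (b1, b2) (- \<alpha>)"
  unfolding arc_A_polar rot_sym_polar refl_sym_polar by (simp_all add: algebra_simps)

text \<open>Here t is the angle of the rotation part of the conjugating orthogonal matrix and e its
  determinant; if the eigenvalues of C are distinct, the rotation must be plus or minus the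
      identity.\<close>

lemma arc_tuple_equiv_iff:
  assumes x: "((b1, b2), (c1, c2), (d1, d2), \<alpha>1, \<alpha>2) \<in> arc_domain"
    and y: "((b1', b2'), (c1', c2'), (d1', d2'), \<beta>1, \<beta>2) \<in> arc_domain"
  shows "(\<exists>g\<in>Sp4. arc_tuple ((b1', b2'), (c1', c2'), (d1', d2'), \<beta>1, \<beta>2)
      = act6 g (arc_tuple ((b1, b2), (c1, c2), (d1, d2), \<alpha>1, \<alpha>2))) \<longleftrightarrow>
    b1' = b1 \<and> b2' = b2 \<and> c1' = c1 \<and> c2' = c2 \<and> d1' = d1 \<and> d2' = d2 \<and>
    (\<exists>t e. (e = 1 \<or> e = - 1) \<and> (c1 = c2 \<or> sin t = 0) \<and>
      (b1 = b2 \<or> [\<beta>1 = e * \<alpha>1 - 2 * t] (rmod (2 * pi))) \<and>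
      (d1 = d2 \<or> [\<beta>2 = e * \<alpha>2 + 2 * t] (rmod (2 * pi))))"
    (is "?L \<longleftrightarrow> ?R")
proof -
  have bcd: "b1 \<ge> b2" "c1 \<ge> c2" "d1 \<ge> d2" "b1' \<ge> b2'" "c1' \<ge> c2'" "d1' \<ge> d2'"
    using x y unfolding arc_domain_def by (auto simp: chamber_closed_iff)
  let ?A = "arc_A (b1, b2) \<alpha>1" and ?C = "arc_C (c1, c2)" and ?D = "arc_D (c1, c2) (d1, d2) \<alpha>2"
  let ?A' = "arc_A (b1', b2') \<beta>1" and ?C' = "arc_C (c1', c2')" and ?D' = "arc_D (c1', c2') (d1',
      d2') \<beta>2"
  have L: "?L \<longleftrightarrow> (\<exists>K. orth_mat K \<and> ?A' = K ** ?A ** transpose K \<and> ?C' = K ** ?C ** transpose K \<and>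
    ?D' = K ** ?D ** transpose K)"
    unfolding arc_tuple_def prod.case by (rule act6_standard_iff)
  have rr: "(rot t ** refl_mat) ** X ** transpose (rot t ** refl_mat)
      = rot t ** (refl_mat ** X ** transpose refl_mat) ** transpose (rot t)" for t X
    unfolding matrix_transpose_mul by (simp add: matrix_mul_assoc)
  show ?thesis
  proof
    assume ?L
    then obtain K where K: "orth_mat K" "?A' = K ** ?A ** transpose K" "?C' = K ** ?C ** transpose
        K"
      "?D' = K ** ?D ** transpose K" unfolding L by blast
    have "exp (- b2') = exp (- b2) \<and> exp (- b1') = exp (- b1)"
      using sym_polar_eigenvalues[OF K(1) _ _ K(2)[unfolded arc_A_polar]] bcd by simp
    hence b: "b1' = b1" "b2' = b2" by simp_all
    have "exp c1' = exp c1 \<and> exp c2' = exp c2"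
      using sym_polar_eigenvalues[OF K(1) _ _ K(3)[unfolded arc_C_polar]] bcd by simp
    hence c: "c1' = c1" "c2' = c2" by simp_all
    have ct: "(c1 = c2 \<or> sin t = 0)" if "rot t ** ?C ** transpose (rot t) = ?C" for t
    proof -
      have "c1 = c2 \<or> [2 * t = 0] (rmod (2 * pi))"
        using that unfolding arc_C_polar rot_sym_polar sym_polar_eq_iff by simp
      thus ?thesis
      proof
        assume "[2 * t = 0] (rmod (2 * pi))"
        hence "cos (2 * t) = 1" unfolding cis_eq_iff[symmetric] by (simp add: complex_eq_iff)
        thus ?thesis by (simp add: cos_double_sin)
      qed simp
    qed
    from K(1) obtain t e where te: "e = 1 \<or> e = -1" "c1 = c2 \<or> sin t = 0"
      "?A' = arc_A (b1, b2) (e * \<alpha>1 - 2 * t)" "?D' = arc_D (c1, c2) (d1, d2) (e * \<alpha>2 + 2 * t)"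
    proof (cases rule: orth_mat_cases)
      case (1 t)
      have s: "c1 = c2 \<or> sin t = 0" by (rule ct) (use K(3) in \<open>simp add: c 1\<close>)
      show ?thesis using that[of 1 t] K s unfolding 1 conj_arc_A conj_arc_D(1)[OF s] by simp
    next
      case (2 t)
      \<comment> \<open>The reflection fixes the diagonal matrix C, so the rotation factor has to
        fix it as well.\<close>
      have s: "c1 = c2 \<or> sin t = 0"
        by (rule ct) (use K(3)[unfolded c 2 rr] conj_arc_C(2) in \<open>metis sin_zero\<close>)
      show ?thesis using that[of "-1" t] K s
        unfolding 2 rr conj_arc_A conj_arc_D(2)[OF s] conj_arc_D(1)[OF s] by simp
    qed
    have "?D' = arc_M (c1, c2) ** sym_polar (exp d1) (exp d2) (e * \<alpha>2 + 2 * t) ** transpose (arc_M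
        (c1, c2))"
      using te(4) unfolding arc_D_polar .
    hence "sym_polar (exp d1') (exp d2') \<beta>2 = sym_polar (exp d1) (exp d2) (e * \<alpha>2 + 2 * t)"
      unfolding c arc_D_polar by (rule arc_M_congruent_inject)
    hence "exp d1' = exp d1 \<and> exp d2' = exp d2"
      using sym_polar_eigenvalues[of "rot 0" "exp d2" "exp d1" "exp d2'" "exp d1'" \<beta>2 "e * \<alpha>2 + 2
          * t"] bcd
      by (simp add: transpose_mat orth_mat_def)
    hence d: "d1' = d1" "d2' = d2" by simp_all
    show ?R using te unfolding b c d arc_A_eq_iff arc_D_eq_iff by blast
  next
    assume ?R
    then obtain t e where eq: "b1' = b1" "b2' = b2" "c1' = c1" "c2' = c2" "d1' = d1" "d2' = d2"
      and te: "e = 1 \<or> e = - 1" "c1 = c2 \<or> sin t = 0"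
      "b1 = b2 \<or> [\<beta>1 = e * \<alpha>1 - 2 * t] (rmod (2 * pi))"
      "d1 = d2 \<or> [\<beta>2 = e * \<alpha>2 + 2 * t] (rmod (2 * pi))" by blast
    note A = te(3)[folded arc_A_eq_iff] and D = te(4)[folded arc_D_eq_iff[of "(c1, c2)"]]
    from te(1) show ?L
    proof
      assume e: "e = 1"
      show ?L unfolding L unfolding eq
        by (rule exI[of _ "rot t"]) (simp add: conj_arc_A conj_arc_C[OF te(2)] conj_arc_D[OF
            te(2)] A D e)
    next
      assume e: "e = - 1"
      show ?L unfolding L unfolding eq
        by (rule exI[of _ "rot t ** refl_mat"], unfold rr)
          (simp add: orth_mat_mult conj_arc_A conj_arc_C[OF te(2)] conj_arc_D[OF te(2)] A D e)
    qed
  qed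
qed

section \<open>Angles modulo 2 pi and the generated relation\<close>

lemma rcong_iff: "[x = y] (rmod (2 * pi)) \<longleftrightarrow> (\<exists>n :: int. y = x + of_int n * (2 * pi))"
  by (rule rcong_altdef)

lemma rcong_domain_eq:
  assumes "[x = y] (rmod (2 * pi))" "x \<in> {0..<2 * pi}" "y \<in> {0..<2 * pi}" shows "x = y"
proof -
  have "z rmod (2 * pi) = z" if "z \<in> {0..<2 * pi}" for z
    by (rule rmod_idem) (use that in simp)
  thus ?thesis using assms unfolding rcong_def by metis
qed

lemma rmod_2pi_domain: "x rmod (2 * pi) \<in> {0..<2 * pi}"
  using rmod_less[of "2 * pi" x] rmod_nonneg[of "2 * pi" x] by simp

lemma rmod_2pi_rcong: "[x rmod (2 * pi) = x] (rmod (2 * pi))"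
  by (simp add: rcong_def)

text \<open>Each generator comes from one orthogonal matrix: \<open>reflect\<close> from the
  reflection, \<open>c_diag\<close> from a rotation, and \<open>b_diag\<close> and
  \<open>d_diag\<close> from Id, because the angle concerned does not enter the matrix.\<close>

lemma arc_step_equivalent:
  assumes "arc_step x y"
  shows "x \<in> arc_domain \<and> y \<in> arc_domain \<and> (\<exists>g\<in>Sp4. arc_tuple y = act6 g (arc_tuple x))"
proof -
  have equiv: "\<exists>g\<in>Sp4. arc_tuple (b, c, d, \<beta>1, \<beta>2) = act6 g (arc_tuple (b, c, d, \<alpha>1, \<alpha>2))"
    if "(b, c, d, \<alpha>1, \<alpha>2) \<in> arc_domain" "(b, c, d, \<beta>1, \<beta>2) \<in> arc_domain"
      "e = 1 \<or> e = -1" "c \<in> chamber_diag \<or> sin t = 0"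
      "b \<in> chamber_diag \<or> [\<beta>1 = e * \<alpha>1 - 2 * t] (rmod (2 * pi))"
      "d \<in> chamber_diag \<or> [\<beta>2 = e * \<alpha>2 + 2 * t] (rmod (2 * pi))"
    for b c d \<alpha>1 \<alpha>2 \<beta>1 \<beta>2 e t
  proof -
    obtain b1 b2 c1 c2 d1 d2 where bcd: "b = (b1, b2)" "c = (c1, c2)" "d = (d1, d2)"
      by (metis surj_pair)
    show ?thesis
      using that(3-6) unfolding bcd arc_tuple_equiv_iff[OF that(1,2)[unfolded bcd]]
      by (auto simp: chamber_diag_def)
  qed
  show ?thesis using assms
  proof cases
    case (reflect \<beta>1 \<alpha>1 \<beta>2 \<alpha>2 b c d)
    have "[\<beta> = - 1 * \<alpha> - 2 * 0] (rmod (2 * pi))" "[\<beta> = - 1 * \<alpha> + 2 * 0] (rmod (2 * pi))"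
      if "[\<beta> = 2 * pi - \<alpha>] (rmod (2 * pi))" for \<alpha> \<beta>
    proof -
      obtain n :: int where "2 * pi - \<alpha> = \<beta> + of_int n * (2 * pi)" using \<open>[\<beta> = _] (rmod _)\<close>
          unfolding rcong_iff by blast
      hence "- \<alpha> = \<beta> + of_int (n - 1) * (2 * pi)"
        unfolding of_int_diff of_int_1 left_diff_distrib by linarith
      hence "[\<beta> = - \<alpha>] (rmod (2 * pi))" unfolding rcong_iff by blast
      thus "[\<beta> = - 1 * \<alpha> - 2 * 0] (rmod (2 * pi))" "[\<beta> = - 1 * \<alpha> + 2 * 0] (rmod (2 * pi))"
        by simp_all
    qed
    thus ?thesis using equiv[of b c d \<alpha>1 \<alpha>2 \<beta>1 \<beta>2 "-1" 0] reflect by simp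
  next
    case (b_diag b c d \<alpha>1 \<alpha>2 \<beta>1)
    thus ?thesis using equiv[of b c d \<alpha>1 \<alpha>2 \<beta>1 \<alpha>2 1 0] by simp
  next
    case (c_diag c \<beta>1 \<beta>2 \<alpha>1 \<alpha>2 b d)
    have h: "[\<beta>2 = \<alpha>2 + (\<alpha>1 - \<beta>1)] (rmod (2 * pi))"
      using c_diag(4) unfolding rcong_iff by (auto simp: algebra_simps)
    \<comment> \<open>The half appears because a rotation through t shifts the angles by -2t and
      2t.\<close>
    define t where "t = (\<alpha>1 - \<beta>1) / 2"
    have e: "1 * \<alpha>1 - 2 * t = \<beta>1" "1 * \<alpha>2 + 2 * t = \<alpha>2 + (\<alpha>1 - \<beta>1)"
      by (simp_all add: t_def field_simps)
    show ?thesis using equiv[of b c d \<alpha>1 \<alpha>2 \<beta>1 \<beta>2 1 t, unfolded e] h c_diag by simp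
  next
    case (d_diag d b c \<alpha>1 \<alpha>2 \<beta>2)
    thus ?thesis using equiv[of b c d \<alpha>1 \<alpha>2 \<alpha>1 \<beta>2 1 0] by simp
  qed
qed

lemma arc_map_eq_iff:
  assumes "x \<in> arc_domain" "y \<in> arc_domain"
  shows "arc_map x = arc_map y \<longleftrightarrow> (\<exists>g\<in>Sp4. arc_tuple y = act6 g (arc_tuple x))"
  unfolding arc_map_def arc_hexagon_arc_tuple
  by (rule PSp4_orbit_eq_iff) (intro arc_tuple_maximal6 assms)+

lemma equivclp_arc_map: "equivclp arc_step x y \<Longrightarrow> arc_map x = arc_map y"
proof (induction rule: equivclp_induct)
  case (step y z)
  have "arc_map u = arc_map v" if "arc_step u v" for u v
    using arc_step_equivalent[OF that] arc_map_eq_iff by blast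
  thus ?case using step by metis
qed simp

text \<open>The generators reproduce any admissible rotation in three moves: both angles shift by
  -2t and 2t through \<open>c_diag\<close>, then \<open>b_diag\<close> and \<open>d_diag\<close>
  correct an angle that the congruences leave open.\<close>

lemma arc_rel_rotate:
  assumes x: "(b, c, d, \<alpha>1, \<alpha>2) \<in> arc_domain" and y: "(b, c, d, \<beta>1, \<beta>2) \<in> arc_domain"
    and c: "c \<in> chamber_diag \<or> sin t = 0"
    and b: "b \<in> chamber_diag \<or> [\<beta>1 = \<alpha>1 - 2 * t] (rmod (2 * pi))"
    and d: "d \<in> chamber_diag \<or> [\<beta>2 = \<alpha>2 + 2 * t] (rmod (2 * pi))"
  shows "equivclp arc_step (b, c, d, \<alpha>1, \<alpha>2) (b, c, d, \<beta>1, \<beta>2)"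
proof -
  have dom: "(b, c, d, \<gamma>1, \<gamma>2) \<in> arc_domain" if "\<gamma>1 \<in> {0..<2 * pi}" "\<gamma>2 \<in> {0..<2 * pi}" for \<gamma>1 \<gamma>2
    using x that by (simp add: arc_domain_def)
  have \<alpha>: "\<alpha>1 \<in> {0..<2 * pi}" "\<alpha>2 \<in> {0..<2 * pi}" and \<beta>: "\<beta>1 \<in> {0..<2 * pi}" "\<beta>2 \<in> {0..<2 * pi}"
    using x y by (simp_all add: arc_domain_def)
  \<comment> \<open>The shifted angles are reduced modulo 2 pi, so that the intermediate parameters
    stay in \<open>arc_domain\<close>.\<close>
  define \<gamma>1 \<gamma>2 where "\<gamma>1 = (\<alpha>1 - 2 * t) rmod (2 * pi)" and "\<gamma>2 = (\<alpha>2 + 2 * t) rmod (2 * pi)"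
  have \<gamma>: "\<gamma>1 \<in> {0..<2 * pi}" "\<gamma>2 \<in> {0..<2 * pi}" unfolding \<gamma>1_def \<gamma>2_def by (rule rmod_2pi_domain)+
  have \<gamma>c: "[\<gamma>1 = \<alpha>1 - 2 * t] (rmod (2 * pi))" "[\<gamma>2 = \<alpha>2 + 2 * t] (rmod (2 * pi))"
    unfolding \<gamma>1_def \<gamma>2_def by (rule rmod_2pi_rcong)+
  have 1: "equivclp arc_step (b, c, d, \<alpha>1, \<alpha>2) (b, c, d, \<gamma>1, \<gamma>2)"
  proof (cases "c \<in> chamber_diag")
    case True
    have "[\<gamma>1 + \<gamma>2 = (\<alpha>1 - 2 * t) + (\<alpha>2 + 2 * t)] (rmod (2 * pi))" using \<gamma>c by (rule rcong_add)
    hence "[\<gamma>1 + \<gamma>2 = \<alpha>1 + \<alpha>2] (rmod (2 * pi))" by simp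
    thus ?thesis using True x dom[OF \<gamma>] by (intro r_into_equivclp arc_step.c_diag)
  next
    case False
    \<comment> \<open>When C is not scalar, t is a multiple of pi and the shift by 2t is invisible
      modulo 2 pi.\<close>
    then obtain n :: int where n: "t = of_int n * pi" using c by (auto simp: sin_zero_iff_int2)
    have "[\<alpha>1 = \<alpha>1 - 2 * t] (rmod (2 * pi))" "[\<alpha>2 = \<alpha>2 + 2 * t] (rmod (2 * pi))"
      unfolding rcong_iff n by (rule exI[of _ "-n"], simp, rule exI[of _ n], simp)
    hence "[\<gamma>1 = \<alpha>1] (rmod (2 * pi))" "[\<gamma>2 = \<alpha>2] (rmod (2 * pi))"
      using \<gamma>c by (simp_all add: rcong_def)
    hence "\<gamma>1 = \<alpha>1" "\<gamma>2 = \<alpha>2" using rcong_domain_eq \<alpha> \<gamma> by blast+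
    thus ?thesis by simp
  qed
  have 2: "equivclp arc_step (b, c, d, \<gamma>1, \<gamma>2) (b, c, d, \<beta>1, \<gamma>2)"
  proof (cases "b \<in> chamber_diag")
    case True
    thus ?thesis by (intro r_into_equivclp arc_step.b_diag dom \<gamma> \<beta>)
  next
    case False
    hence "[\<gamma>1 = \<beta>1] (rmod (2 * pi))" using b \<gamma>c(1) by (simp add: rcong_def)
    hence "\<gamma>1 = \<beta>1" using rcong_domain_eq \<gamma> \<beta> by blast
    thus ?thesis by simp
  qed
  have 3: "equivclp arc_step (b, c, d, \<beta>1, \<gamma>2) (b, c, d, \<beta>1, \<beta>2)"
  proof (cases "d \<in> chamber_diag")
    case True
    thus ?thesis by (intro r_into_equivclp arc_step.d_diag dom \<gamma> \<beta>)
  next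
    case False
    hence "[\<gamma>2 = \<beta>2] (rmod (2 * pi))" using d \<gamma>c(2) by (simp add: rcong_def)
    hence "\<gamma>2 = \<beta>2" using rcong_domain_eq \<gamma> \<beta> by blast
    thus ?thesis by simp
  qed
  show ?thesis by (rule equivclp_trans[OF equivclp_trans[OF 1 2] 3])
qed

lemma arc_map_eq_imp_arc_rel:
  assumes x: "x \<in> arc_domain" and y: "y \<in> arc_domain" and eq: "arc_map x = arc_map y"
  shows "(x, y) \<in> arc_rel"
proof -
  obtain b1 b2 c1 c2 d1 d2 \<alpha>1 \<alpha>2 where x': "x = ((b1, b2), (c1, c2), (d1, d2), \<alpha>1, \<alpha>2)" by (metis
      surj_pair)
  obtain b1' b2' c1' c2' d1' d2' \<beta>1 \<beta>2 where y': "y = ((b1', b2'), (c1', c2'), (d1', d2'), \<beta>1,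
      \<beta>2)" by (metis surj_pair)
  obtain t e where eqs: "b1' = b1" "b2' = b2" "c1' = c1" "c2' = c2" "d1' = d1" "d2' = d2"
    and te: "e = 1 \<or> e = - 1" "c1 = c2 \<or> sin t = 0"
    "b1 = b2 \<or> [\<beta>1 = e * \<alpha>1 - 2 * t] (rmod (2 * pi))"
    "d1 = d2 \<or> [\<beta>2 = e * \<alpha>2 + 2 * t] (rmod (2 * pi))"
    using eq[unfolded arc_map_eq_iff[OF x y], unfolded x' y' arc_tuple_equiv_iff[OF x[unfolded x']
        y[unfolded y']]]
    by blast
  define b c d where bcd: "b = (b1, b2)" "c = (c1, c2)" "d = (d1, d2)"
  have diag: "b1 = b2 \<longleftrightarrow> b \<in> chamber_diag" "c1 = c2 \<longleftrightarrow> c \<in> chamber_diag" "d1 = d2 \<longleftrightarrow> d \<in> chamber_diag"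
    using x unfolding x' bcd arc_domain_def by (auto simp: chamber_diag_def chamber_closed_iff)
  have X: "x = (b, c, d, \<alpha>1, \<alpha>2)" and Y: "y = (b, c, d, \<beta>1, \<beta>2)" unfolding x' y' eqs bcd by simp_all
  note te' = te[unfolded diag]
  from te(1) have "equivclp arc_step x y"
  proof
    assume "e = 1"
    thus ?thesis unfolding X Y using x y te' by (intro arc_rel_rotate[of _ _ _ _ _ _ _ t])
        (simp_all add: X Y)
  next
    assume e: "e = - 1"
    \<comment> \<open>Determinant -1 is a reflection followed by a rotation: a
      \<open>reflect\<close> step leads to these angles, and the rotation case does the
      rest.\<close>
    define \<gamma>1 \<gamma>2 where "\<gamma>1 = (2 * pi - \<alpha>1) rmod (2 * pi)" and "\<gamma>2 = (2 * pi - \<alpha>2) rmod (2 * pi)"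
    have \<gamma>: "\<gamma>1 \<in> {0..<2 * pi}" "\<gamma>2 \<in> {0..<2 * pi}" unfolding \<gamma>1_def \<gamma>2_def by (rule
        rmod_2pi_domain)+
    have \<gamma>c: "[\<gamma>1 = 2 * pi - \<alpha>1] (rmod (2 * pi))" "[\<gamma>2 = 2 * pi - \<alpha>2] (rmod (2 * pi))"
      unfolding \<gamma>1_def \<gamma>2_def by (rule rmod_2pi_rcong)+
    have dom: "(b, c, d, \<gamma>1, \<gamma>2) \<in> arc_domain" using x \<gamma> unfolding X by (simp add: arc_domain_def)
    have r: "equivclp arc_step x (b, c, d, \<gamma>1, \<gamma>2)"
      unfolding X by (intro r_into_equivclp arc_step.reflect \<gamma>c dom x[unfolded X])
    have shift: "[\<beta> = \<gamma> + s] (rmod (2 * pi))"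
      if h: "[\<beta> = - 1 * \<alpha> + s] (rmod (2 * pi))" "[\<gamma> = 2 * pi - \<alpha>] (rmod (2 * pi))" for \<alpha> \<beta> \<gamma> s
    proof -
      obtain m n :: int where "- 1 * \<alpha> + s = \<beta> + of_int m * (2 * pi)" "2 * pi - \<alpha> = \<gamma> + of_int n *
          (2 * pi)"
        using h unfolding rcong_iff by blast
      hence "\<gamma> + s = \<beta> + of_int (m + 1 - n) * (2 * pi)"
        unfolding of_int_diff of_int_add of_int_1 left_diff_distrib distrib_right by linarith
      thus ?thesis unfolding rcong_iff by blast
    qed
    have "equivclp arc_step (b, c, d, \<gamma>1, \<gamma>2) y"
      unfolding Y
    proof (rule arc_rel_rotate[OF dom y[unfolded Y] te'(2)])
      show "b \<in> chamber_diag \<or> [\<beta>1 = \<gamma>1 - 2 * t] (rmod (2 * pi))"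
        using te'(3) shift[OF _ \<gamma>c(1), of \<beta>1 "- (2 * t)"] unfolding e by auto
      show "d \<in> chamber_diag \<or> [\<beta>2 = \<gamma>2 + 2 * t] (rmod (2 * pi))"
        using te'(4) shift[OF _ \<gamma>c(2), of \<beta>2 "2 * t"] unfolding e by auto
    qed
    with r show ?thesis by (rule equivclp_trans)
  qed
  thus ?thesis using x y by (simp add: arc_rel_def)
qed

text \<open>Diagonalising C uses up the freedom in O(2) that normalising the triple leaves. Polar
  forms of A and of D pulled back through M then supply the remaining coordinates without any
  further motion.\<close>

lemma maximal6_arc_tuple_exists:
  assumes "maximal6 t"
  obtains x g where "x \<in> arc_domain" "g \<in> Sp4" "arc_tuple x = act6 g t"
proof -
  obtain p2 q2 p4 p5 q5 p1 where t: "t = (p2, q2, p4, p5, q5, p1)" by (cases t)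
  have "maximal_triple p1 p2 p4" using assms unfolding t maximal6_def maximal_tuple_Cons by simp
  then obtain g where g: "g \<in> Sp4" "act g p1 = infty_lag" "act g p2 = mat_lag 0" "act g p4 =
      mat_lag (mat 1)"
    by (rule maximal_triple_normalize)
  have m: "maximal6 (act6 g t)" using g(1) assms by (rule maximal6_act(1))
  have lag: "\<exists>X. act g l = mat_lag X" if "maximal_triple infty_lag (mat_lag 0) (act g l)" for l
    using that unfolding maximal_triple_infty_iff by blast
  obtain A C D where ACD: "act g q2 = mat_lag A" "act g p5 = mat_lag C" "act g q5 = mat_lag D"
  proof -
    have "maximal_triple infty_lag (mat_lag 0) (act g q2)" "maximal_triple infty_lag (mat_lag 0)
        (act g p5)"
      "maximal_triple infty_lag (mat_lag 0) (act g q5)"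
      using m unfolding t maximal6_def act6_def prod.case maximal_tuple_Cons g by auto
    from this[THEN lag] show ?thesis using that by blast
  qed
  have gt: "act6 g t = (mat_lag 0, mat_lag A, mat_lag (mat 1), mat_lag C, mat_lag D, infty_lag)"
    by (simp add: t act6_def g ACD)
  note pd = m[unfolded gt maximal6_standard_iff]
  have "posdef_mat C" using pd posdef_add[of "C - mat 1" "mat 1"] by simp
  then obtain p q a where C: "p \<ge> q" "C = sym_polar p q a"
    using sym_polar_exists posdef_sym by metis
  \<comment> \<open>Turning by -a/2 shifts the polar angle of C from a to 0.\<close>
  define K where "K = rot (- a / 2)"
  have K: "orth_mat K" "invertible K" unfolding K_def by (simp_all add: rot_invertible)
  define A' D' where "A' = K ** A ** transpose K" and "D' = K ** D ** transpose K"
  have C': "K ** C ** transpose K = diag2 p q" unfolding C K_def rot_sym_polar by (simp add: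
      sym_polar_0)
  define h where "h = affine_sp K 0 ** g"
  have h: "h \<in> Sp4" unfolding h_def by (intro Sp4_mult g(1) affine_sp_Sp4 K(2) sym_0)
  have ht: "act6 h t = (mat_lag 0, mat_lag A', mat_lag (mat 1), mat_lag (diag2 p q), mat_lag D',
      infty_lag)"
    unfolding h_def act6_act6[symmetric] gt act6_affine_orth[OF K(1)] A'_def D'_def C' ..
  note pd' = maximal6_act(1)[OF h assms, unfolded ht maximal6_standard_iff]
  have pq: "p > 1" "q > 1" using pd' by (simp_all add: diag2_one diag2_diff)
  obtain p' q' a' where A: "p' \<ge> q'" "0 \<le> a'" "a' < 2 * pi" "A' = sym_polar p' q' a'"
    using sym_polar_exists pd' posdef_sym by metis
  have pq': "p' > 0" "q' > 0" "p' < 1" "q' < 1" using pd' unfolding A by (simp_all add: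
      one_diff_sym_polar)
  define c where "c = (ln p, ln q)"
  have arcC: "arc_C c = diag2 p q" using pq by (simp add: arc_C_def c_def)
  define L where "L = matrix_inv (arc_M c)"
  have L: "arc_M c ** L = mat 1" "transpose L ** transpose (arc_M c) = mat 1" "L ** arc_M c = mat 1"
    unfolding L_def using invertible_matrix_inv[OF arc_M_invertible] transpose_invertible_inv[OF
        arc_M_invertible] by auto
  have Linv: "invertible L" unfolding invertible_def using L(1,3) by blast
  \<comment> \<open>D' pulled back through M; the same congruence sends C to Id, so N - Id is
    positive definite.\<close>
  define N where "N = L ** D' ** transpose L"
  have one: "L ** arc_C c ** transpose L = mat 1"
  proof -
    have "L ** arc_C c ** transpose L = (L ** arc_M c) ** transpose (L ** arc_M c)"
      unfolding arc_M_mult[symmetric] matrix_transpose_mul by (simp add: matrix_mul_assoc)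
    thus ?thesis by (simp add: L transpose_mat)
  qed
  have "posdef_mat (L ** (D' - arc_C c) ** transpose L)"
    by (intro posdef_congruent Linv) (use pd' arcC in simp)
  hence N1: "posdef_mat (N - mat 1)" unfolding N_def one[symmetric] by (simp add: matrix_mult_diff)
  have D'N: "D' = arc_M c ** N ** transpose (arc_M c)"
  proof -
    have "arc_M c ** N ** transpose (arc_M c) = (arc_M c ** L) ** D' ** (transpose L ** transpose
        (arc_M c))"
      unfolding N_def by (simp add: matrix_mul_assoc)
    thus ?thesis by (simp add: L)
  qed
  have "sym_mat N" using posdef_sym[OF posdef_add[OF N1 posdef_one]] by simp
  then obtain p'' q'' a'' where N: "p'' \<ge> q''" "0 \<le> a''" "a'' < 2 * pi" "N = sym_polar p'' q'' a''"
    by (rule sym_polar_exists)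
  have pq'': "p'' > 1" "q'' > 1" using N1 unfolding N by (simp_all add: sym_polar_diff_1)
  \<comment> \<open>The eigenvalues of A' lie in (0, 1), and -ln reverses their order; hence the
    smaller eigenvalue gives the first coordinate of b.\<close>
  define b d where "b = (- ln q', - ln p')" and "d = (ln p'', ln q'')"
  \<comment> \<open>The sign undoes the one in \<open>arc_A_polar\<close>, and the reduction returns
    the angle to [0, 2 pi).\<close>
  define \<alpha>1 where "\<alpha>1 = (- a') rmod (2 * pi)"
  have \<alpha>1: "\<alpha>1 \<in> {0..<2 * pi}" unfolding \<alpha>1_def by (rule rmod_2pi_domain)
  have "arc_A b \<alpha>1 = arc_A b (- a')"
    unfolding b_def arc_A_eq_iff \<alpha>1_def by (rule disjI2) (rule rmod_2pi_rcong)
  hence "arc_A b \<alpha>1 = A'" unfolding A b_def arc_A_polar using pq' by simp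
  moreover have "arc_D c d a'' = D'"
    unfolding D'N N d_def arc_D_polar using pq'' by simp
  ultimately have "arc_tuple (b, c, d, \<alpha>1, a'') = act6 h t"
    unfolding arc_tuple_def prod.case ht arcC by simp
  moreover have "(b, c, d, \<alpha>1, a'') \<in> arc_domain"
    unfolding arc_domain_def b_def c_def d_def
    using \<alpha>1 N A(1) C(1) pq pq' pq'' by (simp add: chamber_closed_iff)
  ultimately show ?thesis using that h by blast
qed

theorem theorem4p25:
  shows "\<exists>F :: arc_params set \<Rightarrow> ordered_hexagon set.
    (\<forall>x\<in>arc_domain. arc_hexagon x \<in> ordered_hexagons \<and> F (arc_rel `` {x}) = arc_map x) \<and>
    bij_betw F arc_space hexagon_moduli"
proof -
  \<comment> \<open>\<open>arc_map\<close> is constant on each class, so the image of a class is a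
    singleton and \<open>the_elem\<close> picks the common value.\<close>
  define F where "F X = the_elem (arc_map ` X)" for X
  have rel: "(x, y) \<in> arc_rel \<longleftrightarrow> x \<in> arc_domain \<and> y \<in> arc_domain \<and> arc_map x = arc_map y" for x y
  proof
    assume "(x, y) \<in> arc_rel"
    hence "x \<in> arc_domain" "y \<in> arc_domain" "equivclp arc_step x y" unfolding arc_rel_def by blast+
    thus "x \<in> arc_domain \<and> y \<in> arc_domain \<and> arc_map x = arc_map y" using equivclp_arc_map by blast
  qed (blast intro: arc_map_eq_imp_arc_rel)
  have F: "F (arc_rel `` {x}) = arc_map x" if "x \<in> arc_domain" for x
  proof -
    have "arc_map ` (arc_rel `` {x}) = {arc_map x}" using that by (auto simp: rel)
    thus ?thesis by (simp add: F_def)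
  qed
  have hex: "arc_hexagon x \<in> ordered_hexagons" if "x \<in> arc_domain" for x
    unfolding arc_hexagon_arc_tuple using that by (intro maximal6_ordered arc_tuple_maximal6)
  have "inj_on F arc_space"
  proof (rule inj_onI)
    fix X Y assume "X \<in> arc_space" "Y \<in> arc_space" "F X = F Y"
    then obtain x y where xy: "x \<in> arc_domain" "y \<in> arc_domain" "X = arc_rel `` {x}" "Y = arc_rel
        `` {y}"
      by (auto simp: arc_space_def elim!: quotientE)
    hence "(x, y) \<in> arc_rel" using \<open>F X = F Y\<close> by (simp add: rel F)
    thus "X = Y" unfolding xy by (rule equiv_class_eq[OF equiv_arc_rel])
  qed
  moreover have "F ` arc_space = hexagon_moduli"
  proof -
    have sp: "arc_space = (\<lambda>x. arc_rel `` {x}) ` arc_domain"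
      unfolding arc_space_def quotient_def by blast
    have "F ` arc_space = (\<lambda>x. F (arc_rel `` {x})) ` arc_domain" unfolding sp by (rule image_image)
    also have "\<dots> = arc_map ` arc_domain" by (rule image_cong[OF refl F])
    also have "\<dots> = hexagon_moduli"
    proof
      show "arc_map ` arc_domain \<subseteq> hexagon_moduli"
        unfolding arc_map_def hexagon_moduli_def using hex by blast
      show "hexagon_moduli \<subseteq> arc_map ` arc_domain"
      proof
        fix h assume "h \<in> hexagon_moduli"
        then obtain t where t: "maximal6 t" "h = PSp4_orbit (hexagon_of_tuple t)"
          unfolding hexagon_moduli_def using ordered_hexagon_maximal6 by blast
        obtain x g where x: "x \<in> arc_domain" "g \<in> Sp4" "arc_tuple x = act6 g t"
          using maximal6_arc_tuple_exists[OF t(1)] .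
        have "h = arc_map x"
          unfolding t(2) arc_map_def arc_hexagon_arc_tuple
          using PSp4_orbit_eq_iff[OF t(1) arc_tuple_maximal6[OF x(1)]] x by blast
        thus "h \<in> arc_map ` arc_domain" using x(1) by blast
      qed
    qed
    finally show ?thesis .
  qed
  ultimately have "bij_betw F arc_space hexagon_moduli" unfolding bij_betw_def by blast
  thus ?thesis using F hex by (intro exI[of _ F] conjI ballI)
qed

end
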